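(* Let $\mathcal{O}\subseteq\mathbb{R}^n$ be open (not necessarily convex) and let $\mathcal{X}$ be an open subset of $\mathbb{R}^{k+1}$ or of $\mathbb{R}\times\mathbb{T}^k$. Let $\alpha\in(0,1)$ with $\alpha>\frac13$, let $G\in C^2(\mathcal{O};\mathbb{M}^{n\times(k+1)})$, and let $U\in B^{\alpha}_{3,\infty}(\mathcal{X};\mathcal{O})$ be a weak solution of $$\operatorname{div}_X\big(G(U(X))\big)=0\quad\text{in }\mathcal{X}.$$ Assume that there are $Q\in C(\mathcal{O};\mathbb{M}^{1\times(k+1)})$ and $\mathcal{B}\in C^1(\mathcal{O};\mathbb{M}^{1\times n})$ such that $$D_UQ_j(U)=\mathcal{B}(U)\,D_UG_j(U)\quad\text{for all }U\in\mathcal{O},\ j\in\{0,\dots,k\},$$ and that the essential range of $U$ is a compact subset of $\mathcal{O}$. Then $U$ is a weak solution of the companion law $\operatorname{div}_X\big(Q(U(X))\big)=0$ in $\mathcal{X}$.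
   Context: $\mathbb{T}^k$ is the flat torus of dimension $k$; $\mathbb{M}^{a\times b}$ is the space of real $a\times b$ matrices. Coordinates on $\mathcal{X}$ are $X=(x_0,\dots,x_k)^T$. The columns of a matrix field $M$ with $k+1$ columns are $M_0,\dots,M_k$, and $\operatorname{div}_XM(X)=\sum_{j=0}^k\partial_{x_j}M_j(X)$. $D_X=(\partial_{x_0},\dots,\partial_{x_k})$, and $D_U$ is the differential with respect to $U\in\mathcal{O}$; thus $D_UG_j(U)$ is an $n\times n$ matrix and $D_UQ_j(U)$ is a $1\times n$ row. The essential range of $U$ is the set of $y\in\mathbb{R}^n$ such that $\{X\in\mathcal{X}:|U(X)-y|<r\}$ has positive Lebesgue measure for every $r>0$. Weak solution: a function $U:\mathcal{X}\to\mathcal{O}$ is a weak solution of $\operatorname{div}_X(G(U(X)))=0$ if $G(U)$ is locally integrable in $\mathcal{X}$ and $\int_{\mathcal{X}}G(U(X)):D_X\psi(X)\,dX=0$ for all smooth $\psi:\mathcal{X}\to\mathbb{R}^n$ with compact support in $\mathcal{X}$, where $A:B=\sum_{i,j}A_{ij}B_{ij}$. Weak solutions of $\operatorname{div}_X(Q(U(X)))=0$ are defined in the same way with $Q$ in place of $G$ and scalar test functions $\psi:\mathcal{X}\to\mathbb{R}$. Besov space: for $\alpha\in(0,1)$ and $q\in[1,\infty)$, $B^\alpha_{q,\infty}(\mathcal{X})$ is the set of $U\in L^q(\mathcal{X})$ with $\sup_{\xi\ne0}|\xi|^{-\alpha}\|U(\cdot)-U(\cdot-\xi)\|_{L^q(\mathcal{X}\cap(\mathcal{X}+\xi))}<\infty$,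 where $\xi$ ranges over $\mathbb{R}^{k+1}$ (acting by translation modulo periods in torus directions). $B^\alpha_{q,\infty}(\mathcal{X};\mathcal{O})$ denotes $\mathcal{O}$-valued functions whose components all lie in $B^\alpha_{q,\infty}(\mathcal{X})$. *)

theory Defs
  imports "HOL-Analysis.Analysis"
begin

section \<open>Functions of class \<open>C\<^sup>k\<close> on an open set\<close>

fun Ck_on :: "nat \<Rightarrow> ('a::euclidean_space \<Rightarrow> 'b::euclidean_space) \<Rightarrow> 'a set \<Rightarrow> bool" where
  "Ck_on 0 f S \<longleftrightarrow> continuous_on S f"
| "Ck_on (Suc k) f S \<longleftrightarrow> (\<forall>x\<in>S. f differentiable (at x)) \<and>
     (\<forall>v. Ck_on k (\<lambda>x. frechet_derivative f (at x) v) S)"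


section \<open>Euclidean and partially periodic domains\<close>

text \<open>
  The set \<open>J\<close> contains the indices of the torus directions, each torus factor being
  \<open>\<real>/\<int>\<close>.  Points of the quotient of \<open>\<real>\<^sup>d\<close> by the lattice \<open>periods J\<close> are represented by
  their preimages in \<open>\<real>\<^sup>d\<close>: an open subset of the quotient is a lattice-invariant open set
  \<open>X\<close>, a function on it is a lattice-invariant function on \<open>X\<close>, and integration over it is
  integration over the points of \<open>X\<close> in the unit cell.  For \<open>J = {}\<close> the lattice is \<open>{0}\<close>,
  the cell is the whole space, and all notions below are the plain ones on \<open>\<real>\<^sup>d\<close>.
\<close>

definition periods :: "'d::finite set \<Rightarrow> (real^'d) set" where
  "periods J = {v. \<forall>j. if j \<in> J then v $ j \<in> \<int> else v $ j = 0}"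

definition unit_cell :: "'d::finite set \<Rightarrow> (real^'d) set" where
  "unit_cell J = {x. \<forall>j\<in>J. 0 \<le> x $ j \<and> x $ j < 1}"

definition open_domain :: "'d::finite set \<Rightarrow> (real^'d) set \<Rightarrow> bool" where
  "open_domain J X \<longleftrightarrow> open X \<and> (\<forall>v\<in>periods J. \<forall>x\<in>X. x + v \<in> X)"

definition functions_on ::
  "'d::finite set \<Rightarrow> (real^'d) set \<Rightarrow> 'b set \<Rightarrow> (real^'d \<Rightarrow> 'b) set" where
  "functions_on J X S = {f. f \<in> X \<rightarrow> S \<and> (\<forall>v\<in>periods J. \<forall>x\<in>X. f (x + v) = f x)}"

definition domain_measure :: "'d::finite set \<Rightarrow> (real^'d) set \<Rightarrow> (real^'d) measure" where
  "domain_measure J X = lebesgue_on (X \<inter> unit_cell J)"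

definition essential_range ::
  "'d::finite set \<Rightarrow> (real^'d) set \<Rightarrow> (real^'d \<Rightarrow> real^'n) \<Rightarrow> (real^'n) set" where
  "essential_range J X U =
     {y. \<forall>r>0. emeasure (domain_measure J X) {x \<in> X \<inter> unit_cell J. norm (U x - y) < r} > 0}"


section \<open>Besov spaces\<close>

definition Lq_space ::
  "real \<Rightarrow> 'd::finite set \<Rightarrow> (real^'d) set \<Rightarrow> (real^'d \<Rightarrow> real) set" where
  "Lq_space q J X = {f \<in> functions_on J X UNIV.
     f \<in> borel_measurable (domain_measure J X) \<and>
     integrable (domain_measure J X) (\<lambda>x. \<bar>f x\<bar> powr q)}"

definition Lq_norm ::
  "real \<Rightarrow> 'd::finite set \<Rightarrow> (real^'d) set \<Rightarrow> (real^'d \<Rightarrow> real) \<Rightarrow> real" where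
  "Lq_norm q J X f = (\<integral>x. \<bar>f x\<bar> powr q \<partial>domain_measure J X) powr (1 / q)"

text \<open>
  For \<open>f\<close> in \<open>L\<^sup>q\<close> the increments below are again in \<open>L\<^sup>q\<close> of the intersection, so that
  \<open>Lq_norm\<close> is never applied to a function with a divergent integral.
\<close>

definition besov_space ::
  "real \<Rightarrow> real \<Rightarrow> 'd::finite set \<Rightarrow> (real^'d) set \<Rightarrow> (real^'d \<Rightarrow> real) set" where
  "besov_space \<alpha> q J X = {f \<in> Lq_space q J X.
     bdd_above ((\<lambda>\<xi>. norm \<xi> powr (- \<alpha>) *
        Lq_norm q J (X \<inter> (\<lambda>x. x + \<xi>) ` X) (\<lambda>x. f x - f (x - \<xi>))) ` {\<xi>. \<xi> \<noteq> 0})}"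

definition besov_space_into ::
  "real \<Rightarrow> real \<Rightarrow> 'd::finite set \<Rightarrow> (real^'d) set \<Rightarrow> (real^'n) set \<Rightarrow> (real^'d \<Rightarrow> real^'n) set" where
  "besov_space_into \<alpha> q J X \<O> =
     {U \<in> functions_on J X \<O>. \<forall>i. (\<lambda>x. U x $ i) \<in> besov_space \<alpha> q J X}"


section \<open>Weak solutions\<close>

text \<open>
  Test functions are extended by zero outside \<open>X\<close>.  The compact subsets of the quotient are
  the images of compact sets in \<open>\<real>\<^sup>d\<close>, so the support is compact iff it is covered by
  the lattice translates of a compact subset of \<open>X\<close>.
\<close>

definition test_function ::
  "'d::finite set \<Rightarrow> (real^'d) set \<Rightarrow> (real^'d \<Rightarrow> real^'r) \<Rightarrow> bool" where
  "test_function J X \<psi> \<longleftrightarrow>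
     \<psi> \<in> functions_on J UNIV UNIV \<and> (\<forall>k. Ck_on k \<psi> UNIV) \<and>
     (\<exists>K. compact K \<and> K \<subseteq> X \<and> {x. \<psi> x \<noteq> 0} \<subseteq> {y + v | y v. y \<in> K \<and> v \<in> periods J})"

text \<open>
  An \<open>r \<times> d\<close> matrix has type \<open>real^'d^'r\<close>, and its inner product is the Frobenius product
  \<open>A : B\<close>.  Scalar laws are the case \<open>'r = 1\<close>, with scalar test functions valued in \<open>real^1\<close>.
\<close>

definition weak_solution ::
  "'d::finite set \<Rightarrow> (real^'d) set \<Rightarrow> (real^'n) set \<Rightarrow> (real^'n \<Rightarrow> real^'d^'r) \<Rightarrow>
   (real^'d \<Rightarrow> real^'n) \<Rightarrow> bool" where
  "weak_solution J X \<O> F U \<longleftrightarrow>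
     U \<in> functions_on J X \<O> \<and>
     (\<forall>K. compact K \<and> K \<subseteq> X \<longrightarrow> (\<lambda>x. F (U x)) absolutely_integrable_on K) \<and>
     (\<forall>\<psi>. test_function J X \<psi> \<longrightarrow>
        (\<integral>x. F (U x) \<bullet> jacobian \<psi> (at x) \<partial>domain_measure J X) = 0)"

end

theory Submission
  imports Defs "HOL-Probability.Probability_Measure"
begin

text \<open>
  The proof is the commutator argument of Constantin, E and Titi.  Multiplying \<open>G\<close>, \<open>Q\<close> and \<open>B\<close>
  by a smooth cutoff that is \<open>1\<close> near the essential range \<open>K\<close> gives compactly supported functions
  \<open>g\<close>, \<open>q\<close> and \<open>b\<close> on the whole space, with \<open>Dq = b Dg\<close> near \<open>K\<close>.  Let \<open>U\<^sub>e\<close> be the mollification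
  of \<open>U\<close> at scale \<open>e\<close>.  Testing the given law with the mollification of \<open>\<psi> b(U\<^sub>e)\<close> and integrating
  by parts writes the integral of \<open>q(U)\<close> against \<open>D\<psi>\<close> as the sum of three errors:
  \<^item> \<open>q(U) - q(U\<^sub>e)\<close>, paired with \<open>D\<psi>\<close>;
  \<^item> the commutator of \<open>g\<close> with mollification, paired with \<open>D(\<psi> b(U\<^sub>e))\<close>;
  \<^item> \<open>\<psi> (Dq - b Dg)(U\<^sub>e) DU\<^sub>e\<close>, the defect of the companion relation at the values of \<open>U\<^sub>e\<close>.

  Let \<open>a\<close>, \<open>s\<close>, \<open>t\<close> be the means of the first, second and third powers of \<open>|U(x - y) - U(x)|\<close> over
  \<open>|y| < e\<close>.  Up to constants, \<open>|U\<^sub>e - U| \<le> a\<close> and \<open>|DU\<^sub>e| \<le> a/e\<close>, and the commutator is at most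
  \<open>s\<close> because the linear term of a Taylor expansion averages to zero.  As \<open>U\<close> is bounded, and as
  \<open>a s \<le> 2 t\<close>, the first two errors are at most \<open>a + t/e\<close>.  In the locale \<open>mollified\<close> the functions
  \<open>U\<close>, \<open>U\<^sub>e\<close>, \<open>a\<close>, \<open>s\<close> and \<open>t\<close> are \<open>V\<close>, \<open>W\<close>, \<open>osc 1\<close>, \<open>osc 2\<close> and \<open>osc 3\<close>.

  The set \<open>\<O>\<close> need not be convex, so \<open>U\<^sub>e\<close> may take values outside the region where \<open>Dq = b Dg\<close>.  This is
  what the third error measures.  It vanishes unless \<open>|U\<^sub>e - U| \<ge> r\<close> for a fixed \<open>r > 0\<close>, and then
  \<open>1\<close> is bounded by a multiple of \<open>a\<^sup>2\<close>; together with the factor \<open>DU\<^sub>e\<close> the error is at most a multiple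
  of \<open>a\<^sup>3/e\<close>, hence of \<open>t/e\<close>.  The pointwise bound is \<open>defect_estimate\<close>.  The Besov hypothesis bounds
  the integral of \<open>t\<close> over compact sets by a multiple of \<open>e\<close> to the power \<open>3\<alpha>\<close>, so that all errors
  tend to zero when \<open>3\<alpha> > 1\<close>; this is \<open>companion_law_euclidean\<close>.

  Torus directions are removed by \<open>weak_form_periodic_iff\<close>: it suffices to test with functions that
  have compact support in the covering space \<open>\<real>\<^sup>d\<close>.  Such a function can be periodised, and a periodic
  test function is the periodisation of its product with a partition of unity.  Finally \<open>U\<close> is
  replaced by a bounded Borel function that agrees with it almost everywhere, for which
  \<open>besov_local_representative\<close> provides the local increment bounds.
\<close>


section \<open>Calculus of \<open>C\<^sup>k\<close> functions\<close>

lemma frechet_derivative_eq: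
  "(f has_derivative f') (at x) \<Longrightarrow> frechet_derivative f (at x) = f'"
  using frechet_derivative_at by metis

lemma Ck_on_differentiable:
  "Ck_on (Suc k) f S \<Longrightarrow> x \<in> S \<Longrightarrow> (f has_derivative frechet_derivative f (at x)) (at x)"
  using frechet_derivative_works by auto

lemma Ck_on_cong:
  assumes "open S" "\<And>x. x \<in> S \<Longrightarrow> f x = g x" "Ck_on k f S"
  shows "Ck_on k g S"
  using assms(2,3)
proof (induction k arbitrary: f g)
  case 0
  then show ?case by (metis Ck_on.simps(1) continuous_on_cong)
next
  case (Suc k)
  have eq: "(g has_derivative frechet_derivative f (at x)) (at x)" if "x \<in> S" for x
    using Ck_on_differentiable[OF Suc.prems(2) that] has_derivative_transform_within_open[OF _ assms(1) that]
      Suc.prems(1) by blast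
  have "Ck_on k (\<lambda>x. frechet_derivative g (at x) v) S" for v
  proof (rule Suc.IH)
    show "Ck_on k (\<lambda>x. frechet_derivative f (at x) v) S"
      using Suc.prems by simp
    show "frechet_derivative f (at x) v = frechet_derivative g (at x) v" if "x \<in> S" for x
      using frechet_derivative_eq[OF eq[OF that]] by simp
  qed
  then show ?case
    using eq by (auto simp: differentiable_def)
qed

lemma Ck_on_SucI:
  assumes "open S" "\<And>x. x \<in> S \<Longrightarrow> (f has_derivative f' x) (at x)"
    "\<And>v. Ck_on k (\<lambda>x. f' x v) S"
  shows "Ck_on (Suc k) f S"
proof -
  have "Ck_on k (\<lambda>x. frechet_derivative f (at x) v) S" for v
    by (rule Ck_on_cong[OF assms(1) _ assms(3)[of v]])
      (use assms(2) frechet_derivative_eq in metis)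
  then show ?thesis
    using assms(2) by (auto simp: differentiable_def)
qed

lemma Ck_on_Suc_imp: "Ck_on (Suc k) f S \<Longrightarrow> Ck_on k f S"
proof (induction k arbitrary: f)
  case 0
  then show ?case
    by (auto intro!: continuous_at_imp_continuous_on differentiable_imp_continuous_within)
qed auto

lemma Ck_on_subset: "Ck_on k f S \<Longrightarrow> T \<subseteq> S \<Longrightarrow> Ck_on k f T"
  by (induction k arbitrary: f) (auto intro: continuous_on_subset)

lemma Ck_on_Union:
  assumes "\<And>T. T \<in> \<T> \<Longrightarrow> open T \<and> Ck_on k f T"
  shows "Ck_on k f (\<Union>\<T>)"
  using assms
proof (induction k arbitrary: f)
  case 0
  then show ?case
    using continuous_on_open_Union[of \<T> f] by auto
qed auto

lemma Ck_on_const: "open S \<Longrightarrow> Ck_on k (\<lambda>x. c) S"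
proof (induction k arbitrary: c)
  case (Suc k)
  show ?case
    by (rule Ck_on_SucI[where f' = "\<lambda>_ _. 0"]) (use Suc in auto)
qed auto

lemma Ck_on_add:
  assumes "open S" "Ck_on k f S" "Ck_on k g S"
  shows "Ck_on k (\<lambda>x. f x + g x) S"
  using assms(2,3)
proof (induction k arbitrary: f g)
  case (Suc k)
  show ?case
  proof (rule Ck_on_SucI[OF assms(1)])
    show "((\<lambda>x. f x + g x) has_derivative
        (\<lambda>v. frechet_derivative f (at x) v + frechet_derivative g (at x) v)) (at x)" if "x \<in> S" for x
      by (intro has_derivative_add Ck_on_differentiable[OF _ that]) (use Suc.prems in blast)+
    show "Ck_on k (\<lambda>x. frechet_derivative f (at x) v + frechet_derivative g (at x) v) S" for v
      using Suc.prems by (intro Suc.IH) auto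
  qed
qed (auto intro: continuous_on_add)

lemma Ck_on_sum:
  assumes "open S" "\<And>i. i \<in> I \<Longrightarrow> Ck_on k (f i) S"
  shows "Ck_on k (\<lambda>x. \<Sum>i\<in>I. f i x) S"
  using assms(2)
  by (induction I rule: infinite_finite_induct) (auto intro: Ck_on_const Ck_on_add assms(1))

lemma Ck_on_bounded_linear:
  assumes "open S" "bounded_linear h" "Ck_on k f S"
  shows "Ck_on k (\<lambda>x. h (f x)) S"
  using assms(3)
proof (induction k arbitrary: f)
  case 0
  then show ?case
    using bounded_linear.continuous_on[OF assms(2)] by auto
next
  case (Suc k)
  show ?case
  proof (rule Ck_on_SucI[OF assms(1)])
    show "((\<lambda>x. h (f x)) has_derivative (\<lambda>v. h (frechet_derivative f (at x) v))) (at x)" if "x \<in> S" for x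
      by (intro bounded_linear.has_derivative[OF assms(2)] Ck_on_differentiable[OF Suc.prems that])
    show "Ck_on k (\<lambda>x. h (frechet_derivative f (at x) v)) S" for v
      using Suc.prems by (intro Suc.IH) auto
  qed
qed

lemma Ck_on_bilinear:
  assumes "open S" "bounded_bilinear p" "Ck_on k f S" "Ck_on k g S"
  shows "Ck_on k (\<lambda>x. p (f x) (g x)) S"
  using assms(3,4)
proof (induction k arbitrary: f g)
  case 0
  then show ?case
    using bounded_bilinear.continuous_on[OF assms(2)] by auto
next
  case (Suc k)
  show ?case
  proof (rule Ck_on_SucI[OF assms(1)])
    fix x assume "x \<in> S"
    then show "((\<lambda>x. p (f x) (g x)) has_derivative (\<lambda>v. p (f x) (frechet_derivative g (at x) v)
        + p (frechet_derivative f (at x) v) (g x))) (at x)"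
      by (intro bounded_bilinear.FDERIV[OF assms(2)]) (use Suc Ck_on_differentiable in blast)+
  next
    fix v
    show "Ck_on k (\<lambda>x. p (f x) (frechet_derivative g (at x) v)
        + p (frechet_derivative f (at x) v) (g x)) S"
      using Suc.prems Suc.prems[THEN Ck_on_Suc_imp] by (intro Ck_on_add Suc.IH assms(1)) auto
  qed
qed

lemma Ck_on_translate:
  assumes "Ck_on k f UNIV"
  shows "Ck_on k (\<lambda>x. f (x + v)) UNIV"
  using assms
proof (induction k arbitrary: f)
  case 0
  then show ?case
    by (auto intro!: continuous_on_compose2[of UNIV f] continuous_intros)
next
  case (Suc k)
  show ?case
  proof (rule Ck_on_SucI)
    show "((\<lambda>x. f (x + v)) has_derivative frechet_derivative f (at (x + v))) (at x)" for x
    proof -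
      have "((\<lambda>x. x + v) has_derivative (\<lambda>x. x)) (at x)"
        by (auto intro!: derivative_eq_intros)
      then show ?thesis
        using has_derivative_compose[of "\<lambda>x. x + v" "\<lambda>x. x" x UNIV f]
          Ck_on_differentiable[OF Suc.prems] by auto
    qed
    show "Ck_on k (\<lambda>x. frechet_derivative f (at (x + v)) w) UNIV" for w
      using Suc.IH[of "\<lambda>x. frechet_derivative f (at x) w"] Suc.prems by auto
  qed auto
qed

lemma C1_on_iff:
  assumes "open S"
  shows "Ck_on 1 f S \<longleftrightarrow> (\<exists>f'. (\<forall>x\<in>S. (f has_derivative f' x) (at x)) \<and> (\<forall>v. continuous_on S (\<lambda>x. f' x v)))"
proof
  assume "Ck_on 1 f S"
  then show "\<exists>f'. (\<forall>x\<in>S. (f has_derivative f' x) (at x)) \<and> (\<forall>v. continuous_on S (\<lambda>x. f' x v))"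
    by (intro exI[of _ "\<lambda>x. frechet_derivative f (at x)"]) (auto simp: frechet_derivative_works)
next
  assume "\<exists>f'. (\<forall>x\<in>S. (f has_derivative f' x) (at x)) \<and> (\<forall>v. continuous_on S (\<lambda>x. f' x v))"
  then show "Ck_on 1 f S"
    using Ck_on_SucI[OF assms, of f _ 0] by auto
qed

section \<open>A smooth bump function\<close>

text \<open>
  \<open>flat 0\<close> is the flat function \<open>exp (-1/s)\<close>.  The derivative of
  \<open>flat m\<close> is a combination of \<open>flat (m+1)\<close> and \<open>flat
  (m+2)\<close>, so one induction that ranges over all \<open>m\<close> shows that every member of
  the family is smooth.
\<close>

definition flat :: "nat \<Rightarrow> real \<Rightarrow> real" where
  "flat m s = (if s > 0 then exp (- (1/s)) / s ^ m else 0)"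

lemma flat_nonneg: "flat m s \<ge> 0"
  by (simp add: flat_def)

text \<open>
  The exponential series at \<open>1/s\<close> dominates each of its terms.
\<close>

lemma flat_bound: "flat m s \<le> fact m"
proof (cases "s > 0")
  case True
  have "(1/s) ^ m / fact m \<le> exp (1/s)"
    using True sum_le_suminf[OF summable_exp_generic[of "1/s"], of "{m}"]
    by (simp add: exp_def divide_inverse mult.commute)
  then show ?thesis
    using True by (simp add: flat_def exp_minus field_simps)
qed (simp add: flat_def)

lemma flat_has_derivative:
  "(flat m has_real_derivative (flat (m+2) s - real m * flat (m+1) s)) (at s)"
proof -
  consider "s > 0" | "s < 0" | "s = 0" by linarith
  then show ?thesis
  proof cases
    case 1
    have "((\<lambda>s. exp (- (1/s)) / s ^ m) has_real_derivative (flat (m+2) s - real m * flat (m+1) s)) (at s)"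
    proof (cases m)
      case (Suc n)
      then show ?thesis
        using 1
        by (cases n; auto intro!: derivative_eq_intros simp: flat_def field_simps power2_eq_square)
          (metis One_nat_def power_eq_if)
    qed (use 1 in \<open>auto intro!: derivative_eq_intros simp: flat_def field_simps power2_eq_square\<close>)
    then show ?thesis
      by (rule has_field_derivative_transform_within_open[where S = "{0<..}"])
        (use 1 in \<open>auto simp: flat_def\<close>)
  next
    case 2
    have "((\<lambda>s. 0) has_real_derivative (flat (m+2) s - real m * flat (m+1) s)) (at s)"
      using 2 by (auto simp: flat_def)
    then show ?thesis
      by (rule has_field_derivative_transform_within_open[where S = "{..<0}"])
        (use 2 in \<open>auto simp: flat_def\<close>)
  next
    case 3
    \<comment> \<open>Every quotient \<open>flat m h / h = flat (m+1) h\<close> is at most \<open>h * flat (m+2) h\<close>.\<close>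
    have b: "\<bar>flat m h / h\<bar> \<le> fact (m+2) * \<bar>h\<bar>" for h
    proof (cases "h > 0")
      case True
      have "flat m h / h = flat (m+2) h * h"
        using True by (simp add: flat_def)
      then show ?thesis
        using flat_bound[of "m+2" h] flat_nonneg[of "m+2" h] True
        by (simp add: abs_mult mult_right_mono del: fact_Suc)
    qed (auto simp: flat_def mult_nonneg_nonpos simp del: fact_Suc)
    have "((\<lambda>h. flat m h / h) \<longlongrightarrow> 0) (at 0)"
    proof (rule Lim_null_comparison[where g = "\<lambda>h. fact (m+2) * \<bar>h\<bar>"])
      show "((\<lambda>h::real. fact (m+2) * \<bar>h\<bar>) \<longlongrightarrow> 0) (at 0)"
        by (auto intro!: tendsto_eq_intros)
    qed (use b in auto)
    then show ?thesis
      using 3 by (simp add: DERIV_def flat_def)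
  qed
qed

text \<open>
  For \<open>c = 1/e\<^sup>2\<close> the support is the ball of radius \<open>e\<close>.
\<close>

definition bump :: "nat \<Rightarrow> real \<Rightarrow> 'a::euclidean_space \<Rightarrow> real" where
  "bump m c x = flat m (1 - c * (x \<bullet> x))"

lemma bump_has_derivative:
  "(bump m c has_derivative
      (\<lambda>v. (real m * bump (m+1) c x - bump (m+2) c x) * (2 * c * (x \<bullet> v)))) (at x)"
proof -
  have 1: "((\<lambda>x::'a. 1 - c * (x \<bullet> x)) has_derivative (\<lambda>v. - (2 * c * (x \<bullet> v)))) (at x)"
    by (auto intro!: derivative_eq_intros simp: inner_commute)
  show ?thesis
    using has_derivative_compose[OF 1 flat_has_derivative[of m "1 - c * (x \<bullet> x)", unfolded has_field_derivative_def]]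
    by (simp add: bump_def[abs_def] algebra_simps)
qed

lemma bump_smooth: "Ck_on k (bump m c :: 'a::euclidean_space \<Rightarrow> real) UNIV"
proof (induction k arbitrary: m)
  case 0
  show ?case
    using bump_has_derivative has_derivative_continuous by (auto simp: continuous_on_eq_continuous_at) blast
next
  case (Suc k)
  have lin: "Ck_on k (\<lambda>x::'a. 2 * c * (x \<bullet> v)) UNIV" for k v
  proof (cases k)
    case (Suc l)
    have "((\<lambda>x::'a. 2 * c * (x \<bullet> v)) has_derivative (\<lambda>w. 2 * c * (w \<bullet> v))) (at x)" for x
      by (auto intro!: derivative_eq_intros)
    then show ?thesis
      unfolding Suc by (intro Ck_on_SucI[where f' = "\<lambda>_ w. 2 * c * (w \<bullet> v)"] Ck_on_const) auto
  qed (auto intro!: continuous_intros)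
  have "Ck_on k (\<lambda>x. (real m * bump (m+1) c x + (-1) * bump (m+2) c x) * (2 * c * (x \<bullet> v))) UNIV" for v :: 'a
    by (intro Ck_on_bilinear[OF _ bounded_bilinear_mult] Ck_on_add
        Ck_on_bounded_linear[OF _ bounded_linear_mult_right] Suc.IH lin) auto
  then show ?case
    by (intro Ck_on_SucI[OF _ bump_has_derivative]) auto
qed

section \<open>Integration of compactly supported functions\<close>

lemma lborel_reflect: "distr lborel borel (\<lambda>y. x - y) = (lborel :: 'a::euclidean_space measure)"
  using lborel_affine[of "-1" x] by (simp add: density_1)

lemma integral_reflect:
  fixes h :: "'a::euclidean_space \<Rightarrow> 'b::euclidean_space"
  assumes "h \<in> borel_measurable borel"
  shows "(\<integral>y. h (x - y) \<partial>lborel) = (\<integral>y. h y \<partial>lborel)"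
proof -
  have "(\<integral>y. h y \<partial>lborel) = (\<integral>y. h y \<partial>distr lborel borel (\<lambda>y. x - y))"
    by (simp add: lborel_reflect)
  also have "\<dots> = (\<integral>y. h (x - y) \<partial>lborel)"
    using assms by (intro integral_distr) auto
  finally show ?thesis by simp
qed

lemma integrable_bounded_support:
  fixes f :: "'a::euclidean_space \<Rightarrow> 'b::euclidean_space"
  assumes "f \<in> borel_measurable borel" "\<And>x. norm (f x) \<le> c" "\<And>x. norm x > R \<Longrightarrow> f x = 0"
  shows "integrable lborel f"
  by (rule integrableI_bounded_set[where A = "cball 0 R" and B = c])
    (use assms emeasure_lborel_cball_finite[of "0::'a" R] in auto)

lemma measurable_bilinear:
  fixes p :: "'b::euclidean_space \<Rightarrow> 'c::euclidean_space \<Rightarrow> 'e::euclidean_space"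
  assumes "bounded_bilinear p" "f \<in> borel_measurable M" "g \<in> borel_measurable M"
  shows "(\<lambda>x. p (f x) (g x)) \<in> borel_measurable M"
  using assms(2,3)
  by (rule borel_measurable_continuous_Pair)
    (auto intro!: bounded_bilinear.continuous_on[OF assms(1)] continuous_intros)

lemma bounded_compact_support:
  fixes u :: "'a::euclidean_space \<Rightarrow> 'b::euclidean_space"
  assumes "continuous_on UNIV u" "\<And>x. norm x > R \<Longrightarrow> u x = 0"
  shows "\<exists>c>0. \<forall>x. norm (u x) \<le> c"
proof -
  have "compact (u ` cball 0 R)"
    using assms(1) by (intro compact_continuous_image) (auto intro: continuous_on_subset)
  then obtain c where c: "c > 0" "\<forall>y\<in>u ` cball 0 R. norm y \<le> c"
    using bounded_pos compact_imp_bounded by blast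
  have "norm (u x) \<le> c" for x
    using c assms(2)[of x] by (cases "norm x > R") auto
  with c(1) show ?thesis by blast
qed

lemma uniformly_continuous_compact_support:
  fixes u :: "'a::euclidean_space \<Rightarrow> 'b::euclidean_space"
  assumes "continuous_on UNIV u" "\<And>x. norm x > R \<Longrightarrow> u x = 0" "e > 0"
  shows "\<exists>d>0. \<forall>z w. norm (z - w) < d \<longrightarrow> norm (u z - u w) < e"
proof -
  have "uniformly_continuous_on (cball 0 (R + 1)) u"
    using assms(1) by (intro compact_uniformly_continuous) (auto intro: continuous_on_subset)
  then obtain d where d: "d > 0"
    "\<And>z w. z \<in> cball 0 (R+1) \<Longrightarrow> w \<in> cball 0 (R+1) \<Longrightarrow> dist w z < d \<Longrightarrow> dist (u w) (u z) < e"
    unfolding uniformly_continuous_on_def using assms(3) by blast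
  have "norm (u z - u w) < e" if "norm (z - w) < min d 1" for z w
  proof (cases "norm z > R + 1 \<or> norm w > R + 1")
    case True
    have "\<bar>norm z - norm w\<bar> < 1"
      using that norm_triangle_ineq3[of z w] by linarith
    with True have "norm z > R" "norm w > R"
      by linarith+
    then show ?thesis
      using assms(2,3) by simp
  next
    case False
    then show ?thesis
      using d(2)[of w z] that by (auto simp: dist_norm)
  qed
  with d(1) show ?thesis
    by (intro exI[of _ "min d 1"]) auto
qed

lemma integrable_bilinear_compact_support:
  fixes f :: "'a::euclidean_space \<Rightarrow> 'b::euclidean_space" and k :: "'a \<Rightarrow> 'c::euclidean_space"
    and p :: "'b \<Rightarrow> 'c \<Rightarrow> 'e::euclidean_space"
  assumes p: "bounded_bilinear p" and f: "f \<in> borel_measurable borel" "\<And>x. norm (f x) \<le> M"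
    and k: "continuous_on UNIV k" "\<And>x. norm x > R \<Longrightarrow> k x = 0"
  shows "integrable lborel (\<lambda>x. p (f x) (k x))"
proof -
  obtain P where P: "P > 0" "\<And>a b. norm (p a b) \<le> norm a * norm b * P"
    using bounded_bilinear.pos_bounded[OF p] by blast
  obtain c where c: "c > 0" "\<And>x. norm (k x) \<le> c"
    using bounded_compact_support[OF k] by blast
  have M: "M \<ge> 0"
    using f(2) norm_ge_zero order_trans by blast
  show ?thesis
  proof (rule integrable_bounded_support[where c = "M * c * P" and R = R])
    show "(\<lambda>x. p (f x) (k x)) \<in> borel_measurable borel"
      by (intro measurable_bilinear[OF p f(1)] borel_measurable_continuous_onI k(1))
    show "norm (p (f x) (k x)) \<le> M * c * P" for x
      by (rule order_trans[OF P(2)]) (use P(1) M c f(2) in \<open>auto intro!: mult_mono\<close>)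
  qed (simp add: k(2) bounded_bilinear.zero_right[OF p])
qed

text \<open>
  The derivative is a parameter, so that formulas for it can be carried along with the function.
\<close>

definition C1_deriv :: "('a::euclidean_space \<Rightarrow> 'b::euclidean_space) \<Rightarrow> ('a \<Rightarrow> 'a \<Rightarrow> 'b) \<Rightarrow> bool" where
  "C1_deriv f f' \<longleftrightarrow> (\<forall>x. (f has_derivative f' x) (at x)) \<and> (\<forall>v. continuous_on UNIV (\<lambda>x. f' x v))"

lemma C1_derivD:
  assumes "C1_deriv f f'"
  shows "(f has_derivative f' x) (at x)" "continuous_on UNIV (\<lambda>x. f' x v)" "continuous_on UNIV f"
    "linear (f' x)"
proof -
  show *: "(f has_derivative f' x) (at x)" "continuous_on UNIV (\<lambda>x. f' x v)" for x v
    using assms by (auto simp: C1_deriv_def)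
  show "continuous_on UNIV f"
    by (auto simp: continuous_on_eq_continuous_at intro: has_derivative_continuous *)
  show "linear (f' x)"
    using *(1) has_derivative_linear by blast
qed

lemma Ck_on_continuous: "Ck_on k f S \<Longrightarrow> continuous_on S f"
  by (induction k) (simp_all add: Ck_on_Suc_imp del: Ck_on.simps(2))

lemma C1_deriv_of_Ck: "Ck_on (Suc k) f UNIV \<Longrightarrow> C1_deriv f (\<lambda>x. frechet_derivative f (at x))"
  unfolding C1_deriv_def
  using Ck_on_continuous[of k "\<lambda>x. frechet_derivative f (at x) _"] Ck_on_differentiable[of k f UNIV] by simp

lemma linear_bound_Basis:
  fixes A :: "'a::euclidean_space \<Rightarrow> 'b::euclidean_space" and c :: real
  assumes "linear A" "\<And>i. i \<in> Basis \<Longrightarrow> norm (A i) \<le> c"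
  shows "norm (A v) \<le> DIM('a) * c * norm v"
proof -
  have "A v = A (\<Sum>i\<in>Basis. (v \<bullet> i) *\<^sub>R i)"
    by (simp add: euclidean_representation)
  also have "\<dots> = (\<Sum>i\<in>Basis. (v \<bullet> i) *\<^sub>R A i)"
    using assms(1) by (simp add: linear_sum linear_cmul)
  also have "norm \<dots> \<le> (\<Sum>i\<in>(Basis::'a set). norm v * c)"
    by (intro sum_norm_le) (auto intro!: mult_mono assms Basis_le_norm)
  finally show ?thesis by (simp add: mult_ac)
qed

text \<open>
  The complement of a closed set is open, so a function that vanishes there has a vanishing
  derivative there as well.
\<close>

lemma C1_deriv_zero_outside:
  assumes "C1_deriv f f'" "closed S" "\<And>x. x \<notin> S \<Longrightarrow> f x = 0" "x \<notin> S"
  shows "f' x v = 0"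
proof -
  have "(f has_derivative (\<lambda>_. 0)) (at x)"
    by (rule has_derivative_transform_within_open[of "\<lambda>_. 0" _ _ UNIV "- S"])
      (use assms in \<open>auto simp: open_Compl\<close>)
  then show ?thesis
    using C1_derivD(1)[OF assms(1), of x] has_derivative_unique by metis
qed

lemma C1_compact_support:
  fixes k :: "'a::euclidean_space \<Rightarrow> 'b::euclidean_space"
  assumes k: "C1_deriv k k'" "\<And>x. norm x > R \<Longrightarrow> k x = 0"
  shows C1_support_deriv: "norm x > R \<Longrightarrow> k' x v = 0"
    and C1_bounded_deriv: "\<exists>c>0. \<forall>x v. norm (k' x v) \<le> c * norm v"
    and C1_uniform_deriv: "e > 0 \<Longrightarrow> \<exists>d>0. \<forall>z w v. norm (z - w) < d \<longrightarrow> norm (k' z v - k' w v) \<le> e * norm v"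
proof -
  note D = C1_derivD[OF k(1)]
  show zero: "k' x v = 0" if "norm x > R" for x v
    by (rule C1_deriv_zero_outside[OF k(1) closed_cball[of 0 R]]) (use k(2) that in auto)
  show "\<exists>c>0. \<forall>x v. norm (k' x v) \<le> c * norm v"
  proof -
    have "\<forall>i. \<exists>c>0. \<forall>x. norm (k' x i) \<le> c"
      using bounded_compact_support[OF D(2) zero] by blast
    then obtain c where c: "\<And>i. c i > 0" "\<And>i x. norm (k' x i) \<le> c i"
      by metis
    have "norm (k' x v) \<le> DIM('a) * (\<Sum>i\<in>Basis. c i) * norm v" for x v
    proof (rule linear_bound_Basis[OF D(4)])
      fix i :: 'a assume "i \<in> Basis"
      then show "norm (k' x i) \<le> (\<Sum>i\<in>Basis. c i)"
        using c(2)[of x i] member_le_sum[of i Basis c] c(1) by (force simp: less_imp_le)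
    qed
    moreover have "DIM('a) * (\<Sum>i\<in>Basis. c i) > 0"
      using c(1) by (auto intro!: mult_pos_pos sum_pos)
    ultimately show ?thesis by blast
  qed
  show "\<exists>d>0. \<forall>z w v. norm (z - w) < d \<longrightarrow> norm (k' z v - k' w v) \<le> e * norm v" if "e > 0"
  proof -
    have "\<forall>i. \<exists>d>0. \<forall>z w. norm (z - w) < d \<longrightarrow> norm (k' z i - k' w i) < e / DIM('a)"
      using uniformly_continuous_compact_support[OF D(2) zero, where e = "e / DIM('a)"] that by simp
    then obtain d where d: "\<And>i. d i > 0"
      "\<And>i z w. norm (z - w) < d i \<Longrightarrow> norm (k' z i - k' w i) < e / DIM('a)"
      by metis
    have "norm (k' z v - k' w v) \<le> e * norm v" if "norm (z - w) < Min (d ` Basis)" for z w v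
    proof -
      have "norm (k' z v - k' w v) \<le> DIM('a) * (e / DIM('a)) * norm v"
      proof (rule linear_bound_Basis[of "\<lambda>v. k' z v - k' w v"])
        show "linear (\<lambda>v. k' z v - k' w v)"
          by (intro linear_compose_sub D(4))
        fix i :: 'a assume "i \<in> Basis"
        then have "norm (z - w) < d i"
          using that by auto
        then show "norm (k' z i - k' w i) \<le> e / DIM('a)"
          using d(2) by (simp add: less_imp_le)
      qed
      then show ?thesis by simp
    qed
    moreover have "Min (d ` Basis) > 0"
      using d(1) by auto
    ultimately show ?thesis by blast
  qed
qed

section \<open>Convolution\<close>

text \<open>
  The product \<open>p\<close> is multiplication by scalars on either side.  Regularity of the convolution
  comes from \<open>k\<close>: for a bounded \<open>f\<close> the mollifier is \<open>k\<close>, whereas in differentiating the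
  mollification of a \<open>C\<^sup>1\<close> function the mollifier is \<open>f\<close>.
\<close>

definition conv ::
  "('b \<Rightarrow> 'c \<Rightarrow> 'e::euclidean_space) \<Rightarrow> ('a::euclidean_space \<Rightarrow> 'b) \<Rightarrow> ('a \<Rightarrow> 'c) \<Rightarrow> 'a \<Rightarrow> 'e" where
  "conv p f k x = (\<integral>y. p (f y) (k (x - y)) \<partial>lborel)"

locale convolution =
  fixes p :: "'b::euclidean_space \<Rightarrow> 'c::euclidean_space \<Rightarrow> 'e::euclidean_space"
    and f :: "'a::euclidean_space \<Rightarrow> 'b" and M :: real
  assumes bil: "bounded_bilinear p"
    and meas[measurable]: "f \<in> borel_measurable borel"
    and bound: "\<And>x. norm (f x) \<le> M"
begin

lemma integrable_conv:
  assumes "continuous_on UNIV k" "\<And>x. norm x > R \<Longrightarrow> k x = 0"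
  shows "integrable lborel (\<lambda>y. p (f y) (k (x - y)))"
proof (rule integrable_bilinear_compact_support[OF bil meas bound, where R = "norm x + R"])
  show "continuous_on UNIV (\<lambda>y. k (x - y))"
    by (intro continuous_on_compose2[OF assms(1)] continuous_intros) auto
  show "k (x - y) = 0" if "norm y > norm x + R" for y
    using that norm_triangle_ineq2[of y x] by (intro assms(2)) (simp add: norm_minus_commute)
qed

text \<open>
  The constant serves all \<open>x\<close>, \<open>g\<close> and \<open>c\<close>, so that a
  uniformly small change of the kernel results in a small change of the convolution.
\<close>

lemma conv_estimate:
  assumes "R \<ge> 0"
  shows "\<exists>C>0. \<forall>x g c. (\<forall>y. norm (g y) \<le> c) \<longrightarrow> (\<forall>y. norm (x - y) > R \<longrightarrow> g y = 0) \<longrightarrow>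
     g \<in> borel_measurable borel \<longrightarrow> norm (\<integral>y. p (f y) (g y) \<partial>lborel) \<le> C * c"
proof -
  obtain P where P: "P > 0" "\<And>a b. norm (p a b) \<le> norm a * norm b * P"
    using bounded_bilinear.pos_bounded[OF bil] by blast
  have M: "M \<ge> 0"
    using bound norm_ge_zero order_trans by blast
  define C where "C = (M + 1) * P * measure lborel (cball (0::'a) (R + 1))"
  have "norm (\<integral>y. p (f y) (g y) \<partial>lborel) \<le> C * c"
    if g: "\<And>y. norm (g y) \<le> c" "\<And>y. norm (x - y) > R \<Longrightarrow> g y = 0" "g \<in> borel_measurable borel" for x g c
  proof -
    have c: "c \<ge> 0"
      using g(1) norm_ge_zero order_trans by blast
    have le: "norm (p (f y) (g y)) \<le> (M + 1) * P * c * indicator (cball x (R + 1)) y" for y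
    proof (cases "norm (x - y) > R")
      case False
      have "norm (p (f y) (g y)) \<le> norm (f y) * norm (g y) * P"
        by (rule P)
      also have "\<dots> \<le> (M + 1) * c * P"
        using P(1) M c g(1) bound[of y] by (intro mult_mono) auto
      finally show ?thesis
        using False by (auto simp: dist_norm mult_ac indicator_def)
    qed (use P(1) M c g(2) bounded_bilinear.zero_right[OF bil] in simp)
    have "norm (\<integral>y. p (f y) (g y) \<partial>lborel)
        \<le> (\<integral>y. (M + 1) * P * c * indicator (cball x (R + 1)) y \<partial>lborel)"
    proof (rule Bochner_Integration.integral_norm_bound_integral)
      show "integrable lborel (\<lambda>y. (M + 1) * P * c * indicator (cball x (R + 1)) y)"
        using emeasure_lborel_cball_finite[of x "R + 1"] by auto
      then show "integrable lborel (\<lambda>y. p (f y) (g y))"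
        by (rule Bochner_Integration.integrable_bound)
          (use le measurable_bilinear[OF bil meas g(3)] in \<open>auto intro: order_trans[OF le abs_ge_self]\<close>)
    qed (use le in auto)
    also have "\<dots> = C * c"
      using content_cball_conv_ball[of x "R+1"] content_cball_conv_ball[of "0::'a" "R+1"] assms
        content_ball_conv_unit_ball[of "R+1" x] content_ball_conv_unit_ball[of "R+1" "0::'a"]
      by (simp add: C_def)
    finally show ?thesis .
  qed
  moreover have "C > 0"
    using P(1) M assms content_cball_pos[of "R+1" "0::'a"] by (simp add: C_def)
  ultimately show ?thesis by blast
qed

lemma continuous_conv:
  assumes "continuous_on UNIV k" "\<And>x. norm x > R \<Longrightarrow> k x = 0"
  shows "continuous_on UNIV (conv p f k)"
proof -
  obtain C where C: "C > 0" "\<And>x g c. (\<And>y. norm (g y) \<le> c) \<Longrightarrow> (\<And>y. norm (x - y) > \<bar>R\<bar> + 1 \<Longrightarrow> g y = 0) \<Longrightarrow>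
     g \<in> borel_measurable borel \<Longrightarrow> norm (\<integral>y. p (f y) (g y) \<partial>lborel) \<le> C * c"
    using conv_estimate[of "\<bar>R\<bar> + 1"] by force
  have [measurable]: "k \<in> borel_measurable borel"
    by (intro borel_measurable_continuous_onI assms)
  have "\<exists>d>0. \<forall>z. dist z x < d \<longrightarrow> dist (conv p f k z) (conv p f k x) < e" if e: "e > 0" for x e
  proof -
    obtain d where d: "d > 0" "\<And>z w. norm (z - w) < d \<Longrightarrow> norm (k z - k w) < e / (2 * C)"
      using uniformly_continuous_compact_support[OF assms(1), of R "e / (2 * C)"] assms(2) e C(1)
      by (metis divide_pos_pos mult_pos_pos zero_less_numeral)
    have "dist (conv p f k z) (conv p f k x) < e" if "dist z x < min d 1" for z
    proof -
      have eq: "conv p f k z - conv p f k x = (\<integral>y. p (f y) (k (z - y) - k (x - y)) \<partial>lborel)"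
        unfolding conv_def
        by (subst Bochner_Integration.integral_diff[symmetric])
          (auto intro!: integrable_conv assms simp: bounded_bilinear.diff_right[OF bil])
      have "norm (conv p f k z - conv p f k x) \<le> C * (e / (2 * C))"
        unfolding eq
      proof (rule C(2))
        show "norm (k (z - y) - k (x - y)) \<le> e / (2 * C)" for y
          using d(2)[of "z - y" "x - y"] that by (simp add: dist_norm less_imp_le)
        show "k (z - y) - k (x - y) = 0" if y: "norm (x - y) > \<bar>R\<bar> + 1" for y
        proof -
          have "norm (z - y) > R" "norm (x - y) > R"
            using y \<open>dist z x < min d 1\<close> norm_triangle_ineq[of "z - y" "x - z"]
            by (auto simp: dist_norm norm_minus_commute)
          then show ?thesis using assms(2) by simp
        qed
      qed auto
      then show ?thesis
        using C(1) e by (simp add: dist_norm)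
    qed
    with d(1) show ?thesis
      by (intro exI[of _ "min d 1"]) auto
  qed
  then show ?thesis
    by (auto simp: continuous_on_iff)
qed

text \<open>
  A continuous derivative with compact support is uniformly continuous, so the difference
  quotients of \<open>k\<close> converge uniformly, and hence under the integral.
\<close>

lemma conv_C1_deriv:
  assumes k: "C1_deriv k k'" "\<And>x. norm x > R \<Longrightarrow> k x = 0"
  shows "C1_deriv (conv p f k) (\<lambda>x v. conv p f (\<lambda>z. k' z v) x)"
proof -
  note D = C1_derivD[OF k(1)]
  note zero = C1_support_deriv[OF k]
  obtain C where C: "C > 0" "\<And>x g c. (\<And>y. norm (g y) \<le> c) \<Longrightarrow> (\<And>y. norm (x - y) > \<bar>R\<bar> + 1 \<Longrightarrow> g y = 0) \<Longrightarrow>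
     g \<in> borel_measurable borel \<Longrightarrow> norm (\<integral>y. p (f y) (g y) \<partial>lborel) \<le> C * c"
    using conv_estimate[of "\<bar>R\<bar> + 1"] by force
  have [measurable]: "k \<in> borel_measurable borel" "(\<lambda>z. k' z v) \<in> borel_measurable borel" for v
    by (intro borel_measurable_continuous_onI D)+
  have int: "integrable lborel (\<lambda>y. p (f y) (k' (x - y) v))" "integrable lborel (\<lambda>y. p (f y) (k (x - y)))" for x v
    using integrable_conv[OF D(2) zero] integrable_conv[OF D(3) k(2)] by auto
  have "(conv p f k has_derivative (\<lambda>v. conv p f (\<lambda>z. k' z v) x)) (at x)" for x
    unfolding has_derivative_at_alt
  proof (intro conjI allI impI)
    have "linear (\<lambda>v. conv p f (\<lambda>z. k' z v) x)"
      unfolding conv_def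
      by (intro linearI)
        (simp_all add: linear_add[OF D(4)] linear_cmul[OF D(4)] bounded_bilinear.add_right[OF bil]
          bounded_bilinear.scaleR_right[OF bil] Bochner_Integration.integral_add[OF int(1) int(1)])
    then show "bounded_linear (\<lambda>v. conv p f (\<lambda>z. k' z v) x)"
      using linear_conv_bounded_linear by blast
    fix e :: real assume e: "e > 0"
    obtain d where d: "d > 0" "\<And>z w v. norm (z - w) < d \<Longrightarrow> norm (k' z v - k' w v) \<le> e / C * norm v"
      using C1_uniform_deriv[OF k(1), where R = R and e = "e / C"] k(2) e C(1)
      by (metis divide_pos_pos)
    have "norm (conv p f k y - conv p f k x - conv p f (\<lambda>z. k' z (y - x)) x) \<le> e * norm (y - x)"
      if y: "norm (y - x) < min d 1" for y
    proof -
      have eq: "conv p f k y - conv p f k x - conv p f (\<lambda>z. k' z (y - x)) x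
        = (\<integral>w. p (f w) (k (y - w) - k (x - w) - k' (x - w) (y - x)) \<partial>lborel)"
        unfolding conv_def bounded_bilinear.diff_right[OF bil]
        by (simp add: int Bochner_Integration.integral_diff)
      have "norm (conv p f k y - conv p f k x - conv p f (\<lambda>z. k' z (y - x)) x) \<le> C * (norm (y - x) * (e / C))"
        unfolding eq
      proof (rule C(2))
        fix w
        have "norm (k (y - w) - k (x - w) - k' (x - w) ((y - w) - (x - w))) \<le> norm ((y - w) - (x - w)) * (e / C)"
        proof (rule differentiable_bound_linearization[where S = "ball (x - w) d"])
          show "x - w + t *\<^sub>R (y - w - (x - w)) \<in> ball (x - w) d" if "t \<in> {0..1}" for t
          proof -
            have "norm (t *\<^sub>R (y - x)) \<le> 1 * norm (y - x)"
              unfolding norm_scaleR using that by (intro mult_right_mono) auto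
            then show ?thesis
              using y by (simp add: dist_norm norm_minus_commute scaleR_diff_right)
          qed
          show "(k has_derivative k' z) (at z within ball (x - w) d)" for z
            using D(1) has_derivative_at_withinI by blast
          show "onorm (k' z - k' (x - w)) \<le> e / C" if "z \<in> ball (x - w) d" for z
            by (rule onorm_le) (use d(2)[of z "x - w"] that in \<open>simp add: dist_norm norm_minus_commute\<close>)
        qed (use d(1) in auto)
        then show "norm (k (y - w) - k (x - w) - k' (x - w) (y - x)) \<le> norm (y - x) * (e / C)"
          by simp
        show "k (y - w) - k (x - w) - k' (x - w) (y - x) = 0" if "norm (x - w) > \<bar>R\<bar> + 1"
        proof -
          have "norm (y - w) > R" "norm (x - w) > R"
            using y that norm_triangle_ineq[of "y - w" "x - y"] by (auto simp: norm_minus_commute)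
          then show ?thesis using k(2) zero by simp
        qed
      qed auto
      then show ?thesis
        using C(1) by (simp add: mult.commute)
    qed
    then show "\<exists>d>0. \<forall>y. norm (y - x) < d \<longrightarrow>
        norm (conv p f k y - conv p f k x - conv p f (\<lambda>z. k' z (y - x)) x) \<le> e * norm (y - x)"
      using d(1) by (intro exI[of _ "min d 1"]) auto
  qed
  then show ?thesis
    using continuous_conv[OF D(2) zero] by (auto simp: C1_deriv_def)
qed

text \<open>
  Each derivative falls on the kernel, and the derivatives of \<open>k\<close> are again smooth
  with support in the same ball.
\<close>

lemma conv_smooth:
  assumes "\<And>j. Ck_on j k UNIV" "\<And>x. norm x > R \<Longrightarrow> k x = 0"
  shows "Ck_on j (conv p f k) UNIV"
  using assms
proof (induction j arbitrary: k)
  case 0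
  have "continuous_on UNIV k"
    using 0(1)[of 0] by simp
  from continuous_conv[OF this 0(2)] show ?case
    by simp
next
  case (Suc j)
  note C1 = C1_deriv_of_Ck[OF Suc.prems(1)]
  show ?case
  proof (rule Ck_on_SucI)
    show "(conv p f k has_derivative (\<lambda>v. conv p f (\<lambda>z. frechet_derivative k (at z) v) x)) (at x)" for x
      using conv_C1_deriv[OF C1 Suc.prems(2)] C1_derivD(1) by blast
    show "Ck_on j (\<lambda>x. conv p f (\<lambda>z. frechet_derivative k (at z) v) x) UNIV" for v
      using Suc.IH[of "\<lambda>z. frechet_derivative k (at z) v"] C1_support_deriv[OF C1 Suc.prems(2)]
        Suc.prems(1)[of "Suc _"] by auto
  qed auto
qed

end

lemma conv_reflect:
  fixes p :: "'b::euclidean_space \<Rightarrow> 'c::euclidean_space \<Rightarrow> 'e::euclidean_space"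
  assumes "bounded_bilinear p" "f \<in> borel_measurable borel" "k \<in> borel_measurable borel"
  shows "conv p f k x = (\<integral>y. p (f (x - y)) (k y) \<partial>lborel)"
proof -
  note [measurable] = assms(2,3)
  have "(\<lambda>y. p (f y) (k (x - y))) \<in> borel_measurable borel"
    by (intro measurable_bilinear[OF assms(1)]) auto
  from integral_reflect[OF this, of x] show ?thesis
    by (simp add: conv_def)
qed

lemma conv_flip:
  fixes p :: "'b::euclidean_space \<Rightarrow> 'c::euclidean_space \<Rightarrow> 'e::euclidean_space"
  assumes "bounded_bilinear p" "f \<in> borel_measurable borel" "k \<in> borel_measurable borel"
  shows "conv p f k x = conv (\<lambda>a b. p b a) k f x"
  unfolding conv_reflect[OF assms] by (simp add: conv_def)

text \<open>
  This is integration by parts: the convolution of \<open>k\<close> with the constant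
  \<open>1\<close> is constant, and its derivative is the integral of the derivative of
  \<open>k\<close>.
\<close>

lemma integral_deriv_eq_0:
  fixes k :: "'a::euclidean_space \<Rightarrow> 'b::euclidean_space"
  assumes k: "C1_deriv k k'" "\<And>x. norm x > R \<Longrightarrow> k x = 0"
  shows "(\<integral>x. k' x v \<partial>lborel) = 0"
proof -
  interpret convolution scaleR "\<lambda>_::'a. 1::real" 1
    by (intro convolution.intro bounded_bilinear_scaleR) auto
  note D = C1_derivD[OF k(1)]
  have meas: "k \<in> borel_measurable borel" "(\<lambda>z. k' z v) \<in> borel_measurable borel"
    by (intro borel_measurable_continuous_onI D)+
  have "conv scaleR (\<lambda>_::'a. 1::real) k = (\<lambda>x. \<integral>y. k y \<partial>lborel)"
    using integral_reflect[OF meas(1)] by (auto simp: conv_def)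
  then have "((\<lambda>x. \<integral>y. k y \<partial>lborel) has_derivative (\<lambda>v. conv scaleR (\<lambda>_. 1) (\<lambda>z. k' z v) 0)) (at 0)"
    using conv_C1_deriv[OF k] C1_derivD(1) by metis
  then have "conv scaleR (\<lambda>_. 1) (\<lambda>z. k' z v) 0 = 0"
    using has_derivative_unique[OF _ has_derivative_const] by metis
  then show ?thesis
    using integral_reflect[OF meas(2), of 0] by (simp add: conv_def)
qed

section \<open>Mollification\<close>

text \<open>
  The bounds are relative to the volume of the ball and have a constant \<open>C\<close> that does
  not depend on \<open>e\<close>, so that integrals against the kernel are controlled by averages
  over the ball.
\<close>

definition mollifier :: "real \<Rightarrow> real \<Rightarrow> ('a::euclidean_space \<Rightarrow> real) \<Rightarrow> bool" where
  "mollifier C e k \<longleftrightarrow> (\<forall>j. Ck_on j k UNIV) \<and> (\<forall>x. k (- x) = k x) \<and> (\<forall>x. 0 \<le> k x) \<and>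
     (\<forall>x. e \<le> norm x \<longrightarrow> k x = 0) \<and> (\<integral>x. k x \<partial>lborel) = 1 \<and>
     (\<forall>x. k x \<le> C / measure lborel (ball (0::'a) e)) \<and>
     (\<forall>x v. \<bar>frechet_derivative k (at x) v\<bar> \<le> C / e / measure lborel (ball (0::'a) e) * norm v)"

lemma measure_ball_pos: "e > 0 \<Longrightarrow> measure lborel (ball (0::'a::euclidean_space) e) > 0"
  using content_ball_pos[of e "0::'a"] by simp

lemma mollifier_exists:
  "\<exists>C>0. \<forall>e>0. \<exists>k::'a::euclidean_space \<Rightarrow> real. mollifier C e k"
proof -
  define C :: real where "C = 4 * exp (4/3) * 2 ^ DIM('a)"
  have "\<exists>k::'a \<Rightarrow> real. mollifier C e k" if e: "e > 0" for e
  proof -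
    define N where "N = measure lborel (ball (0::'a) e)"
    define b :: "nat \<Rightarrow> 'a \<Rightarrow> real" where "b m = bump m (1 / e\<^sup>2)" for m
    define Z where "Z = (\<integral>x. b 0 x \<partial>lborel)"
    have N: "N > 0"
      using measure_ball_pos[OF e] by (simp add: N_def)
    have b0: "b m x = 0" if "norm x \<ge> e" for m x
    proof -
      have "e\<^sup>2 \<le> x \<bullet> x"
        using power_mono[OF that, of 2] e by (simp add: power2_norm_eq_inner)
      then show ?thesis
        using e by (simp add: b_def bump_def flat_def field_simps)
    qed
    have b_nonneg: "b m x \<ge> 0" and b_le: "b m x \<le> fact m" for m x
      by (auto simp: b_def bump_def flat_nonneg flat_bound)
    have cont: "continuous_on UNIV (b m)" for m
      using bump_smooth Ck_on_continuous unfolding b_def by blast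
    have int: "integrable lborel (b 0)"
      by (rule integrable_bounded_support[where c = 1 and R = e])
        (use b_nonneg b_le[of 0] b0 cont in \<open>auto intro: borel_measurable_continuous_onI\<close>)
    (* On the half ball 1 - |x|^2/e^2 is at least 3/4, so the bump is at least exp (-4/3). *)
    have Z: "Z \<ge> exp (-(4/3)) / 2 ^ DIM('a) * N"
    proof -
      have "exp (-(4/3)) * indicator (ball 0 (e/2)) x \<le> b 0 x" for x
      proof (cases "norm x < e/2")
        case True
        have "x \<bullet> x \<le> (e/2)\<^sup>2"
          using power_mono[of "norm x" "e/2" 2] True by (simp add: power2_norm_eq_inner)
        then have s: "1 - 1 / e\<^sup>2 * (x \<bullet> x) \<ge> 3/4"
          using e by (simp add: field_simps power2_eq_square)
        then have "1 / (1 - 1 / e\<^sup>2 * (x \<bullet> x)) \<le> 1 / (3/4)"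
          by (intro divide_left_mono) auto
        moreover have "0 < 1 - 1 / e\<^sup>2 * (x \<bullet> x)"
          using s by linarith
        ultimately show ?thesis
          using True by (simp add: b_def bump_def flat_def)
      qed (use b_nonneg in auto)
      then have "(\<integral>x. exp (-(4/3)) * indicator (ball (0::'a) (e/2)) x \<partial>lborel) \<le> Z"
        unfolding Z_def using emeasure_lborel_ball_finite[of "0::'a" "e/2"]
        by (intro integral_mono int) auto
      also have "(\<integral>x. exp (-(4/3)) * indicator (ball (0::'a) (e/2)) x \<partial>lborel) = exp (-(4/3)) / 2 ^ DIM('a) * N"
        using content_ball_conv_unit_ball[of "e/2" "0::'a"] content_ball_conv_unit_ball[of e "0::'a"] e
        by (simp add: N_def power_divide)
      finally show ?thesis .
    qed
    have "0 < exp (-(4/3)) / 2 ^ DIM('a) * N"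
      using N by simp
    then have Zpos: "Z > 0"
      using Z by linarith
    have ZN: "1 / Z \<le> C / 4 / N"
    proof -
      have "1 / Z \<le> 1 / (exp (-(4/3)) / 2 ^ DIM('a) * N)"
        using Z N by (intro divide_left_mono mult_pos_pos Zpos) auto
      then show ?thesis
        by (simp add: C_def exp_minus field_simps)
    qed
    have der: "((\<lambda>x. b 0 x / Z) has_derivative (\<lambda>v. (- b 2 x) * (2 / e\<^sup>2 * (x \<bullet> v)) / Z)) (at x)" for x
      using bump_has_derivative[of 0 "1/e\<^sup>2" x] Zpos
      by (auto intro!: derivative_eq_intros simp: b_def numeral_2_eq_2)
    have "mollifier C e (\<lambda>x. b 0 x / Z)"
      unfolding mollifier_def N_def[symmetric]
    proof (intro conjI allI impI)
      show "Ck_on j (\<lambda>x. b 0 x / Z) UNIV" for j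
        unfolding b_def by (intro Ck_on_bounded_linear[OF _ bounded_linear_divide] bump_smooth) auto
      show "b 0 (- x) / Z = b 0 x / Z" for x
        by (simp add: b_def bump_def)
      show "0 \<le> b 0 x / Z" for x
        using b_nonneg Zpos by simp
      show "b 0 x / Z = 0" if "e \<le> norm x" for x
        using b0[OF that] by simp
      show "(\<integral>x. b 0 x / Z \<partial>lborel) = 1"
        using Zpos by (simp add: Z_def)
      have "C / 4 / N \<le> C / N"
        using N by (simp add: C_def field_simps)
      then show "b 0 x / Z \<le> C / N" for x
        using divide_right_mono[OF b_le[of 0 x], of Z] Zpos ZN by simp
      show "\<bar>frechet_derivative (\<lambda>x. b 0 x / Z) (at x) v\<bar> \<le> C / e / N * norm v" for x v
      proof (cases "norm x \<ge> e")
        case True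
        then show ?thesis
          using b0[OF True, of 2] N e by (simp add: frechet_derivative_eq[OF der] C_def)
      next
        case False
        have "\<bar>b 2 x * (2 / e\<^sup>2 * (x \<bullet> v)) / Z\<bar> = b 2 x * (2 / e\<^sup>2 * \<bar>x \<bullet> v\<bar>) * (1 / Z)"
          using b_nonneg[of 2 x] Zpos by (simp add: abs_mult)
        also have "\<dots> \<le> 2 * (2 / e\<^sup>2 * (e * norm v)) * (C / 4 / N)"
        proof (intro mult_mono ZN)
          show "b 2 x \<le> 2" using b_le[of 2 x] by (simp add: fact_numeral)
          show "\<bar>x \<bullet> v\<bar> \<le> e * norm v"
            using Cauchy_Schwarz_ineq2[of x v] False
            by (meson dual_order.trans less_imp_le mult_right_mono norm_ge_zero not_le)
        qed (use e Zpos b_nonneg in auto)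
        also have "\<dots> = C / e / N * norm v"
          using e by (simp add: field_simps power2_eq_square)
        finally show ?thesis
          by (simp add: frechet_derivative_eq[OF der])
      qed
    qed
    then show ?thesis by blast
  qed
  moreover have "C > 0" by (simp add: C_def)
  ultimately show ?thesis by blast
qed

abbreviation mollify :: "('a::euclidean_space \<Rightarrow> 'b::euclidean_space) \<Rightarrow> ('a \<Rightarrow> real) \<Rightarrow> 'a \<Rightarrow> 'b" where
  "mollify \<equiv> conv (\<lambda>v c. c *\<^sub>R v)"

lemma bounded_bilinear_mollify:
  "bounded_bilinear (\<lambda>(v::'b::euclidean_space) (c::real). c *\<^sub>R v)"
  by (rule bounded_bilinear.flip[OF bounded_bilinear_scaleR])

lemma convolution_mollify:
  fixes f :: "'a::euclidean_space \<Rightarrow> 'b::euclidean_space"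
  assumes "f \<in> borel_measurable borel" "\<And>x. norm (f x) \<le> M"
  shows "convolution (\<lambda>v c. c *\<^sub>R v) f M"
  by (intro convolution.intro bounded_bilinear_mollify assms)

text \<open>
  Fubini's theorem exchanges the two integrals, and evenness of the kernel puts it back into the
  form of a mollification.
\<close>

lemma mollify_adjoint:
  fixes F H :: "'a::euclidean_space \<Rightarrow> 'b::euclidean_space" and k :: "'a \<Rightarrow> real"
  assumes F: "F \<in> borel_measurable borel" "\<And>x. norm (F x) \<le> M"
    and H: "continuous_on UNIV H" "\<And>x. norm x > R \<Longrightarrow> H x = 0"
    and k: "continuous_on UNIV k" "\<And>x. norm x > r \<Longrightarrow> k x = 0" "\<And>x. k (- x) = k x"
  shows "(\<integral>x. F x \<bullet> mollify H k x \<partial>lborel) = (\<integral>x. mollify F k x \<bullet> H x \<partial>lborel)"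
proof -
  obtain h c where h: "h > 0" "\<And>x. norm (H x) \<le> h" and c: "c > 0" "\<And>x. norm (k x) \<le> c"
    using bounded_compact_support[OF H] bounded_compact_support[OF k(1,2)] by blast
  have [measurable]: "F \<in> borel_measurable borel" "H \<in> borel_measurable borel" "k \<in> borel_measurable borel"
    using F H k by (auto intro: borel_measurable_continuous_onI)
  have M: "M \<ge> 0"
    using F(2) norm_ge_zero order_trans by blast
  interpret FH: convolution "\<lambda>v c. c *\<^sub>R v" F M
    by (intro convolution_mollify F)
  interpret HH: convolution "\<lambda>v c. c *\<^sub>R v" H h
    by (intro convolution_mollify h) auto
  have int: "integrable (lborel \<Otimes>\<^sub>M lborel) (\<lambda>(x, y). k (x - y) * (F x \<bullet> H y))"
  proof (rule integrableI_bounded_set[where A = "cball 0 (r + R) \<times> cball 0 R" and B = "c * (M * h)"])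
    show "emeasure (lborel \<Otimes>\<^sub>M lborel) (cball (0::'a) (r + R) \<times> cball (0::'a) R) < \<infinity>"
      using emeasure_lborel_cball_finite[of "0::'a" "r + R"] emeasure_lborel_cball_finite[of "0::'a" R]
      by (simp add: lborel.emeasure_pair_measure_Times ennreal_mult_less_top)
    have "norm (k (x - y) * (F x \<bullet> H y)) \<le> c * (M * h)" for x y
    proof -
      have "\<bar>F x \<bullet> H y\<bar> \<le> M * h"
        using Cauchy_Schwarz_ineq2[of "F x" "H y"] mult_mono[OF F(2)[of x] h(2)[of y]] M by force
      then show ?thesis
        using c M h(1) by (auto simp: abs_mult intro!: mult_mono)
    qed
    then show "AE x in lborel \<Otimes>\<^sub>M lborel. x \<in> cball 0 (r + R) \<times> cball 0 R \<longrightarrow>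
        norm (case x of (x, y) \<Rightarrow> k (x - y) * (F x \<bullet> H y)) \<le> c * (M * h)"
      by auto
    have zero: "k (x - y) * (F x \<bullet> H y) = 0" if "\<not> (norm x \<le> r + R \<and> norm y \<le> R)" for x y
    proof (cases "norm y > R")
      case False
      then have "norm (x - y) > r"
        using that norm_triangle_ineq2[of x y] by linarith
      then show ?thesis using k(2) by simp
    qed (use H(2) in simp)
    show "AE x in lborel \<Otimes>\<^sub>M lborel. x \<notin> cball 0 (r + R) \<times> cball 0 R \<longrightarrow>
        (case x of (x, y) \<Rightarrow> k (x - y) * (F x \<bullet> H y)) = 0"
    proof (intro AE_I2 impI)
      fix z :: "'a \<times> 'a" assume "z \<notin> cball 0 (r + R) \<times> cball 0 R"
      then have "\<not> (norm (fst z) \<le> r + R \<and> norm (snd z) \<le> R)"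
        by (cases z) auto
      from zero[OF this] show "(case z of (x, y) \<Rightarrow> k (x - y) * (F x \<bullet> H y)) = 0"
        by (cases z) simp
    qed
  qed auto
  have 1: "F x \<bullet> mollify H k x = (\<integral>y. k (x - y) * (F x \<bullet> H y) \<partial>lborel)" for x
    unfolding conv_def
    by (subst Bochner_Integration.integral_inner_right[symmetric]) (auto intro!: HH.integrable_conv[OF k(1,2)])
  have 2: "mollify F k y \<bullet> H y = (\<integral>x. k (x - y) * (F x \<bullet> H y) \<partial>lborel)" for y
  proof -
    have "k (x - y) = k (y - x)" for x
      using k(3)[of "x - y"] by simp
    then show ?thesis
      unfolding conv_def
      by (subst Bochner_Integration.integral_inner_left[symmetric]) (auto intro!: FH.integrable_conv[OF k(1,2)])
  qed
  show ?thesis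
    unfolding 1 2 using lborel_pair.Fubini_integral[OF int] by simp
qed

section \<open>Averages over small balls\<close>

abbreviation ball_average :: "real \<Rightarrow> 'a::euclidean_space measure" where
  "ball_average e \<equiv> uniform_measure lborel (ball 0 e)"

lemma prob_space_ball_average: "e > 0 \<Longrightarrow> prob_space (ball_average e :: 'a::euclidean_space measure)"
  using emeasure_lborel_ball_finite[of "0::'a" e] measure_ball_pos[of e, where 'a = 'a]
  by (intro prob_space_uniform_measure) (auto simp: measure_def)

lemma integral_ball_average:
  fixes h :: "'a::euclidean_space \<Rightarrow> real"
  assumes "e > 0" "h \<in> borel_measurable borel"
  shows "(\<integral>y. h y \<partial>ball_average e) = (\<integral>y. indicator (ball 0 e) y * h y \<partial>lborel) / measure lborel (ball (0::'a) e)"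
proof -
  define N where "N = measure lborel (ball (0::'a) e)"
  have N: "N > 0" "emeasure lborel (ball (0::'a) e) = ennreal N"
    using emeasure_lborel_ball_finite[of "0::'a" e] measure_ball_pos[OF assms(1), where 'a = 'a]
    by (auto simp: N_def emeasure_eq_ennreal_measure)
  have "(ball_average e :: 'a measure) = density lborel (\<lambda>x. ennreal (indicator (ball 0 e) x / N))"
    unfolding uniform_measure_def N(2)
    by (intro arg_cong[where f = "density _"] ext) (use N(1) divide_ennreal[of 1 N] in \<open>auto simp: indicator_def\<close>)
  then have "(\<integral>y. h y \<partial>ball_average e) = (\<integral>y. (indicator (ball 0 e) y / N) *\<^sub>R h y \<partial>lborel)"
    using N(1) assms(2)
    by (simp only:) (intro integral_density, auto intro!: borel_measurable_divide borel_measurable_indicator)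
  then show ?thesis
    by (simp add: N_def)
qed

text \<open>
  The weight will be a mollifier or a partial derivative of one.
\<close>

lemma weighted_integral_le_average:
  fixes w :: "'a::euclidean_space \<Rightarrow> real" and h :: "'a \<Rightarrow> 'b::euclidean_space"
  assumes e: "e > 0" and w: "w \<in> borel_measurable borel" "\<And>y. e \<le> norm y \<Longrightarrow> w y = 0"
    "\<And>y. \<bar>w y\<bar> \<le> c / measure lborel (ball (0::'a) e)"
    and h: "h \<in> borel_measurable borel" "\<And>y. norm (h y) \<le> M"
  shows "norm (\<integral>y. w y *\<^sub>R h y \<partial>lborel) \<le> c * (\<integral>y. norm (h y) \<partial>ball_average e)"
proof -
  note [measurable] = w(1) h(1)
  define N where "N = measure lborel (ball (0::'a) e)"
  have N: "N > 0"
    using measure_ball_pos[OF e] by (simp add: N_def)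
  have c: "c \<ge> 0"
    using N order_trans[OF abs_ge_zero w(3)] by (simp add: N_def[symmetric] zero_le_divide_iff)
  have le: "norm (w y *\<^sub>R h y) \<le> c / N * (indicator (ball 0 e) y * norm (h y))" for y
    using w(2)[of y] mult_right_mono[OF w(3)[of y], of "norm (h y)"] by (auto simp: N_def indicator_def)
  have "norm (\<integral>y. w y *\<^sub>R h y \<partial>lborel) \<le> (\<integral>y. c / N * (indicator (ball 0 e) y * norm (h y)) \<partial>lborel)"
  proof (rule Bochner_Integration.integral_norm_bound_integral)
    have M: "M \<ge> 0"
      using h(2) norm_ge_zero order_trans by blast
    show "integrable lborel (\<lambda>y. c / N * (indicator (ball 0 e) y * norm (h y)))"
      by (rule integrable_bounded_support[where R = e and c = "c / N * M"])
        (use N c h(2) M in \<open>auto simp: indicator_def abs_mult intro!: divide_right_mono mult_left_mono\<close>)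
    then show "integrable lborel (\<lambda>y. w y *\<^sub>R h y)"
      by (rule Bochner_Integration.integrable_bound)
        (use order_trans[OF le abs_ge_self] in \<open>auto intro!: AE_I2 simp del: abs_mult abs_divide\<close>)
  qed (use le in auto)
  also have "\<dots> = c * (\<integral>y. norm (h y) \<partial>ball_average e)"
    using e by (subst integral_ball_average) (auto simp: N_def)
  finally show ?thesis .
qed

lemma (in prob_space) moment_inequalities:
  fixes Y :: "'a \<Rightarrow> real"
  assumes [measurable]: "Y \<in> borel_measurable M" and Y: "\<And>x. 0 \<le> Y x" "\<And>x. Y x \<le> c"
  defines "m j \<equiv> (\<integral>x. Y x ^ j \<partial>M)"
  shows "m 1 ^ 2 \<le> m 2" "m 1 ^ 3 \<le> m 3" "m 1 * m 2 \<le> 2 * m 3"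
proof -
  have int: "integrable M (\<lambda>x. Y x ^ j)" for j
    by (rule integrable_const_bound[where B = "c ^ j"]) (use Y in \<open>auto intro!: power_mono\<close>)
  define a where "a = m 1"
  have a: "a \<ge> 0"
    unfolding a_def m_def using Y by (auto intro!: integral_nonneg_AE)
  \<comment> \<open>In each case the integrand lies above a polynomial whose mean is known: the tangent
    of a power at \<open>a\<close>, or Young's inequality \<open>a y\<^sup>2 \<le> a\<^sup>3 + y\<^sup>3\<close>.\<close>
  have "(\<integral>x. 2 * a * Y x ^ 1 - a\<^sup>2 \<partial>M) \<le> m 2"
    unfolding m_def
  proof (intro integral_mono)
    show "2 * a * Y x ^ 1 - a\<^sup>2 \<le> Y x ^ 2" for x
      using zero_le_power2[of "Y x - a"] by (simp add: power2_eq_square algebra_simps)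
  qed (use int int[of 1] in auto)
  moreover have "(\<integral>x. 2 * a * Y x ^ 1 - a\<^sup>2 \<partial>M) = 2 * a * m 1 - a\<^sup>2"
    unfolding m_def using int[of 1] by (simp add: prob_space)
  ultimately show "m 1 ^ 2 \<le> m 2"
    by (simp add: a_def power2_eq_square)
  have "(\<integral>x. 3 * a\<^sup>2 * Y x ^ 1 - 2 * a ^ 3 \<partial>M) \<le> m 3"
    unfolding m_def
  proof (intro integral_mono)
    show "3 * a\<^sup>2 * Y x ^ 1 - 2 * a ^ 3 \<le> Y x ^ 3" for x
    proof -
      have "0 \<le> (Y x - a)\<^sup>2 * (Y x + 2 * a)"
        using Y a by simp
      also have "\<dots> = Y x ^ 3 - (3 * a\<^sup>2 * Y x ^ 1 - 2 * a ^ 3)"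
        by (simp add: power2_eq_square power3_eq_cube algebra_simps)
      finally show ?thesis by simp
    qed
  qed (use int int[of 1] in auto)
  moreover have "(\<integral>x. 3 * a\<^sup>2 * Y x ^ 1 - 2 * a ^ 3 \<partial>M) = 3 * a\<^sup>2 * m 1 - 2 * a ^ 3"
    unfolding m_def using int[of 1] by (simp add: prob_space)
  ultimately show 3: "m 1 ^ 3 \<le> m 3"
    by (simp add: a_def power2_eq_square power3_eq_cube)
  have "(\<integral>x. a * Y x ^ 2 \<partial>M) \<le> (\<integral>x. a ^ 3 + Y x ^ 3 \<partial>M)"
  proof (intro integral_mono)
    show "a * Y x ^ 2 \<le> a ^ 3 + Y x ^ 3" for x
    proof (cases "a \<le> Y x")
      case True
      then have "a * Y x ^ 2 \<le> Y x * Y x ^ 2"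
        by (intro mult_right_mono) auto
      then show ?thesis
        using a by (simp add: power2_eq_square power3_eq_cube add_increasing)
    next
      case False
      then have "a * Y x ^ 2 \<le> a * a ^ 2"
        using Y a by (intro mult_left_mono power_mono) auto
      then show ?thesis
        using Y by (simp add: power2_eq_square power3_eq_cube add_increasing2)
    qed
  qed (use int in auto)
  also have "(\<integral>x. a ^ 3 + Y x ^ 3 \<partial>M) = a ^ 3 + m 3"
    unfolding m_def using int[of 3] by (simp add: prob_space)
  finally show "m 1 * m 2 \<le> 2 * m 3"
    using 3 by (simp add: a_def m_def)
qed

section \<open>Calculus of compactly supported \<open>C\<^sup>1\<close> functions\<close>

lemma C1_deriv_bilinear:
  assumes p: "bounded_bilinear p" and f: "C1_deriv f f'" and h: "C1_deriv h h'"
  shows "C1_deriv (\<lambda>x. p (f x) (h x)) (\<lambda>x v. p (f x) (h' x v) + p (f' x v) (h x))"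
  using C1_derivD[OF f] C1_derivD[OF h]
  by (auto simp: C1_deriv_def intro!: bounded_bilinear.FDERIV[OF p] continuous_on_add
      bounded_bilinear.continuous_on[OF p])

lemma C1_deriv_compose:
  fixes V :: "'a::euclidean_space \<Rightarrow> 'b::euclidean_space"
  assumes b: "C1_deriv b b'" and V: "C1_deriv V V'"
  shows "C1_deriv (\<lambda>x. b (V x)) (\<lambda>x v. b' (V x) (V' x v))"
proof -
  note B = C1_derivD[OF b] and V = C1_derivD[OF V]
  have "((\<lambda>x. b (V x)) has_derivative (\<lambda>v. b' (V x) (V' x v))) (at x)" for x
    using has_derivative_compose[OF V(1) B(1)] .
  moreover have "continuous_on UNIV (\<lambda>x. b' (V x) (V' x v))" for v
  proof -
    (* Only the directional derivatives of b are known to be continuous, so the direction is expanded in the basis. *)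
    have "b' (V x) (V' x v) = (\<Sum>i\<in>Basis. (V' x v \<bullet> i) *\<^sub>R b' (V x) i)" for x
      using linear_sum[OF B(4), of _ "\<lambda>i. (V' x v \<bullet> i) *\<^sub>R i" Basis] linear_cmul[OF B(4)]
      by (simp add: euclidean_representation)
    then show ?thesis
      by (simp only:) (intro continuous_intros V(2) continuous_on_compose2[OF B(2) V(3)], auto)
  qed
  ultimately show ?thesis
    by (simp add: C1_deriv_def)
qed

lemma C1_lipschitz:
  fixes f :: "'a::euclidean_space \<Rightarrow> 'b::euclidean_space"
  assumes f: "C1_deriv f f'" "\<And>x. norm x > R \<Longrightarrow> f x = 0"
  shows "\<exists>c>0. \<forall>x y. norm (f x - f y) \<le> c * norm (x - y)"
proof -
  obtain c where c: "c > 0" "\<And>x v. norm (f' x v) \<le> c * norm v"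
    using C1_bounded_deriv[OF f] by blast
  have "norm (f x - f y) \<le> c * norm (x - y)" for x y
    by (rule differentiable_bound[of UNIV f f'])
      (auto intro: C1_derivD(1)[OF f(1)] onorm_le c(2))
  with c(1) show ?thesis by blast
qed

text \<open>
  The partial derivatives are \<open>C\<^sup>1\<close> with compact support, so the derivative is
  Lipschitz; the remainder is the derivative's variation along the segment.
\<close>

lemma C2_Taylor:
  fixes f :: "'a::euclidean_space \<Rightarrow> 'b::euclidean_space"
  assumes f: "Ck_on 2 f UNIV" "\<And>x. norm x > R \<Longrightarrow> f x = 0"
  defines "f' \<equiv> \<lambda>x. frechet_derivative f (at x)"
  shows "\<exists>c>0. \<forall>x y. norm (f y - f x - f' x (y - x)) \<le> c * (norm (y - x))\<^sup>2"
proof -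
  have C1: "C1_deriv f f'"
    unfolding f'_def using f(1) C1_deriv_of_Ck by (simp only: numeral_2_eq_2)
  have "Ck_on (Suc 0) (\<lambda>x. f' x i) UNIV" for i
    using f(1) by (simp only: numeral_2_eq_2 f'_def Ck_on.simps(2)[of "Suc 0"])
  from C1_lipschitz[OF C1_deriv_of_Ck[OF this], of R]
  have "\<exists>c>0. \<forall>x y. norm (f' x i - f' y i) \<le> c * norm (x - y)" for i
    using C1_support_deriv[OF C1 f(2)] by blast
  then obtain c where c: "\<And>i. c i > 0" "\<And>i x y. norm (f' x i - f' y i) \<le> c i * norm (x - y)"
    by metis
  define L where "L = DIM('a) * (\<Sum>i\<in>Basis. c i)"
  have L: "L > 0"
    using c(1) by (auto simp: L_def intro!: mult_pos_pos sum_pos)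
  have lip: "norm (f' x v - f' y v) \<le> L * norm (x - y) * norm v" for x y v
  proof -
    have "norm (f' x v - f' y v) \<le> DIM('a) * ((\<Sum>i\<in>Basis. c i) * norm (x - y)) * norm v"
    proof (rule linear_bound_Basis[of "\<lambda>v. f' x v - f' y v"])
      show "linear (\<lambda>v. f' x v - f' y v)"
        by (intro linear_compose_sub C1_derivD(4)[OF C1])
      fix i :: 'a assume "i \<in> Basis"
      then have "c i \<le> (\<Sum>i\<in>Basis. c i)"
        using c(1) by (intro member_le_sum) (auto simp: less_imp_le)
      then show "norm (f' x i - f' y i) \<le> (\<Sum>i\<in>Basis. c i) * norm (x - y)"
        using c(2)[of x i y] mult_right_mono[of "c i" "\<Sum>i\<in>Basis. c i" "norm (x - y)"] by fastforce
    qed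
    then show ?thesis
      by (simp add: L_def mult_ac)
  qed
  have "norm (f y - f x - f' x (y - x)) \<le> L * (norm (y - x))\<^sup>2" for x y
  proof -
    have "norm (f y - f x - f' x (y - x)) \<le> norm (y - x) * (L * norm (y - x))"
    proof (rule differentiable_bound_linearization[where S = "cball x (norm (y - x))"])
      show "x + t *\<^sub>R (y - x) \<in> cball x (norm (y - x))" if "t \<in> {0..1}" for t
        using that mult_right_mono[of "\<bar>t\<bar>" 1 "norm (y - x)"] by (simp add: dist_norm)
      show "(f has_derivative f' z) (at z within cball x (norm (y - x)))" for z
        using C1_derivD(1)[OF C1] has_derivative_at_withinI by blast
      show "onorm (f' z - f' x) \<le> L * norm (y - x)" if z: "z \<in> cball x (norm (y - x))" for z
      proof (rule onorm_le)
        fix v :: 'a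
        have "L * norm (z - x) * norm v \<le> L * norm (y - x) * norm v"
          using z L by (intro mult_right_mono mult_left_mono) (auto simp: dist_norm norm_minus_commute)
        then show "norm ((f' z - f' x) v) \<le> L * norm (y - x) * norm v"
          using lip[of z v x] by simp
      qed
    qed simp
    then show ?thesis
      by (simp add: power2_eq_square mult_ac)
  qed
  with L show ?thesis by blast
qed

lemma integrable_compact_support:
  fixes f :: "'a::euclidean_space \<Rightarrow> 'b::euclidean_space"
  assumes "continuous_on UNIV f" "\<And>x. norm x > R \<Longrightarrow> f x = 0"
  shows "integrable lborel f"
  using integrable_bilinear_compact_support[OF bounded_bilinear_scaleR, of "\<lambda>_. 1" 1 f R] assms by simp

section \<open>Estimates for mollified functions\<close>

locale mollified =
  fixes V :: "'a::euclidean_space \<Rightarrow> 'b::euclidean_space" and M C e :: real and k :: "'a \<Rightarrow> real"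
  assumes V_meas[measurable]: "V \<in> borel_measurable borel"
    and V_bound: "\<And>x. norm (V x) \<le> M"
    and pos: "C > 0" "e > 0"
    and moll: "mollifier C e k"
begin

definition W :: "'a \<Rightarrow> 'b" where "W = mollify V k"

definition W' :: "'a \<Rightarrow> 'a \<Rightarrow> 'b" where
  "W' x v = mollify V (\<lambda>z. frechet_derivative k (at z) v) x"

text \<open>
  Every estimate below is in terms of these moments of the increments of \<open>V\<close>; the Besov regularity
  enters through the third one.
\<close>

definition osc :: "nat \<Rightarrow> 'a \<Rightarrow> real" where
  "osc j x = (\<integral>y. norm (V (x - y) - V x) ^ j \<partial>ball_average e)"

sublocale Avg: prob_space "ball_average e :: 'a measure"
  by (rule prob_space_ball_average[OF pos(2)])

sublocale convolution "\<lambda>v c. c *\<^sub>R v" V M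
  by (intro convolution_mollify V_meas V_bound)

lemma emeasure_UNIV: "emeasure (ball_average e :: 'a measure) UNIV = 1"
  using Avg.emeasure_space_1 by (simp del: emeasure_uniform_measure)

lemma prob_UNIV: "measure (ball_average e :: 'a measure) UNIV = 1"
  using Avg.prob_space by (simp del: measure_uniform_measure)

lemma
  shows k_smooth: "\<And>j. Ck_on j k UNIV"
    and k_even: "\<And>x. k (- x) = k x"
    and k_nonneg: "\<And>x. 0 \<le> k x"
    and k_zero: "\<And>x. e \<le> norm x \<Longrightarrow> k x = 0"
    and k_integral: "(\<integral>x. k x \<partial>lborel) = 1"
    and k_bound: "\<And>x. k x \<le> C / measure lborel (ball (0::'a) e)"
    and k'_bound: "\<And>x v. \<bar>frechet_derivative k (at x) v\<bar> \<le> C / e / measure lborel (ball (0::'a) e) * norm v"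
  using moll by (auto simp: mollifier_def)

lemma k_C1: "C1_deriv k (\<lambda>z. frechet_derivative k (at z))"
  using C1_deriv_of_Ck k_smooth by blast

lemma k_zero': "norm x > e \<Longrightarrow> k x = 0"
  using k_zero by simp

lemma k_cont: "continuous_on UNIV k" "continuous_on UNIV (\<lambda>z. frechet_derivative k (at z) v)"
  using C1_derivD[OF k_C1] by auto

lemma k_meas[measurable]: "k \<in> borel_measurable borel" "(\<lambda>z. frechet_derivative k (at z) v) \<in> borel_measurable borel"
  using k_cont by (auto intro: borel_measurable_continuous_onI)

lemma integrable_kernel:
  fixes h :: "'a \<Rightarrow> 'c::euclidean_space"
  assumes "h \<in> borel_measurable borel" "\<And>x. norm (h x) \<le> c"
  shows "integrable lborel (\<lambda>y. k y *\<^sub>R h y)"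
  using integrable_bilinear_compact_support[OF bounded_bilinear_mollify assms k_cont(1) k_zero'] .

lemma W_C1: "C1_deriv W W'"
  using conv_C1_deriv[OF k_C1 k_zero'] by (simp add: W_def W'_def[abs_def])

lemma diff_bound: "norm (V x - V y) \<le> 2 * M"
  using norm_triangle_ineq4[of "V x" "V y"] V_bound[of x] V_bound[of y] by linarith

lemma diff_power_bound: "norm (V x - V y) ^ j \<le> (2 * M) ^ j"
  by (intro power_mono diff_bound norm_ge_zero)

lemma integrable_increment: "integrable (ball_average e) (\<lambda>y. norm (V (x - y) - V x) ^ j)"
  by (rule Avg.integrable_const_bound[where B = "(2 * M) ^ j"])
    (use diff_power_bound in auto)

lemma osc_nonneg: "osc j x \<ge> 0"
  unfolding osc_def by (auto intro!: integral_nonneg_AE)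

lemma osc_moments:
  "osc 1 x ^ 2 \<le> osc 2 x" "osc 1 x ^ 3 \<le> osc 3 x" "osc 1 x * osc 2 x \<le> 2 * osc 3 x"
  unfolding osc_def
  by (rule Avg.moment_inequalities[where c = "2 * M"]; use diff_bound in simp)+

lemma osc_2_le: "osc 2 x \<le> 2 * M * osc 1 x"
proof -
  have "osc 2 x \<le> (\<integral>y. 2 * M * norm (V (x - y) - V x) ^ 1 \<partial>ball_average e)"
    unfolding osc_def
  proof (rule integral_mono)
    show "norm (V (x - y) - V x) ^ 2 \<le> 2 * M * norm (V (x - y) - V x) ^ 1" for y
      using mult_right_mono[OF diff_bound[of "x - y" x], of "norm (V (x - y) - V x)"]
      by (simp add: power2_eq_square)
  qed (use integrable_increment integrable_increment[of x 1] in auto)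
  then show ?thesis
    by (simp add: osc_def)
qed

lemma osc_meas[measurable]: "osc j \<in> borel_measurable borel"
proof -
  have "(\<lambda>x. \<integral>y. norm (V (x - y) - V x) ^ j \<partial>ball_average e) \<in> borel_measurable borel"
    by (rule Avg.borel_measurable_lebesgue_integral) measurable
  then show ?thesis
    by (simp add: osc_def[abs_def])
qed

lemma osc_le: "osc j x \<le> (2 * M) ^ j"
proof -
  have "osc j x \<le> (\<integral>y. (2 * M) ^ j \<partial>(ball_average e :: 'a measure))"
    unfolding osc_def
    by (intro integral_mono integrable_increment) (use diff_power_bound in auto)
  then show ?thesis
    by (simp add: prob_UNIV)
qed

lemma mollify_diff:
  fixes h :: "'a \<Rightarrow> 'c::euclidean_space"
  assumes [measurable]: "h \<in> borel_measurable borel" and h: "\<And>x. norm (h x) \<le> c"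
  shows "mollify h k x - w = (\<integral>y. k y *\<^sub>R (h (x - y) - w) \<partial>lborel)"
proof -
  have "integrable lborel (\<lambda>y. k y *\<^sub>R h (x - y))"
    by (rule integrable_kernel[where c = c]) (use h in auto)
  moreover have "integrable lborel k"
    by (rule integrable_compact_support[OF k_cont(1) k_zero'])
  ultimately show ?thesis
    by (simp add: conv_reflect[OF bounded_bilinear_mollify] scaleR_diff_right
        Bochner_Integration.integral_diff k_integral)
qed

lemma W_close: "norm (W x - V x) \<le> C * osc 1 x"
proof -
  have "norm (\<integral>y. k y *\<^sub>R (V (x - y) - V x) \<partial>lborel)
      \<le> C * (\<integral>y. norm (V (x - y) - V x) \<partial>ball_average e)"
    by (rule weighted_integral_le_average[where M = "2 * M"])
      (use pos k_zero k_bound k_nonneg diff_bound in auto)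
  then show ?thesis
    by (simp add: W_def osc_def mollify_diff[OF V_meas V_bound])
qed

text \<open>
  The derivative of the kernel has integral zero, so \<open>V x\<close> can be subtracted from the
  values of \<open>V\<close>; this replaces the size of \<open>V\<close> by its oscillation.
\<close>

lemma W'_bound: "norm (W' x v) \<le> C / e * norm v * osc 1 x"
proof -
  define k' where "k' = (\<lambda>z. frechet_derivative k (at z) v)"
  have [measurable]: "k' \<in> borel_measurable borel"
    by (simp add: k'_def)
  have zero: "k' z = 0" if "norm z > e" for z
    using C1_support_deriv[OF k_C1 k_zero' that] by (simp add: k'_def)
  \<comment> \<open>The kernel is nonnegative, hence minimal wherever it vanishes.\<close>
  have sphere: "k' z = 0" if "e \<le> norm z" for z
    using differential_zero_maxmin[OF UNIV_I open_UNIV C1_derivD(1)[OF k_C1, of z]] k_nonneg k_zero[OF that]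
    by (simp add: k'_def)
  have "integrable lborel (\<lambda>y. k' y *\<^sub>R V (x - y))"
    using integrable_bilinear_compact_support[OF bounded_bilinear_mollify, of "\<lambda>y. V (x - y)" M k' e]
      V_bound zero k_cont(2)[of v] by (simp add: k'_def)
  moreover have "integrable lborel k'" "(\<integral>y. k' y \<partial>lborel) = 0"
    using integrable_compact_support[OF k_cont(2)[of v, folded k'_def] zero] integral_deriv_eq_0[OF k_C1 k_zero']
    by (auto simp: k'_def)
  ultimately have "W' x v = (\<integral>y. k' y *\<^sub>R (V (x - y) - V x) \<partial>lborel)"
    by (simp add: W'_def k'_def[symmetric] conv_reflect[OF bounded_bilinear_mollify] scaleR_diff_right
        Bochner_Integration.integral_diff)
  also have "norm \<dots> \<le> C / e * norm v * (\<integral>y. norm (V (x - y) - V x) \<partial>ball_average e)"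
    by (rule weighted_integral_le_average[where M = "2 * M"])
      (use pos sphere k'_bound[of _ v] diff_bound in \<open>auto simp: k'_def\<close>)
  finally show ?thesis
    by (simp add: osc_def)
qed

text \<open>
  Expand \<open>g\<close> at \<open>W x\<close>.  The linear term has mean zero because \<open>W x\<close> is the mean of \<open>V\<close> for the
  weight \<open>k\<close>, which leaves the quadratic remainder.
\<close>

lemma commutator_bound:
  fixes g :: "'b \<Rightarrow> 'c::euclidean_space"
  assumes g: "continuous_on UNIV g" "\<And>u. norm (g u) \<le> G"
    and g': "\<And>u. linear (g' u)" "\<And>u w. norm (g w - g u - g' u (w - u)) \<le> L * (norm (w - u))\<^sup>2"
    and L: "L \<ge> 0"
  shows "norm (mollify (\<lambda>x. g (V x)) k x - g (W x)) \<le> 2 * L * C * (1 + C\<^sup>2) * osc 2 x"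
proof -
  have [measurable]: "g \<in> borel_measurable borel" "(\<lambda>w. g' u w) \<in> borel_measurable borel" for u
    using g(1) g'(1) by (auto intro!: borel_measurable_continuous_onI linear_continuous_on
        simp: linear_conv_bounded_linear[symmetric])
  have bl: "bounded_linear (g' (W x))"
    using g'(1) linear_conv_bounded_linear by blast
  define h where "h y = g (V (x - y)) - g (W x) - g' (W x) (V (x - y) - W x)" for y
  have h_le: "norm (h y) \<le> 2 * L * (norm (V (x - y) - V x) ^ 2 + (C * osc 1 x)\<^sup>2)" for y
  proof -
    have "norm (V (x - y) - W x) \<le> norm (V (x - y) - V x) + C * osc 1 x"
      using norm_triangle_ineq4[of "V (x - y) - V x" "W x - V x"] W_close[of x] by simp
    then have "(norm (V (x - y) - W x))\<^sup>2 \<le> (norm (V (x - y) - V x) + C * osc 1 x)\<^sup>2"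
      by (intro power_mono) auto
    also have "\<dots> \<le> 2 * (norm (V (x - y) - V x) ^ 2 + (C * osc 1 x)\<^sup>2)"
      using sum_squares_bound[of "norm (V (x - y) - V x)" "C * osc 1 x"] by (simp add: power2_sum)
    finally have "L * (norm (V (x - y) - W x))\<^sup>2 \<le> L * (2 * (norm (V (x - y) - V x) ^ 2 + (C * osc 1 x)\<^sup>2))"
      using L by (rule mult_left_mono)
    then show ?thesis
      using g'(2)[of "V (x - y)" "W x"] unfolding h_def by linarith
  qed
  have h_bound: "norm (h y) \<le> 2 * L * ((2 * M) ^ 2 + (C * osc 1 x)\<^sup>2)" for y
    using order_trans[OF h_le[of y]] L diff_bound[of "x - y" x]
    by (smt (verit) mult_left_mono norm_ge_zero power_mono)
  have h_meas[measurable]: "h \<in> borel_measurable borel"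
    unfolding h_def by measurable
  have "mollify (\<lambda>x. g (V x)) k x - g (W x) = (\<integral>y. k y *\<^sub>R h y \<partial>lborel)"
  proof -
    have "norm (g (V (x - y)) - g (W x)) \<le> 2 * G" for y
      using norm_triangle_ineq4[of "g (V (x - y))" "g (W x)"] g(2)[of "V (x - y)"] g(2)[of "W x"] by linarith
    then have i1: "integrable lborel (\<lambda>y. k y *\<^sub>R (g (V (x - y)) - g (W x)))"
      by (intro integrable_kernel[where c = "2 * G"]) auto
    have "norm (V (x - y) - W x) \<le> 2 * M + C * osc 1 x" for y
      using norm_triangle_ineq4[of "V (x - y) - V x" "W x - V x"] W_close[of x] diff_bound[of "x - y" x] by simp
    then have i2: "integrable lborel (\<lambda>y. k y *\<^sub>R (V (x - y) - W x))"
      by (intro integrable_kernel[where c = "2 * M + C * osc 1 x"]) auto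
    have "(\<integral>y. k y *\<^sub>R g' (W x) (V (x - y) - W x) \<partial>lborel) = (\<integral>y. g' (W x) (k y *\<^sub>R (V (x - y) - W x)) \<partial>lborel)"
      by (simp add: linear_cmul[OF g'(1)])
    also have "\<dots> = g' (W x) (\<integral>y. k y *\<^sub>R (V (x - y) - W x) \<partial>lborel)"
      by (rule integral_bounded_linear[OF bl i2])
    also have "\<dots> = 0"
      using mollify_diff[OF V_meas V_bound, of x "W x"] by (simp add: W_def linear_0[OF g'(1)])
    finally have 0: "(\<integral>y. k y *\<^sub>R g' (W x) (V (x - y) - W x) \<partial>lborel) = 0" .
    have i3: "integrable lborel (\<lambda>y. k y *\<^sub>R g' (W x) (V (x - y) - W x))"
      using integrable_bounded_linear[OF bl i2] by (simp add: linear_cmul[OF g'(1)])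
    have "mollify (\<lambda>x. g (V x)) k x - g (W x) = (\<integral>y. k y *\<^sub>R (g (V (x - y)) - g (W x)) \<partial>lborel)"
      by (rule mollify_diff[where c = G]) (use g(2) in auto)
    then show ?thesis
      using Bochner_Integration.integral_diff[OF i1 i3] 0 by (simp add: h_def scaleR_diff_right)
  qed
  also have "norm \<dots> \<le> C * (\<integral>y. norm (h y) \<partial>ball_average e)"
    by (rule weighted_integral_le_average) (use pos k_zero k_bound k_nonneg h_bound in auto)
  also have "\<dots> \<le> C * (2 * L * (osc 2 x + (C * osc 1 x)\<^sup>2))"
  proof (rule mult_left_mono)
    have "(\<integral>y. norm (h y) \<partial>ball_average e)
        \<le> (\<integral>y. 2 * L * (norm (V (x - y) - V x) ^ 2 + (C * osc 1 x)\<^sup>2) \<partial>ball_average e)"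
    proof (rule integral_mono)
      show "integrable (ball_average e) (\<lambda>y. norm (h y))"
        by (rule Avg.integrable_const_bound[where B = "2 * L * ((2 * M) ^ 2 + (C * osc 1 x)\<^sup>2)"])
          (use h_bound in auto)
    qed (use integrable_increment h_le in auto)
    also have "\<dots> = 2 * L * (osc 2 x + (C * osc 1 x)\<^sup>2)"
      using integrable_increment[of x 2] by (simp add: osc_def prob_UNIV)
    finally show "(\<integral>y. norm (h y) \<partial>ball_average e) \<le> 2 * L * (osc 2 x + (C * osc 1 x)\<^sup>2)" .
  qed (use pos in simp)
  also have "\<dots> \<le> C * (2 * L * (osc 2 x + C\<^sup>2 * osc 2 x))"
    using osc_moments(1)[of x] pos L by (intro mult_left_mono add_mono) (auto simp: power_mult_distrib)
  finally show ?thesis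
    by (simp add: algebra_simps)
qed

text \<open>
  By Fubini's theorem, a bound for each single shift \<open>y\<close> passes to the average over
  all shifts.
\<close>

lemma integral_osc_3:
  assumes S: "S \<in> sets borel" "bounded S"
    and B: "\<And>y. norm y < e \<Longrightarrow> (\<integral>x. indicator S x * norm (V x - V (x - y)) ^ 3 \<partial>lborel) \<le> B"
  shows "(\<integral>x. indicator S x * osc 3 x \<partial>lborel) \<le> B"
proof -
  note [measurable] = S(1)
  have fin: "emeasure lborel S < \<infinity>"
    using emeasure_bounded_finite[OF S(2)] .
  interpret pair_sigma_finite "lborel :: 'a measure" "ball_average e :: 'a measure"
    by standard
  have int: "integrable (lborel \<Otimes>\<^sub>M ball_average e) (\<lambda>(x, y). indicator S x * norm (V x - V (x - y)) ^ 3)"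
  proof (rule integrableI_bounded_set[where A = "S \<times> UNIV" and B = "(2 * M) ^ 3"])
    have "emeasure (lborel \<Otimes>\<^sub>M (ball_average e :: 'a measure)) (S \<times> UNIV) = emeasure lborel S * 1"
      using S(1) by (subst Avg.emeasure_pair_measure_Times) (auto simp del: emeasure_uniform_measure simp: emeasure_UNIV)
    then show "emeasure (lborel \<Otimes>\<^sub>M (ball_average e :: 'a measure)) (S \<times> UNIV) < \<infinity>"
      using fin by simp
    show "AE z in lborel \<Otimes>\<^sub>M ball_average e. z \<in> S \<times> UNIV \<longrightarrow>
        norm (case z of (x, y) \<Rightarrow> indicator S x * norm (V x - V (x - y)) ^ 3) \<le> (2 * M) ^ 3"
      using diff_power_bound[of _ _ 3] by auto
    show "(\<lambda>(x, y). indicator S x * norm (V x - V (x - y)) ^ 3) \<in> borel_measurable (lborel \<Otimes>\<^sub>M ball_average e)"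
      by measurable
    show "AE z in lborel \<Otimes>\<^sub>M ball_average e. z \<notin> S \<times> UNIV \<longrightarrow>
        (case z of (x, y) \<Rightarrow> indicator S x * norm (V x - V (x - y)) ^ 3) = 0"
      by (intro AE_I2) (auto simp: indicator_def)
  qed (use S(1) in auto)
  have "(\<integral>x. indicator S x * osc 3 x \<partial>lborel)
      = (\<integral>x. \<integral>y. indicator S x * norm (V x - V (x - y)) ^ 3 \<partial>ball_average e \<partial>lborel)"
    by (simp add: osc_def norm_minus_commute)
  also have "\<dots> = (\<integral>y. \<integral>x. indicator S x * norm (V x - V (x - y)) ^ 3 \<partial>lborel \<partial>ball_average e)"
    by (rule Fubini_integral[OF int, symmetric])
  also have "\<dots> \<le> (\<integral>y. B \<partial>(ball_average e :: 'a measure))"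
  proof (rule integral_mono_AE)
    show "integrable (ball_average e) (\<lambda>y. \<integral>x. indicator S x * norm (V x - V (x - y)) ^ 3 \<partial>lborel)"
      using integrable_snd[OF int] .
    have "emeasure lborel (ball (0::'a) e) \<noteq> 0" "emeasure lborel (ball (0::'a) e) \<noteq> \<infinity>"
      using emeasure_lborel_ball_finite[of "0::'a" e] measure_ball_pos[OF pos(2), where 'a = 'a]
      by (auto simp: measure_def)
    then show "AE y in ball_average e. (\<integral>x. indicator S x * norm (V x - V (x - y)) ^ 3 \<partial>lborel) \<le> B"
      by (intro AE_uniform_measureI) (use B in auto)
  qed auto
  also have "\<dots> = B"
    by (simp add: prob_UNIV)
  finally show ?thesis .
qed

end

section \<open>The companion law on Euclidean space\<close>

text \<open>
  Finitely many such bounds, each valid for all large constants, hold with one common constant.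
\<close>

lemma eventually_uniform_bound:
  fixes F G :: "'a \<Rightarrow> 'b \<Rightarrow> real"
  assumes "\<exists>c>0. \<forall>x y. F x y \<le> c * G x y" "\<And>x y. G x y \<ge> 0"
  shows "\<forall>\<^sub>F B in at_top. \<forall>x y. F x y \<le> B * G x y"
proof -
  obtain c where c: "\<And>x y. F x y \<le> c * G x y"
    using assms(1) by blast
  show ?thesis
    using eventually_ge_at_top[of c]
    by eventually_elim (meson c assms(2) mult_right_mono order_trans)
qed

lemma C1_eventually_bounds:
  fixes f :: "'a::euclidean_space \<Rightarrow> 'b::euclidean_space"
  assumes f: "C1_deriv f f'" "\<And>x. norm x > R \<Longrightarrow> f x = 0"
  shows "\<forall>\<^sub>F B in at_top. (\<forall>x y. norm (f x - f y) \<le> B * norm (x - y)) \<and>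
    (\<forall>x v. norm (f' x v) \<le> B * norm v) \<and> (\<forall>x. norm (f x) \<le> B)"
proof (intro eventually_conj)
  show "\<forall>\<^sub>F B in at_top. \<forall>x y. norm (f x - f y) \<le> B * norm (x - y)"
    using C1_lipschitz[OF f(1), of R] f(2) by (intro eventually_uniform_bound) auto
  show "\<forall>\<^sub>F B in at_top. \<forall>x v. norm (f' x v) \<le> B * norm v"
    using C1_bounded_deriv[OF f(1), of R] f(2) by (intro eventually_uniform_bound) auto
  have "\<exists>c>0. \<forall>x (y::unit). norm (f x) \<le> c * 1"
    using bounded_compact_support[OF C1_derivD(3)[OF f(1)], of R] f(2) by auto
  from eventually_uniform_bound[OF this] show "\<forall>\<^sub>F B in at_top. \<forall>x. norm (f x) \<le> B"
    by simp
qed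

context mollified
begin

text \<open>
  The three terms are the errors of the introduction for one coordinate direction \<open>j\<close>.  In the term
  with \<open>q'\<close> and \<open>g'\<close>, the companion relation is available only within distance \<open>r\<close> of \<open>V x\<close>;
  farther away \<open>1 \<le> (C a / r)\<^sup>2\<close>, where \<open>a\<close> is the first moment, turns the factor \<open>a/e\<close> of \<open>W'\<close>
  into \<open>a\<^sup>3/e\<close>.
\<close>

lemma defect_estimate:
  fixes g :: "'a \<Rightarrow> 'b \<Rightarrow> 'b" and q :: "'a \<Rightarrow> 'b \<Rightarrow> real" and b :: "'b \<Rightarrow> 'b" and \<psi> :: "'a \<Rightarrow> real"
  assumes j: "j \<in> Basis" and B: "B \<ge> 0" and r: "r > 0" and M: "M \<ge> 0"
    and q: "\<And>u w. \<bar>q j u - q j w\<bar> \<le> B * norm (u - w)" "\<And>u w. \<bar>q' j u w\<bar> \<le> B * norm w"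
    and g: "continuous_on UNIV (g j)" "\<And>u. norm (g j u) \<le> B" "\<And>u. linear (g' j u)"
      "\<And>u w. norm (g' j u w) \<le> B * norm w"
      "\<And>u w. norm (g j w - g j u - g' j u (w - u)) \<le> B * (norm (w - u))\<^sup>2"
    and b: "\<And>u. norm (b u) \<le> B" "\<And>u w. norm (b' u w) \<le> B * norm w"
    and \<psi>: "\<bar>\<psi> x\<bar> \<le> B" "\<bar>\<psi>' x j\<bar> \<le> B"
    and compat: "\<And>u. norm (u - V x) < r \<Longrightarrow> q' j u (W' x j) = b u \<bullet> g' j u (W' x j)"
  shows "\<bar>(q j (V x) - q j (W x)) * \<psi>' x j
      - \<psi> x * (q' j (W x) (W' x j) - b (W x) \<bullet> g' j (W x) (W' x j))
      + (g j (W x) - mollify (\<lambda>x. g j (V x)) k x) \<bullet> (\<psi>' x j *\<^sub>R b (W x) + \<psi> x *\<^sub>R b' (W x) (W' x j))\<bar>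
    \<le> (B\<^sup>2 * C + 4 * B ^ 3 * C * (1 + C\<^sup>2) * M) * osc 1 x
      + (B * (B + B\<^sup>2) * C ^ 3 / r\<^sup>2 + 4 * B ^ 3 * C\<^sup>2 * (1 + C\<^sup>2)) / e * osc 3 x"
proof -
  define a where "a = osc 1 x"
  have a: "a \<ge> 0" by (simp add: a_def osc_nonneg)
  note pos_simps = pos B a osc_nonneg
  have W'_le: "norm (W' x j) \<le> C / e * a"
    using W'_bound[of x j] j by (simp add: a_def)
  have 1: "\<bar>(q j (V x) - q j (W x)) * \<psi>' x j\<bar> \<le> B\<^sup>2 * C * a"
  proof -
    have "\<bar>q j (V x) - q j (W x)\<bar> \<le> B * (C * a)"
      using q(1)[of "V x" "W x"] W_close[of x] mult_left_mono[OF W_close[of x] B]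
      by (simp add: a_def norm_minus_commute)
    then have "\<bar>q j (V x) - q j (W x)\<bar> * \<bar>\<psi>' x j\<bar> \<le> B * (C * a) * B"
      using pos_simps \<psi> by (intro mult_mono) auto
    then show ?thesis
      by (simp add: abs_mult power2_eq_square mult_ac)
  qed
  have 2: "\<bar>\<psi> x * (q' j (W x) (W' x j) - b (W x) \<bullet> g' j (W x) (W' x j))\<bar>
      \<le> B * (B + B\<^sup>2) * C ^ 3 / r\<^sup>2 / e * osc 3 x"
  proof (cases "norm (W x - V x) < r")
    case True
    then show ?thesis
      using compat[OF True] pos_simps by simp
  next
    case False
    then have "r \<le> C * a"
      using W_close[of x] by (simp add: a_def)
    then have one: "1 \<le> (C * a)\<^sup>2 / r\<^sup>2"
      using r power_mono[of r "C * a" 2] by simp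
    have "\<bar>q' j (W x) (W' x j) - b (W x) \<bullet> g' j (W x) (W' x j)\<bar>
        \<le> B * norm (W' x j) + B * (B * norm (W' x j))"
    proof -
      have "\<bar>b (W x) \<bullet> g' j (W x) (W' x j)\<bar> \<le> norm (b (W x)) * norm (g' j (W x) (W' x j))"
        by (rule Cauchy_Schwarz_ineq2)
      also have "\<dots> \<le> B * (B * norm (W' x j))"
        using b(1) g(4) B by (intro mult_mono) auto
      finally show ?thesis
        using q(2)[of "W x" "W' x j"] by linarith
    qed
    also have "\<dots> = (B + B\<^sup>2) * norm (W' x j)"
      by (simp add: algebra_simps power2_eq_square)
    also have "\<dots> \<le> (B + B\<^sup>2) * (C / e * a)"
      using B by (intro mult_left_mono W'_le) auto
    also have "\<dots> \<le> (B + B\<^sup>2) * (C / e * a) * ((C * a)\<^sup>2 / r\<^sup>2)"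
      using mult_left_mono[OF one, of "(B + B\<^sup>2) * (C / e * a)"] pos_simps by simp
    also have "\<dots> = (B + B\<^sup>2) * C ^ 3 / r\<^sup>2 / e * a ^ 3"
      by (simp add: power2_eq_square power3_eq_cube mult_ac)
    also have "\<dots> \<le> (B + B\<^sup>2) * C ^ 3 / r\<^sup>2 / e * osc 3 x"
      using osc_moments(2)[of x] pos_simps by (intro mult_left_mono) (auto simp: a_def)
    finally have "\<bar>\<psi> x\<bar> * \<bar>q' j (W x) (W' x j) - b (W x) \<bullet> g' j (W x) (W' x j)\<bar>
        \<le> B * ((B + B\<^sup>2) * C ^ 3 / r\<^sup>2 / e * osc 3 x)"
      using \<psi> B by (intro mult_mono) auto
    then show ?thesis
      by (simp add: abs_mult mult_ac)
  qed
  have 3: "\<bar>(g j (W x) - mollify (\<lambda>x. g j (V x)) k x) \<bullet> (\<psi>' x j *\<^sub>R b (W x) + \<psi> x *\<^sub>R b' (W x) (W' x j))\<bar>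
      \<le> 4 * B ^ 3 * C * (1 + C\<^sup>2) * M * a + 4 * B ^ 3 * C\<^sup>2 * (1 + C\<^sup>2) / e * osc 3 x"
  proof -
    have n1: "norm (g j (W x) - mollify (\<lambda>x. g j (V x)) k x) \<le> 2 * B * C * (1 + C\<^sup>2) * osc 2 x"
      using commutator_bound[OF g(1,2,3,5) B, of x] by (simp add: norm_minus_commute)
    have "norm (\<psi>' x j *\<^sub>R b (W x)) \<le> B * B"
      using \<psi> b(1)[of "W x"] B by (auto intro!: mult_mono)
    moreover have "norm (\<psi> x *\<^sub>R b' (W x) (W' x j)) \<le> B * (B * (C / e * a))"
      unfolding norm_scaleR using \<psi> B order_trans[OF b(2)[of "W x" "W' x j"] mult_left_mono[OF W'_le B]]
      by (intro mult_mono) auto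
    ultimately have n2: "norm (\<psi>' x j *\<^sub>R b (W x) + \<psi> x *\<^sub>R b' (W x) (W' x j)) \<le> B\<^sup>2 * (1 + C / e * a)"
      using norm_triangle_ineq[of "\<psi>' x j *\<^sub>R b (W x)" "\<psi> x *\<^sub>R b' (W x) (W' x j)"]
      by (simp add: power2_eq_square algebra_simps)
    have "\<bar>(g j (W x) - mollify (\<lambda>x. g j (V x)) k x) \<bullet> (\<psi>' x j *\<^sub>R b (W x) + \<psi> x *\<^sub>R b' (W x) (W' x j))\<bar>
        \<le> 2 * B * C * (1 + C\<^sup>2) * osc 2 x * (B\<^sup>2 * (1 + C / e * a))"
      by (rule order_trans[OF Cauchy_Schwarz_ineq2 mult_mono[OF n1 n2]]) (use pos_simps in auto)
    also have "\<dots> = 2 * B ^ 3 * C * (1 + C\<^sup>2) * osc 2 x + 2 * B ^ 3 * C\<^sup>2 * (1 + C\<^sup>2) / e * (osc 1 x * osc 2 x)"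
      by (simp add: a_def power2_eq_square power3_eq_cube algebra_simps add_divide_distrib)
    also have "\<dots> \<le> 2 * B ^ 3 * C * (1 + C\<^sup>2) * (2 * M * osc 1 x) + 2 * B ^ 3 * C\<^sup>2 * (1 + C\<^sup>2) / e * (2 * osc 3 x)"
      by (rule add_mono; intro mult_left_mono osc_2_le osc_moments(3)) (use pos_simps in auto)
    finally show ?thesis
      by (simp add: a_def algebra_simps add_divide_distrib)
  qed
  have "\<bar>u - v + w\<bar> \<le> \<bar>u\<bar> + \<bar>v\<bar> + \<bar>w\<bar>" for u v w :: real
    by linarith
  from order_trans[OF this add_mono[OF add_mono[OF 1 2] 3]] show ?thesis
    by (simp add: a_def algebra_simps add_divide_distrib)
qed

text \<open>
  Smoothness is inherited from the kernel, while the formula for the derivative comes from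
  differentiating \<open>f\<close>.
\<close>

lemma mollify_C1:
  fixes f :: "'a \<Rightarrow> 'b"
  assumes f: "C1_deriv f f'" "\<And>x. norm x > R \<Longrightarrow> f x = 0"
  shows "C1_deriv (mollify f k) (\<lambda>x v. mollify (\<lambda>z. f' z v) k x)" "Ck_on i (mollify f k) UNIV"
proof -
  obtain c where c: "\<And>x. norm (f x) \<le> c"
    using bounded_compact_support[OF C1_derivD(3)[OF f(1)] f(2)] by blast
  obtain M where M: "\<And>x. norm (k x) \<le> M"
    using bounded_compact_support[OF k_cont(1) k_zero'] by blast
  have [measurable]: "f \<in> borel_measurable borel" "(\<lambda>x. f' x v) \<in> borel_measurable borel" for v
    using C1_derivD[OF f(1)] by (auto intro: borel_measurable_continuous_onI)
  interpret fk: convolution "\<lambda>v c. c *\<^sub>R v" f c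
    by (intro convolution_mollify c) auto
  show "Ck_on i (mollify f k) UNIV"
    using fk.conv_smooth[OF k_smooth k_zero'] .
  interpret kf: convolution "\<lambda>c v. c *\<^sub>R v" k M
    by (intro convolution.intro bounded_bilinear_scaleR M) auto
  show "C1_deriv (mollify f k) (\<lambda>x v. mollify (\<lambda>z. f' z v) k x)"
  proof -
    have "mollify f k = conv (\<lambda>c v. c *\<^sub>R v) k f"
      "mollify (\<lambda>z. f' z v) k = conv (\<lambda>c v. c *\<^sub>R v) k (\<lambda>z. f' z v)" for v
      by (auto intro!: ext conv_flip[OF bounded_bilinear_mollify])
    then show ?thesis
      using kf.conv_C1_deriv[OF f(1), of R] f(2) by simp
  qed
qed

lemma mollify_support:
  assumes "compact S" "\<And>x. x \<notin> S \<Longrightarrow> f x = 0"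
  shows "compact {x + y | x y. x \<in> S \<and> y \<in> cball 0 e}"
    "x \<notin> {x + y | x y. x \<in> S \<and> y \<in> cball 0 e} \<Longrightarrow> mollify f k x = 0"
proof -
  show "compact {x + y | x y. x \<in> S \<and> y \<in> cball 0 e}"
    by (rule compact_sums[OF assms(1) compact_cball])
  assume x: "x \<notin> {x + y | x y. x \<in> S \<and> y \<in> cball 0 e}"
  have "k (x - y) *\<^sub>R f y = 0" for y
  proof (cases "y \<in> S")
    case True
    have "x - y \<notin> cball 0 e"
    proof
      assume "x - y \<in> cball 0 e"
      then have "\<exists>a b. x = a + b \<and> a \<in> S \<and> b \<in> cball 0 e"
        using True by (intro exI[of _ y] exI[of _ "x - y"]) auto
      with x show False by blast
    qed
    then show ?thesis
      using k_zero by simp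
  qed (use assms(2) in simp)
  then show "mollify f k x = 0"
    unfolding conv_def by (simp only: Bochner_Integration.integral_zero)
qed

end

text \<open>
  At scale \<open>e\<close> the integrand is the defect, which \<open>defect_estimate\<close>
  bounds, plus terms of integral zero: two exact derivatives of compactly supported functions, and
  the given law tested with the mollification of \<open>\<psi> b(W)\<close>.
\<close>

theorem companion_law_euclidean:
  fixes V :: "'a::euclidean_space \<Rightarrow> 'b::euclidean_space"
    and g :: "'a \<Rightarrow> 'b \<Rightarrow> 'b" and q :: "'a \<Rightarrow> 'b \<Rightarrow> real" and b :: "'b \<Rightarrow> 'b" and \<psi> :: "'a \<Rightarrow> real"
  assumes X: "open X"
    and V: "V \<in> borel_measurable borel" "\<And>x. norm (V x) \<le> M"
    and K: "AE x in lborel. x \<in> X \<longrightarrow> V x \<in> K"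
    and besov: "\<And>S. compact S \<Longrightarrow> S \<subseteq> X \<Longrightarrow> \<exists>c d. d > 0 \<and> (\<forall>y. norm y < d \<longrightarrow>
        (\<integral>x. indicator S x * norm (V x - V (x - y)) ^ 3 \<partial>lborel) \<le> c * norm y powr (3 * \<alpha>))"
    and \<alpha>: "\<alpha> > 1/3"
    and g: "\<And>j. Ck_on 2 (g j) UNIV" "\<And>j u. norm u > R \<Longrightarrow> g j u = 0"
    and q: "\<And>j. C1_deriv (q j) (q' j)" "\<And>j u. norm u > R \<Longrightarrow> q j u = 0"
    and b: "C1_deriv b b'" "\<And>u. norm u > R \<Longrightarrow> b u = 0"
    and r: "r > 0"
    and compat: "\<And>j u w p. p \<in> K \<Longrightarrow> norm (u - p) < r \<Longrightarrow>
        q' j u w = b u \<bullet> frechet_derivative (g j) (at u) w"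
    and weak: "\<And>\<phi> S. (\<And>i. Ck_on i \<phi> UNIV) \<Longrightarrow> compact S \<Longrightarrow> S \<subseteq> X \<Longrightarrow> (\<And>x. x \<notin> S \<Longrightarrow> \<phi> x = 0) \<Longrightarrow>
        (\<integral>x. (\<Sum>j\<in>Basis. g j (V x) \<bullet> frechet_derivative \<phi> (at x) j) \<partial>lborel) = 0"
    and \<psi>: "C1_deriv \<psi> \<psi>'" and S: "compact S" "S \<subseteq> X" "\<And>x. x \<notin> S \<Longrightarrow> \<psi> x = 0"
  shows "(\<integral>x. (\<Sum>j\<in>Basis. q j (V x) * \<psi>' x j) \<partial>lborel) = 0"
proof -
  define I where "I = (\<Sum>j\<in>Basis. \<integral>x. q j (V x) * \<psi>' x j \<partial>lborel)"
  define g' where "g' j u = frechet_derivative (g j) (at u)" for j u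
  have g_C1: "C1_deriv (g j) (g' j)" for j
    unfolding g'_def using g(1)[of j] C1_deriv_of_Ck by (simp only: numeral_2_eq_2)
  note [measurable] = V(1)
  have M: "M \<ge> 0"
    using V(2) norm_ge_zero order_trans by blast
  obtain C where C: "C > 0" "\<And>e. e > 0 \<Longrightarrow> \<exists>k::'a \<Rightarrow> real. mollifier C e k"
    using mollifier_exists[where 'a = 'a] by blast
  obtain R' where R': "\<And>x. norm x > R' \<Longrightarrow> x \<notin> S"
    using compact_imp_bounded[OF S(1)] by (meson bounded_iff not_le)
  have \<psi>_R': "\<psi> x = 0" if "norm x > R'" for x
    using R' S(3) that by blast
  have \<psi>'_zero: "\<psi>' x v = 0" if "x \<notin> S" for x v
    using C1_deriv_zero_outside[OF \<psi> compact_imp_closed[OF S(1)] S(3) that] .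
  obtain d0 c0 where besov_S: "d0 > 0" "\<And>y. norm y < d0 \<Longrightarrow>
        (\<integral>x. indicator S x * norm (V x - V (x - y)) ^ 3 \<partial>lborel) \<le> c0 * norm y powr (3 * \<alpha>)"
    using besov[OF S(1,2)] by blast
  obtain d1 where d1: "d1 > 0" "(\<Union>x\<in>S. cball x d1) \<subseteq> X"
    using compact_subset_open_imp_cball_epsilon_subset[OF S(1) X S(2)] by blast
  define c where "c = max c0 0"

  \<comment> \<open>One constant for all the bounds that do not involve the mollifier.\<close>
  note bounds = C1_eventually_bounds[OF q(1) q(2)] C1_eventually_bounds[OF g_C1 g(2)]
    C1_eventually_bounds[OF b] C1_eventually_bounds[OF \<psi> \<psi>_R']
  have Taylor_g: "\<forall>\<^sub>F B in at_top. \<forall>u w. norm (g j w - g j u - g' j u (w - u)) \<le> B * (norm (w - u))\<^sup>2" for j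
    using C2_Taylor[OF g(1)[of j], of R] g(2) unfolding g'_def by (intro eventually_uniform_bound) auto
  have "\<forall>\<^sub>F B in at_top. B \<ge> (0::real) \<and> (\<forall>j\<in>Basis.
      ((\<forall>u w. norm (q j u - q j w) \<le> B * norm (u - w)) \<and>
        (\<forall>u w. norm (q' j u w) \<le> B * norm w) \<and> (\<forall>u. norm (q j u) \<le> B)) \<and>
      ((\<forall>u w. norm (g j u - g j w) \<le> B * norm (u - w)) \<and>
        (\<forall>u w. norm (g' j u w) \<le> B * norm w) \<and> (\<forall>u. norm (g j u) \<le> B)) \<and>
      (\<forall>u w. norm (g j w - g j u - g' j u (w - u)) \<le> B * (norm (w - u))\<^sup>2)) \<and>
      ((\<forall>u w. norm (b u - b w) \<le> B * norm (u - w)) \<and>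
        (\<forall>u w. norm (b' u w) \<le> B * norm w) \<and> (\<forall>u. norm (b u) \<le> B)) \<and>
      ((\<forall>x y. norm (\<psi> x - \<psi> y) \<le> B * norm (x - y)) \<and>
        (\<forall>x v. norm (\<psi>' x v) \<le> B * norm v) \<and> (\<forall>x. norm (\<psi> x) \<le> B))"
    (is "\<forall>\<^sub>F B in at_top. ?bounds B")
    by (intro eventually_conj[OF eventually_ge_at_top] eventually_conj[OF eventually_ball_finite] ballI
        finite_Basis eventually_conj[OF bounds(1)] eventually_conj[OF bounds(2) Taylor_g]
        eventually_conj[OF bounds(3) bounds(4)])
  from eventually_happens'[OF trivial_limit_at_top_linorder this] obtain B where all: "?bounds B"
    by (elim exE)
  have B: "B \<ge> 0"
      "\<And>j u w. j \<in> Basis \<Longrightarrow> \<bar>q j u - q j w\<bar> \<le> B * norm (u - w)"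
      "\<And>j u w. j \<in> Basis \<Longrightarrow> \<bar>q' j u w\<bar> \<le> B * norm w"
      "\<And>j u. j \<in> Basis \<Longrightarrow> norm (g j u) \<le> B"
      "\<And>j u w. j \<in> Basis \<Longrightarrow> norm (g' j u w) \<le> B * norm w"
      "\<And>j u w. j \<in> Basis \<Longrightarrow> norm (g j w - g j u - g' j u (w - u)) \<le> B * (norm (w - u))\<^sup>2"
      "\<And>u. norm (b u) \<le> B" "\<And>u w. norm (b' u w) \<le> B * norm w"
      "\<And>x. \<bar>\<psi> x\<bar> \<le> B" "\<And>x v. \<bar>\<psi>' x v\<bar> \<le> B * norm v"
    using all by simp_all

  define c1 where "c1 = B\<^sup>2 * C + 4 * B ^ 3 * C * (1 + C\<^sup>2) * M"
  define c2 where "c2 = B * (B + B\<^sup>2) * C ^ 3 / r\<^sup>2 + 4 * B ^ 3 * C\<^sup>2 * (1 + C\<^sup>2)"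
  have c12: "c1 \<ge> 0" "c2 \<ge> 0"
    using B(1) C(1) M by (auto simp: c1_def c2_def)
  have qV_int: "integrable lborel (\<lambda>x. q j (V x) * \<psi>' x j)" if "j \<in> Basis" for j
  proof -
    obtain cq where cq: "\<And>u. norm (q j u) \<le> cq"
      using bounded_compact_support[OF C1_derivD(3)[OF q(1)[of j]], of R] q(2) by blast
    have "(\<lambda>x. q j (V x)) \<in> borel_measurable borel"
      using measurable_compose[OF V(1) borel_measurable_continuous_onI[OF C1_derivD(3)[OF q(1)]]] .
    then show ?thesis
      using integrable_bilinear_compact_support[OF bounded_bilinear_mult _ cq C1_derivD(2)[OF \<psi>], of _ R' j]
        R' \<psi>'_zero by blast
  qed

  have main: "\<bar>I\<bar> \<le> DIM('a) * (c1 * (measure lborel S + c) * e powr \<alpha> + c2 * c * e powr (3 * \<alpha> - 1))"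
    if e: "0 < e" "e < d0" "e < d1" for e
  proof -
    obtain k :: "'a \<Rightarrow> real" where k: "mollifier C e k"
      using C(2)[OF e(1)] by blast
    interpret mollified V M C e k
      by standard (use V C(1) e(1) k in auto)
    define f where "f x = \<psi> x *\<^sub>R b (W x)" for x
    define f' where "f' x v = \<psi> x *\<^sub>R b' (W x) (W' x v) + \<psi>' x v *\<^sub>R b (W x)" for x v
    have f: "C1_deriv f f'"
      unfolding f_def[abs_def] f'_def[abs_def]
      by (rule C1_deriv_bilinear[OF bounded_bilinear_scaleR \<psi> C1_deriv_compose[OF b(1) W_C1]])
    have f_zero: "f x = 0" if "x \<notin> S" for x
      using S(3) that by (simp add: f_def)
    have f'_zero: "f' x v = 0" if "x \<notin> S" for x v
      using S(3) \<psi>'_zero that by (simp add: f'_def)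
    (* E1 and E2 are the derivatives of psi q(W) and of f . g(W) in direction j; E3 is the given law tested with mollified f. *)
    define D where "D j x = (q j (V x) - q j (W x)) * \<psi>' x j
      - \<psi> x * (q' j (W x) (W' x j) - b (W x) \<bullet> g' j (W x) (W' x j))
      + (g j (W x) - mollify (\<lambda>x. g j (V x)) k x) \<bullet> (\<psi>' x j *\<^sub>R b (W x) + \<psi> x *\<^sub>R b' (W x) (W' x j))" for j x
    define E1 where "E1 j x = \<psi> x * q' j (W x) (W' x j) + \<psi>' x j * q j (W x)" for j x
    define E2 where "E2 j x = f x \<bullet> g' j (W x) (W' x j) + f' x j \<bullet> g j (W x)" for j x
    define E3 where "E3 j x = mollify (\<lambda>x. g j (V x)) k x \<bullet> f' x j" for j x
    have split: "q j (V x) * \<psi>' x j = D j x + E1 j x - E2 j x + E3 j x" for j x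
      by (simp add: D_def E1_def E2_def E3_def f_def f'_def algebra_simps inner_add_left inner_diff_left inner_commute)

    have E1: "integrable lborel (E1 j)" "(\<integral>x. E1 j x \<partial>lborel) = 0" for j
    proof -
      have C1: "C1_deriv (\<lambda>x. \<psi> x * q j (W x)) (\<lambda>x v. \<psi> x * q' j (W x) (W' x v) + \<psi>' x v * q j (W x))"
        by (rule C1_deriv_bilinear[OF bounded_bilinear_mult \<psi> C1_deriv_compose[OF q(1) W_C1]])
      have zero: "\<psi> x * q j (W x) = 0" if "norm x > R'" for x
        using \<psi>_R' that by simp
      show "(\<integral>x. E1 j x \<partial>lborel) = 0"
        unfolding E1_def by (rule integral_deriv_eq_0[OF C1 zero])
      show "integrable lborel (E1 j)"
        unfolding E1_def
        by (rule integrable_compact_support[OF C1_derivD(2)[OF C1, of j], of R'])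
          (use R' S(3) \<psi>'_zero in auto)
    qed
    have E2: "integrable lborel (E2 j)" "(\<integral>x. E2 j x \<partial>lborel) = 0" for j
    proof -
      have C1: "C1_deriv (\<lambda>x. f x \<bullet> g j (W x)) (\<lambda>x v. f x \<bullet> g' j (W x) (W' x v) + f' x v \<bullet> g j (W x))"
        by (rule C1_deriv_bilinear[OF bounded_bilinear_inner f C1_deriv_compose[OF g_C1 W_C1]])
      have zero: "f x \<bullet> g j (W x) = 0" if "norm x > R'" for x
        using f_zero R' that by simp
      show "(\<integral>x. E2 j x \<partial>lborel) = 0"
        unfolding E2_def by (rule integral_deriv_eq_0[OF C1 zero])
      show "integrable lborel (E2 j)"
        unfolding E2_def
        by (rule integrable_compact_support[OF C1_derivD(2)[OF C1, of j], of R'])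
          (use R' f_zero f'_zero in auto)
    qed
    have gV: "(\<lambda>x. g j (V x)) \<in> borel_measurable borel" "norm (g j (V x)) \<le> B" if "j \<in> Basis" for j x
      using measurable_compose[OF V(1) borel_measurable_continuous_onI[OF C1_derivD(3)[OF g_C1[of j]]]]
        B(4)[OF that] by auto
    have E3_int: "integrable lborel (E3 j)" if "j \<in> Basis" for j
    proof -
      interpret gj: convolution "\<lambda>v c. c *\<^sub>R v" "\<lambda>x. g j (V x)" B
        by (intro convolution_mollify gV that)
      have "continuous_on UNIV (\<lambda>x. mollify (\<lambda>x. g j (V x)) k x \<bullet> f' x j)"
        by (intro continuous_on_inner gj.continuous_conv[OF k_cont(1) k_zero'] C1_derivD(2)[OF f])
      then show ?thesis
        unfolding E3_def by (rule integrable_compact_support[where R = R']) (use R' f'_zero in auto)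
    qed
    have E3: "(\<Sum>j\<in>Basis. \<integral>x. E3 j x \<partial>lborel) = 0"
    proof -
      define \<phi> where "\<phi> = mollify f k"
      have f_R': "f x = 0" "f' x v = 0" if "norm x > R'" for x v
        using f_zero f'_zero R' that by auto
      have \<phi>: "C1_deriv \<phi> (\<lambda>x v. mollify (\<lambda>z. f' z v) k x)" "Ck_on i \<phi> UNIV" for i
        unfolding \<phi>_def by (rule mollify_C1[OF f f_R'(1)], assumption)+
      have d\<phi>: "frechet_derivative \<phi> (at x) v = mollify (\<lambda>z. f' z v) k x" for x v
        using frechet_derivative_eq[OF C1_derivD(1)[OF \<phi>(1)]] by simp
      have eq: "(\<integral>x. E3 j x \<partial>lborel) = (\<integral>x. g j (V x) \<bullet> frechet_derivative \<phi> (at x) j \<partial>lborel)"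
        if "j \<in> Basis" for j
        unfolding d\<phi> E3_def
        by (rule mollify_adjoint[OF gV[OF that] C1_derivD(2)[OF f] f_R'(2) k_cont(1) k_zero' k_even, symmetric])
      have int: "integrable lborel (\<lambda>x. g j (V x) \<bullet> frechet_derivative \<phi> (at x) j)" if j: "j \<in> Basis" for j
      proof -
        define h where "h x = frechet_derivative \<phi> (at x) j" for x
        have h_cont: "continuous_on UNIV h"
          using C1_derivD(2)[OF \<phi>(1)] by (simp add: h_def d\<phi>)
        have h_zero: "h x = 0" if "norm x > R' + e" for x
        proof -
          have "h x = mollify (\<lambda>z. f' z j) k x"
            by (simp add: h_def d\<phi>)
          also have "\<dots> = 0"
          proof -
            have "k (x - y) *\<^sub>R f' y j = 0" for y
            proof (cases "norm y > R'")
              case False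
              then show ?thesis
                using k_zero'[of "x - y"] that norm_triangle_ineq2[of x y] by simp
            qed (use f_R' in simp)
            then show ?thesis
              unfolding conv_def by (simp only: Bochner_Integration.integral_zero)
          qed
          finally show ?thesis .
        qed
        show ?thesis
          unfolding h_def[symmetric]
          by (rule integrable_bilinear_compact_support[OF bounded_bilinear_inner gV[OF j] h_cont h_zero])
      qed
      have "(\<Sum>j\<in>Basis. \<integral>x. E3 j x \<partial>lborel)
          = (\<integral>x. (\<Sum>j\<in>Basis. g j (V x) \<bullet> frechet_derivative \<phi> (at x) j) \<partial>lborel)"
        by (simp add: eq Bochner_Integration.integral_sum int)
      also have "\<dots> = 0"
      proof (rule weak[where S = "{x + y | x y. x \<in> S \<and> y \<in> cball 0 e}"])
        show "{x + y | x y. x \<in> S \<and> y \<in> cball 0 e} \<subseteq> X"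
        proof
          fix z assume "z \<in> {x + y | x y. x \<in> S \<and> y \<in> cball 0 e}"
          then obtain x y where "z = x + y" "x \<in> S" "norm y \<le> e" by auto
          then have "z \<in> cball x d1"
            using e(3) by (simp add: dist_norm)
          with \<open>x \<in> S\<close> d1(2) show "z \<in> X" by blast
        qed
      qed (use \<phi>(2) mollify_support[OF S(1) f_zero] in \<open>simp_all add: \<phi>_def\<close>)
      finally show ?thesis .
    qed
    have D_int: "integrable lborel (D j)" if "j \<in> Basis" for j
    proof -
      have "integrable lborel (\<lambda>x. q j (V x) * \<psi>' x j - E1 j x + E2 j x - E3 j x)"
        by (intro Bochner_Integration.integrable_diff Bochner_Integration.integrable_add qV_int E1 E2 E3_int that)
      then show ?thesis
        by (simp add: split)
    qed
    have I_eq: "I = (\<Sum>j\<in>Basis. \<integral>x. D j x \<partial>lborel)"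
    proof -
      have "I = (\<Sum>j\<in>Basis. (\<integral>x. D j x \<partial>lborel) + (\<integral>x. E3 j x \<partial>lborel))"
        unfolding I_def split by (intro sum.cong) (simp_all add: D_int E1 E2 E3_int)
      then show ?thesis
        by (simp add: sum.distrib E3)
    qed

    have S_sets[measurable]: "S \<in> sets borel"
      using S(1) by (simp add: compact_imp_closed borel_closed)
    have osc_int: "integrable lborel (\<lambda>x. indicator S x * osc i x)" for i
    proof (rule integrable_bounded_support[where c = "(2 * M) ^ i" and R = R'])
      show "norm (indicator S x * osc i x) \<le> (2 * M) ^ i" for x
        using osc_le[of i x] osc_nonneg[of i x] M by (auto simp: indicator_def)
    qed (use R' in \<open>auto simp: indicator_def\<close>)
    have osc3: "(\<integral>x. indicator S x * osc 3 x \<partial>lborel) \<le> c * e powr (3 * \<alpha>)"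
    proof (rule integral_osc_3[OF S_sets compact_imp_bounded[OF S(1)]])
      fix y :: 'a assume y: "norm y < e"
      have "(\<integral>x. indicator S x * norm (V x - V (x - y)) ^ 3 \<partial>lborel) \<le> c0 * norm y powr (3 * \<alpha>)"
        using besov_S(2) y e by simp
      also have "\<dots> \<le> c * e powr (3 * \<alpha>)"
        using y \<alpha> by (intro mult_mono powr_mono2) (auto simp: c_def)
      finally show "(\<integral>x. indicator S x * norm (V x - V (x - y)) ^ 3 \<partial>lborel) \<le> c * e powr (3 * \<alpha>)" .
    qed
    have osc1: "(\<integral>x. indicator S x * osc 1 x \<partial>lborel) \<le> (measure lborel S + c) * e powr \<alpha>"
    proof -
      (* With this threshold t both the constant t and the integral of osc 3 / t^2 are of order e powr alpha. *)
      define t where "t = e powr \<alpha>"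
      have t: "t > 0" using e by (simp add: t_def)
      have "osc 1 x \<le> t + osc 3 x / t\<^sup>2" for x
      proof (cases "osc 1 x \<le> t")
        case True
        then show ?thesis using osc_nonneg[of 3 x] t by (simp add: add_increasing2)
      next
        case False
        then have "osc 1 x * t\<^sup>2 \<le> osc 1 x * (osc 1 x)\<^sup>2"
          using t by (intro mult_left_mono power_mono) auto
        also have "\<dots> \<le> osc 3 x"
          using osc_moments(2)[of x] by (simp add: power2_eq_square power3_eq_cube)
        finally have "osc 1 x \<le> osc 3 x / t\<^sup>2"
          using t by (simp add: field_simps)
        then show ?thesis using t by simp
      qed
      then have "(\<integral>x. indicator S x * osc 1 x \<partial>lborel)
          \<le> (\<integral>x. indicator S x * t + indicator S x * osc 3 x / t\<^sup>2 \<partial>lborel)"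
        using osc_int emeasure_compact_finite[OF S(1)]
        by (intro integral_mono Bochner_Integration.integrable_add integrable_divide) (auto split: split_indicator)
      also have "\<dots> = measure lborel S * t + (\<integral>x. indicator S x * osc 3 x \<partial>lborel) / t\<^sup>2"
        using osc_int[of 3] emeasure_compact_finite[OF S(1)] by simp
      also have "\<dots> \<le> measure lborel S * t + c * e powr (3 * \<alpha>) / t\<^sup>2"
        using osc3 by (intro add_left_mono divide_right_mono) auto
      also have "e powr (3 * \<alpha>) = t ^ 3"
        using e by (simp add: t_def powr_power mult.commute)
      finally show ?thesis
        using t by (simp add: t_def[symmetric] power2_eq_square power3_eq_cube algebra_simps)
    qed
    have "\<bar>\<integral>x. D j x \<partial>lborel\<bar> \<le> c1 * (measure lborel S + c) * e powr \<alpha> + c2 * c * e powr (3 * \<alpha> - 1)"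
      if j: "j \<in> Basis" for j
    proof -
      have D_le: "\<bar>D j x\<bar> \<le> c1 * (indicator S x * osc 1 x) + c2 / e * (indicator S x * osc 3 x)"
        if "x \<in> X \<longrightarrow> V x \<in> K" for x
      proof (cases "x \<in> S")
        case True
        then have "V x \<in> K" using that S(2) by auto
        have "\<bar>D j x\<bar> \<le> c1 * osc 1 x + c2 / e * osc 3 x"
          unfolding D_def c1_def c2_def
        proof (rule defect_estimate[OF j B(1) r M])
          show "continuous_on UNIV (g j)" "linear (g' j u)" for u
            using C1_derivD[OF g_C1] by auto
          show "q' j u (W' x j) = b u \<bullet> g' j u (W' x j)" if "norm (u - V x) < r" for u
            using compat[OF \<open>V x \<in> K\<close> that] by (simp add: g'_def)
        qed (use B j B(10)[of x j] in auto)
        then show ?thesis using True by simp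
      next
        case False
        then show ?thesis
          using S(3) \<psi>'_zero by (simp add: D_def)
      qed
      have "\<bar>\<integral>x. D j x \<partial>lborel\<bar> \<le> (\<integral>x. \<bar>D j x\<bar> \<partial>lborel)"
        by (rule integral_abs_bound)
      also have "\<dots> \<le> (\<integral>x. c1 * (indicator S x * osc 1 x) + c2 / e * (indicator S x * osc 3 x) \<partial>lborel)"
        by (rule integral_mono_AE) (use D_int[OF j] osc_int K D_le in auto)
      also have "\<dots> = c1 * (\<integral>x. indicator S x * osc 1 x \<partial>lborel) + c2 / e * (\<integral>x. indicator S x * osc 3 x \<partial>lborel)"
        using osc_int by simp
      also have "\<dots> \<le> c1 * ((measure lborel S + c) * e powr \<alpha>) + c2 / e * (c * e powr (3 * \<alpha>))"
        using c12 e by (intro add_mono mult_left_mono osc1 osc3) auto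
      also have "\<dots> = c1 * (measure lborel S + c) * e powr \<alpha> + c2 * c * e powr (3 * \<alpha> - 1)"
        using e by (simp add: powr_diff)
      finally show ?thesis .
    qed
    then have "\<bar>I\<bar> \<le> (\<Sum>j\<in>(Basis::'a set). c1 * (measure lborel S + c) * e powr \<alpha> + c2 * c * e powr (3 * \<alpha> - 1))"
      unfolding I_eq by (intro order_trans[OF sum_abs] sum_mono)
    then show ?thesis
      by simp
  qed
  have "((\<lambda>e. DIM('a) * (c1 * (measure lborel S + c) * e powr \<alpha> + c2 * c * e powr (3 * \<alpha> - 1))) \<longlongrightarrow>
      DIM('a) * (c1 * (measure lborel S + c) * 0 + c2 * c * 0)) (at_right 0)"
    using \<alpha>
    by (intro tendsto_intros tendsto_zero_powrI[OF _ tendsto_const])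
      (auto intro: eventually_mono[OF eventually_at_right_less[of 0]] less_imp_le)
  moreover have "\<forall>\<^sub>F e in at_right 0.
      \<bar>I\<bar> \<le> DIM('a) * (c1 * (measure lborel S + c) * e powr \<alpha> + c2 * c * e powr (3 * \<alpha> - 1))"
  proof -
    have "\<forall>\<^sub>F e in at_right 0. e \<in> {0<..<min d0 d1}"
      using besov_S(1) d1(1) by (intro eventually_at_right_real) auto
    then show ?thesis
      by eventually_elim (use main in auto)
  qed
  ultimately have "\<bar>I\<bar> \<le> 0"
    using tendsto_lowerbound[OF _ _ trivial_limit_at_right_real] by force
  then show ?thesis
    unfolding I_def using qV_int by (simp add: Bochner_Integration.integral_sum)
qed

section \<open>Extending the nonlinearities to the whole space\<close>

text \<open>
  The cutoff is the mollified indicator of a neighbourhood of \<open>K\<close>.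
\<close>

lemma smooth_cutoff:
  fixes K :: "'a::euclidean_space set"
  assumes K: "compact K" "K \<subseteq> \<O>" "open \<O>"
  obtains \<eta> :: "'a \<Rightarrow> real" and r T where "r > 0" "\<And>i. Ck_on i \<eta> UNIV" "compact T" "T \<subseteq> \<O>"
    "\<And>u. u \<notin> T \<Longrightarrow> \<eta> u = 0" "\<And>p u. p \<in> K \<Longrightarrow> norm (u - p) < r \<Longrightarrow> \<eta> u = 1"
proof -
  obtain d where d: "d > 0" "(\<Union>x\<in>K. cball x d) \<subseteq> \<O>"
    using compact_subset_open_imp_cball_epsilon_subset[OF K(1,3,2)] by blast
  define e where "e = d / 4"
  have e: "e > 0" using d by (simp add: e_def)
  obtain C and k :: "'a \<Rightarrow> real" where k: "C > 0" "mollifier C e k"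
    using mollifier_exists[where 'a = 'a] e by blast
  define E where "E = {x + y | x y. x \<in> K \<and> y \<in> cball 0 (2 * e)}"
  have E: "compact E"
    unfolding E_def by (rule compact_sums[OF K(1) compact_cball])
  then have [measurable]: "E \<in> sets borel"
    by (simp add: compact_imp_closed borel_closed)
  interpret mollified "indicator E :: 'a \<Rightarrow> real" 1 C e k
    by standard (use e k in \<open>auto simp: indicator_def\<close>)
  define T where "T = {x + y | x y. x \<in> E \<and> y \<in> cball 0 e}"
  show thesis
  proof (rule that)
    show "e > 0" by fact
    show "Ck_on i W UNIV" for i
      unfolding W_def by (rule conv_smooth[OF k_smooth k_zero'])
    show "W u = 0" if "u \<notin> T" for u
      using mollify_support(2)[OF E, of "indicator E :: 'a \<Rightarrow> real" u] that by (auto simp: T_def W_def)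
    show "compact T"
      using mollify_support(1)[OF E, of "indicator E :: 'a \<Rightarrow> real"] by (auto simp: T_def)
    show "T \<subseteq> \<O>"
    proof
      fix z assume "z \<in> T"
      then obtain x y w where z: "z = x + y + w" "x \<in> K" "norm y \<le> 2 * e" "norm w \<le> e"
        by (auto simp: T_def E_def)
      have "norm (y + w) \<le> d"
        using norm_triangle_ineq[of y w] z e by (simp add: e_def)
      then have "z \<in> cball x d"
        using norm_minus_cancel[of "y + w"] by (simp add: z(1) dist_norm add.assoc)
      then show "z \<in> \<O>"
        using d(2) z(2) by blast
    qed
    show "W u = 1" if p: "p \<in> K" "norm (u - p) < e" for p u
    proof -
      have "k (u - y) * indicator E y = k (u - y)" for y
      proof (cases "norm (u - y) \<ge> e")
        case False
        have "norm (y - p) \<le> 2 * e"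
          using norm_triangle_ineq4[of "u - p" "u - y"] p(2) False by simp
        then have "y \<in> E"
          unfolding E_def using p(1) by (intro CollectI exI[of _ p] exI[of _ "y - p"]) auto
        then show ?thesis by simp
      qed (simp add: k_zero)
      then have "W u = (\<integral>y. k (u - y) \<partial>lborel)"
        unfolding W_def conv_def real_scaleR_def by (simp only:)
      also have "\<dots> = 1"
        using integral_reflect[OF k_meas(1), of u] k_integral by simp
      finally show ?thesis .
    qed
  qed
qed

lemma Ck_on_extend_by_zero:
  assumes "open \<O>" "closed T" "T \<subseteq> \<O>" "Ck_on k \<eta> UNIV" "\<And>u. u \<notin> T \<Longrightarrow> \<eta> u = 0" "Ck_on k f \<O>"
  shows "Ck_on k (\<lambda>u. \<eta> u *\<^sub>R f u) UNIV"
proof -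
  have "Ck_on k (\<lambda>u. \<eta> u *\<^sub>R f u) \<O>"
    using assms by (intro Ck_on_bilinear[OF _ bounded_bilinear_scaleR]) (auto intro: Ck_on_subset)
  moreover have "Ck_on k (\<lambda>u. \<eta> u *\<^sub>R f u) (- T)"
    by (rule Ck_on_cong[of _ "\<lambda>_. 0"]) (use assms in \<open>auto intro: Ck_on_const\<close>)
  ultimately have "Ck_on k (\<lambda>u. \<eta> u *\<^sub>R f u) (\<Union>{\<O>, - T})"
    using assms(1,2) by (intro Ck_on_Union) auto
  moreover have "\<Union>{\<O>, - T} = UNIV"
    using assms(3) by auto
  ultimately show ?thesis by simp
qed

lemma bounded_linear_matrix_apply: "bounded_linear (\<lambda>A :: real^'d^'r. A *v w)"
  using linear_conv_bounded_linear
  by (metis (no_types, lifting) linearI matrix_vector_mult_add_rdistrib scaleR_matrix_vector_assoc)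

lemma inner_matrix_eq_sum_Basis:
  fixes A :: "real^'d^'r" and L :: "real^'d \<Rightarrow> real^'r"
  shows "A \<bullet> matrix L = (\<Sum>v\<in>Basis. (A *v v) \<bullet> L v)"
proof -
  have B: "(Basis :: (real^'d) set) = range (\<lambda>j. axis j 1)"
    by (auto simp: Basis_vec_def)
  have "(\<Sum>v\<in>Basis. (A *v v) \<bullet> L v) = (\<Sum>j\<in>UNIV. (A *v axis j 1) \<bullet> L (axis j 1))"
    unfolding B by (subst sum.reindex) (auto simp: inj_def axis_eq_axis)
  also have "\<dots> = (\<Sum>j\<in>UNIV. \<Sum>i\<in>UNIV. A $ i $ j * L (axis j 1) $ i)"
    by (simp add: inner_vec_def matrix_vector_mult_basis column_def)
  also have "\<dots> = A \<bullet> matrix L"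
    by (subst sum.swap) (simp add: inner_vec_def matrix_def)
  finally show ?thesis by simp
qed

text \<open>
  Linear combinations of the columns give the companion relation for every direction \<open>v\<close>.  The
  derivative found here is continuous in \<open>u\<close> when \<open>G\<close> is \<open>C\<^sup>2\<close> and \<open>B\<close> is continuous, so \<open>Q\<close> is \<open>C\<^sup>1\<close>.
\<close>

lemma companion_derivative:
  fixes G :: "real^'n \<Rightarrow> real^'d^'n" and Q :: "real^'n \<Rightarrow> real^'d^1" and B :: "real^'n \<Rightarrow> real^'n^1"
  assumes G: "G differentiable (at u)"
    and QG: "\<And>j. (\<lambda>w. column j (Q w)) differentiable (at u) \<and>
           jacobian (\<lambda>w. column j (Q w)) (at u) = B u ** jacobian (\<lambda>w. column j (G w)) (at u)"
  shows "((\<lambda>w. (Q w *v v) $ 1) has_derivative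
      (\<lambda>h. B u $ 1 \<bullet> frechet_derivative (\<lambda>w. G w *v v) (at u) h)) (at u)"
proof -
  define dG where "dG = frechet_derivative G (at u)"
  have dG: "(G has_derivative dG) (at u)"
    using G by (simp add: dG_def frechet_derivative_works)
  have Gw: "((\<lambda>w. G w *v x) has_derivative (\<lambda>h. dG h *v x)) (at u)" for x
    by (rule bounded_linear.has_derivative[OF bounded_linear_matrix_apply dG])
  have col: "((\<lambda>w. column j (Q w)) has_derivative (\<lambda>h. B u *v (dG h *v axis j 1))) (at u)" for j
  proof -
    define dq where "dq = frechet_derivative (\<lambda>w. column j (Q w)) (at u)"
    have dq: "((\<lambda>w. column j (Q w)) has_derivative dq) (at u)"
      using QG by (simp add: dq_def frechet_derivative_works)
    have "linear dq" "linear (\<lambda>h. dG h *v axis j 1)"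
      using dq Gw has_derivative_linear by blast+
    moreover have "jacobian (\<lambda>w. column j (G w)) (at u) = matrix (\<lambda>h. dG h *v axis j 1)"
      using frechet_derivative_eq[OF Gw[of "axis j 1"]] by (simp add: jacobian_def matrix_vector_mult_basis)
    ultimately have "dq h = B u *v (dG h *v axis j 1)" for h
      using QG[of j] matrix_works[of dq h] matrix_works[of "\<lambda>h. dG h *v axis j 1" h]
      by (simp add: jacobian_def dq_def[symmetric] matrix_vector_mul_assoc[symmetric] linear_matrix_vector_mul_eq)
    then show ?thesis
      using dq by presburger
  qed
  have decomp: "A *v v = (\<Sum>j\<in>UNIV. v $ j *\<^sub>R (A *v axis j 1))" for A :: "real^'d^'r"
    unfolding matrix_vector_mult_basis by (simp add: matrix_mult_sum scalar_mult_eq_scaleR)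
  have "((\<lambda>w. (\<Sum>j\<in>UNIV. v $ j *\<^sub>R column j (Q w)) $ 1) has_derivative
      (\<lambda>h. (\<Sum>j\<in>UNIV. v $ j *\<^sub>R (B u *v (dG h *v axis j 1))) $ 1)) (at u)"
    by (intro bounded_linear.has_derivative[OF bounded_linear_vec_nth] has_derivative_sum
        has_derivative_scaleR_right col)
  moreover have "(\<Sum>j\<in>UNIV. v $ j *\<^sub>R column j (Q w)) $ 1 = (Q w *v v) $ 1" for w
    by (simp add: decomp[of "Q w"] matrix_vector_mult_basis)
  moreover have "(\<Sum>j\<in>UNIV. v $ j *\<^sub>R (B u *v (dG h *v axis j 1))) $ 1 = B u $ 1 \<bullet> (dG h *v v)" for h
  proof -
    have "(\<Sum>j\<in>UNIV. v $ j *\<^sub>R (B u *v (dG h *v axis j 1))) = B u *v (\<Sum>j\<in>UNIV. v $ j *\<^sub>R (dG h *v axis j 1))"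
      by (simp add: linear_sum[OF matrix_vector_mul_linear] linear_cmul[OF matrix_vector_mul_linear])
    also have "\<dots> = B u *v (dG h *v v)"
      by (simp only: decomp[of "dG h"])
    finally show ?thesis
      by (simp add: matrix_vector_mul_component)
  qed
  ultimately show ?thesis
    using frechet_derivative_eq[OF Gw[of v]] by simp
qed

section \<open>Lattice translates of the unit cell\<close>

lemma lebesgue_translate:
  "distr lebesgue lebesgue (\<lambda>x. x + v) = (lebesgue :: 'a::euclidean_space measure)"
  "(\<lambda>x. x + v) \<in> lebesgue \<rightarrow>\<^sub>M (lebesgue :: 'a measure)"
proof -
  have eq: "(\<lambda>x. v + (\<Sum>j\<in>Basis. (1 * (x \<bullet> j)) *\<^sub>R j)) = (\<lambda>x::'a. x + v)"
    by (auto simp: euclidean_representation)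
  show "(\<lambda>x. x + v) \<in> lebesgue \<rightarrow>\<^sub>M (lebesgue :: 'a measure)"
    using lebesgue_affine_measurable[of "\<lambda>_::'a. 1" v] unfolding eq by simp
  show "distr lebesgue lebesgue (\<lambda>x. x + v) = (lebesgue :: 'a::euclidean_space measure)"
    using lebesgue_affine_euclidean[of "\<lambda>_::'a. 1" v] unfolding eq by (simp add: density_1)
qed

lemma lebesgue_integral_translate:
  fixes f :: "'a::euclidean_space \<Rightarrow> 'b::euclidean_space"
  assumes "integrable lebesgue f"
  shows "integrable lebesgue (\<lambda>x. f (x + v))" "(\<integral>x. f (x + v) \<partial>lebesgue) = (\<integral>x. f x \<partial>lebesgue)"
proof -
  have meas: "f \<in> borel_measurable lebesgue"
    using assms by auto
  show "integrable lebesgue (\<lambda>x. f (x + v))"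
    using integrable_distr_eq[OF lebesgue_translate(2) meas, of v] assms by (simp add: lebesgue_translate(1))
  show "(\<integral>x. f (x + v) \<partial>lebesgue) = (\<integral>x. f x \<partial>lebesgue)"
    using integral_distr[OF lebesgue_translate(2) meas, of v] by (simp add: lebesgue_translate(1))
qed

text \<open>
  This is the lattice vector whose translate of the cell contains \<open>x\<close>.
\<close>

definition floor_vec :: "'d::finite set \<Rightarrow> real^'d \<Rightarrow> real^'d" where
  "floor_vec J x = (\<chi> j. if j \<in> J then of_int \<lfloor>x $ j\<rfloor> else 0)"

definition periods_upto :: "'d::finite set \<Rightarrow> real \<Rightarrow> (real^'d) set" where
  "periods_upto J m = {v \<in> periods J. \<forall>j. \<bar>v $ j\<bar> \<le> m}"

lemma floor_vec_in_periods: "floor_vec J x \<in> periods J"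
  by (auto simp: floor_vec_def periods_def)

lemma periods_nth: "v \<in> periods J \<Longrightarrow> v $ j \<in> \<int>" "v \<in> periods J \<Longrightarrow> j \<notin> J \<Longrightarrow> v $ j = 0"
  by (cases "j \<in> J"; force simp: periods_def)+

lemma diff_in_unit_cell_iff:
  assumes "v \<in> periods J"
  shows "x - v \<in> unit_cell J \<longleftrightarrow> v = floor_vec J x"
proof -
  have "(0 \<le> x $ j - v $ j \<and> x $ j - v $ j < 1) \<longleftrightarrow> v $ j = of_int \<lfloor>x $ j\<rfloor>" if "j \<in> J" for j
  proof -
    obtain n :: int where n: "v $ j = of_int n"
      using periods_nth(1)[OF assms] by (auto elim: Ints_cases)
    have "(0 \<le> x $ j - of_int n \<and> x $ j - of_int n < 1) \<longleftrightarrow> n = \<lfloor>x $ j\<rfloor>"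
      by linarith
    then show ?thesis
      using n by simp
  qed
  then have "x - v \<in> unit_cell J \<longleftrightarrow> (\<forall>j\<in>J. v $ j = of_int \<lfloor>x $ j\<rfloor>)"
    by (auto simp: unit_cell_def)
  also have "\<dots> \<longleftrightarrow> v = floor_vec J x"
    using assms by (auto simp: floor_vec_def periods_def vec_eq_iff)
  finally show ?thesis .
qed

lemma periods_add: "v \<in> periods J \<Longrightarrow> w \<in> periods J \<Longrightarrow> v + w \<in> periods J"
  and periods_minus: "v \<in> periods J \<Longrightarrow> - v \<in> periods J"
proof -
  show "v + w \<in> periods J" if "v \<in> periods J" "w \<in> periods J"
    unfolding periods_def
  proof (intro CollectI allI)
    fix j
    show "if j \<in> J then (v + w) $ j \<in> \<int> else (v + w) $ j = 0"
      using that[unfolded periods_def mem_Collect_eq, THEN spec[of _ j]] by (auto split: if_splits)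
  qed
  show "- v \<in> periods J" if "v \<in> periods J"
    unfolding periods_def
  proof (intro CollectI allI)
    fix j
    show "if j \<in> J then (- v) $ j \<in> \<int> else (- v) $ j = 0"
      using that[unfolded periods_def mem_Collect_eq, THEN spec[of _ j]] by (auto split: if_splits)
  qed
qed

lemma finite_periods_upto: "finite (periods_upto J m)"
proof (rule finite_subset)
  let ?F = "PiE UNIV (\<lambda>_. {- \<lceil>m\<rceil>..\<lceil>m\<rceil>}) :: ('a \<Rightarrow> int) set"
  show "finite ((\<lambda>f. \<chi> j. real_of_int (f j)) ` ?F)"
    by (intro finite_imageI finite_PiE) auto
  show "periods_upto J m \<subseteq> (\<lambda>f. \<chi> j. real_of_int (f j)) ` ?F"
  proof
    fix v assume v: "v \<in> periods_upto J m"
    have int: "of_int \<lfloor>v $ j\<rfloor> = v $ j" for j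
      using v periods_nth(1)[of v J j] by (auto simp: periods_upto_def elim: Ints_cases)
    have "\<lfloor>v $ j\<rfloor> \<in> {- \<lceil>m\<rceil>..\<lceil>m\<rceil>}" for j
    proof -
      have "\<bar>v $ j\<bar> \<le> m"
        using v by (simp add: periods_upto_def)
      then show ?thesis
        using int[of j] by (auto simp: le_floor_iff) linarith+
    qed
    then show "v \<in> (\<lambda>f. \<chi> j. real_of_int (f j)) ` ?F"
      by (intro image_eqI[of _ _ "\<lambda>j. \<lfloor>v $ j\<rfloor>"]) (auto simp: int)
  qed
qed

lemma periods_eq_Union: "periods J = (\<Union>n::nat. periods_upto J (real n))"
proof -
  have "\<exists>n::nat. v \<in> periods_upto J (real n)" if "v \<in> periods J" for v
  proof -
    obtain n :: nat where "norm v \<le> real n"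
      using real_arch_simple by blast
    then have "\<bar>v $ j\<bar> \<le> real n" for j
      using component_le_norm_cart[of v j] by linarith
    then show ?thesis
      using that by (auto simp: periods_upto_def)
  qed
  then show ?thesis
    by (auto simp: periods_upto_def)
qed

lemma countable_periods: "countable (periods J)"
  unfolding periods_eq_Union
  by (rule countable_UN) (auto intro: countable_finite finite_periods_upto)

lemma floor_vec_in_periods_upto:
  assumes "\<And>j. j \<in> J \<Longrightarrow> \<bar>x $ j\<bar> \<le> s" "s \<ge> 0" "s + 1 \<le> m"
  shows "floor_vec J x \<in> periods_upto J m"
proof -
  have "\<bar>floor_vec J x $ j\<bar> \<le> m" for j
  proof (cases "j \<in> J")
    case True
    then show ?thesis
      using assms(1)[OF True] assms(3) by (simp add: floor_vec_def) linarith
  qed (use assms in \<open>simp add: floor_vec_def\<close>)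
  then show ?thesis
    by (simp add: periods_upto_def floor_vec_in_periods)
qed

lemma sum_indicator_unit_cell:
  assumes "finite W" "W \<subseteq> periods J" "floor_vec J x \<in> W"
  shows "(\<Sum>v\<in>W. indicator (unit_cell J) (x - v)) = (1::real)"
proof -
  have "(\<Sum>v\<in>W. indicator (unit_cell J) (x - v)) = (\<Sum>v\<in>W. if v = floor_vec J x then 1 else (0::real))"
    using assms(2) by (intro sum.cong) (auto simp: indicator_def diff_in_unit_cell_iff subset_iff)
  then show ?thesis
    using assms by simp
qed

lemma unit_cell_borel[measurable]: "unit_cell J \<in> sets borel"
proof -
  have "unit_cell J = (\<Inter>j\<in>J. {x. 0 \<le> x $ j} \<inter> {x. x $ j < 1})"
    by (auto simp: unit_cell_def)
  moreover have "{x::real^'a. 0 \<le> x $ j} \<inter> {x. x $ j < 1} \<in> sets borel" for j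
    by (intro sets.Int borel_closed[OF closed_halfspace_component_ge_cart] borel_open[OF open_halfspace_component_lt_cart])
  ultimately show ?thesis
    by (cases "J = {}") (auto intro!: sets.finite_INT)
qed

lemma open_domain_translate_iff:
  assumes "open_domain J X" "v \<in> periods J"
  shows "x + v \<in> X \<longleftrightarrow> x \<in> X"
  using assms periods_minus[OF assms(2)] unfolding open_domain_def
  by (metis add_diff_cancel_right' diff_conv_add_uminus)

lemma sum_translates_of_cell:
  fixes h :: "real^'d \<Rightarrow> 'b::real_vector"
  assumes X: "open_domain J X" and h: "\<And>v x. v \<in> periods J \<Longrightarrow> x \<in> X \<Longrightarrow> h (x + v) = h x"
    and W: "finite W" "W \<subseteq> periods J" "floor_vec J x \<in> W"
  shows "(\<Sum>v\<in>W. indicator (X \<inter> unit_cell J) (x - v) *\<^sub>R h (x - v)) = indicator X x *\<^sub>R h x"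
proof -
  have "indicator (X \<inter> unit_cell J) (x - v) *\<^sub>R h (x - v)
      = indicator (unit_cell J) (x - v) *\<^sub>R (indicator X x *\<^sub>R h x)" if "v \<in> W" for v
  proof -
    have "- v \<in> periods J"
      using that W(2) periods_minus by auto
    then show ?thesis
      using h[of "- v" x] open_domain_translate_iff[OF X, of "- v" x] by (auto simp: indicator_def)
  qed
  then have "(\<Sum>v\<in>W. indicator (X \<inter> unit_cell J) (x - v) *\<^sub>R h (x - v))
      = (\<Sum>v\<in>W. indicator (unit_cell J) (x - v)) *\<^sub>R (indicator X x *\<^sub>R h x)"
    by (simp add: scaleR_sum_left del: scaleR_scaleR)
  then show ?thesis
    by (simp add: sum_indicator_unit_cell[OF W])
qed

text \<open>
  Each point of \<open>T\<close> lies in exactly one of the finitely many translates of the cell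
  that \<open>W\<close> selects, so on \<open>T\<close> the function is a finite sum of translates
  of its restriction to the cell.
\<close>

lemma periodic_integrable_over:
  fixes h :: "real^'d \<Rightarrow> real"
  assumes X: "open_domain J X" and h: "\<And>v x. v \<in> periods J \<Longrightarrow> x \<in> X \<Longrightarrow> h (x + v) = h x"
    and int: "integrable lebesgue (\<lambda>x. indicator (X \<inter> unit_cell J) x * h x)"
    and T: "T \<in> sets lebesgue" "T \<subseteq> X"
    and W: "finite W" "W \<subseteq> periods J" "\<And>x. x \<in> T \<Longrightarrow> floor_vec J x \<in> W"
  shows "integrable lebesgue (\<lambda>x. indicator T x * h x)"
    and "(\<And>x. x \<in> X \<Longrightarrow> h x \<ge> 0) \<Longrightarrow> (\<integral>x. indicator T x * h x \<partial>lebesgue)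
      \<le> card W * (\<integral>x. indicator (X \<inter> unit_cell J) x * h x \<partial>lebesgue)"
proof -
  define f where "f x = indicator (X \<inter> unit_cell J) x * h x" for x
  have int_v: "integrable lebesgue (\<lambda>x. f (x - v))" "(\<integral>x. f (x - v) \<partial>lebesgue) = (\<integral>x. f x \<partial>lebesgue)" for v
    using lebesgue_integral_translate[of f "- v"] int by (auto simp: f_def[abs_def])
  have eq: "(\<Sum>v\<in>W. f (x - v)) = h x" if "x \<in> T" for x
    using sum_translates_of_cell[of J X h W x, OF X h W(1,2) W(3)[OF that]] T(2) that
    by (auto simp: f_def)
  have "(\<lambda>x. indicator T x * h x) = (\<lambda>x. indicator T x *\<^sub>R (\<Sum>v\<in>W. f (x - v)))"
    using eq by (auto simp: indicator_def)
  moreover have "integrable lebesgue (\<lambda>x. indicator T x *\<^sub>R (\<Sum>v\<in>W. f (x - v)))"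
    using T(1) by (intro integrable_mult_indicator Bochner_Integration.integrable_sum int_v)
  ultimately show *: "integrable lebesgue (\<lambda>x. indicator T x * h x)"
    by simp
  assume nonneg: "\<And>x. x \<in> X \<Longrightarrow> h x \<ge> 0"
  have "(\<integral>x. indicator T x * h x \<partial>lebesgue) \<le> (\<integral>x. (\<Sum>v\<in>W. f (x - v)) \<partial>lebesgue)"
  proof (rule integral_mono[OF *])
    show "integrable lebesgue (\<lambda>x. \<Sum>v\<in>W. f (x - v))"
      by (intro Bochner_Integration.integrable_sum int_v)
    have "f x \<ge> 0" for x
      using nonneg by (auto simp: f_def indicator_def)
    then show "indicator T x * h x \<le> (\<Sum>v\<in>W. f (x - v))" for x
      using eq[of x] by (cases "x \<in> T") (auto intro!: sum_nonneg)
  qed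
  also have "\<dots> = card W * (\<integral>x. f x \<partial>lebesgue)"
    by (simp add: Bochner_Integration.integral_sum int_v)
  finally show "(\<integral>x. indicator T x * h x \<partial>lebesgue)
      \<le> card W * (\<integral>x. indicator (X \<inter> unit_cell J) x * h x \<partial>lebesgue)"
    by (simp add: f_def)
qed

section \<open>Periodisation of test functions\<close>

text \<open>
  Only the nonzero terms are summed, so that the index set is finite when \<open>\<phi>\<close>
  has compact support.
\<close>

definition periodise :: "'d::finite set \<Rightarrow> (real^'d \<Rightarrow> 'b::real_vector) \<Rightarrow> real^'d \<Rightarrow> 'b" where
  "periodise J \<phi> x = (\<Sum>v | v \<in> periods J \<and> \<phi> (x + v) \<noteq> 0. \<phi> (x + v))"

text \<open>
  A function with compact support meets a strip under only finitely many lattice translations.  On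
  a strip its periodisation is therefore a fixed finite sum, which can be differentiated term by
  term.
\<close>

definition strip :: "'d::finite set \<Rightarrow> real \<Rightarrow> (real^'d) set" where
  "strip J s = {x. \<forall>j\<in>J. \<bar>x $ j\<bar> < s}"

lemma open_strip: "open (strip J s)"
proof -
  have "strip J s = (\<Inter>j\<in>J. {x. \<bar>x $ j\<bar> < s})"
    by (auto simp: strip_def)
  then show ?thesis
    by (auto intro!: open_Collect_less continuous_intros open_INT)
qed

lemma unit_cell_subset_strip: "unit_cell J \<subseteq> strip J 2"
  by (auto simp: unit_cell_def strip_def)

lemma Union_strip: "(\<Union>s. strip J s) = UNIV"
proof -
  have "\<bar>x $ j\<bar> < norm x + 1" for x :: "real^'a" and j
    using component_le_norm_cart[of x j] by linarith
  then have "x \<in> strip J (norm x + 1)" for x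
    by (simp add: strip_def)
  then show ?thesis by blast
qed

lemma periodise_eq_sum:
  assumes "\<And>x. \<phi> x \<noteq> 0 \<Longrightarrow> \<forall>j\<in>J. \<bar>x $ j\<bar> \<le> \<rho>" "x \<in> strip J s" "m \<ge> \<rho> + s" "m \<ge> 0"
  shows "periodise J \<phi> x = (\<Sum>v\<in>periods_upto J m. \<phi> (x + v))"
  unfolding periodise_def
proof (rule sum.mono_neutral_left[OF finite_periods_upto])
  have "\<bar>v $ j\<bar> \<le> m" if v: "v \<in> periods J" "\<phi> (x + v) \<noteq> 0" for v j
  proof (cases "j \<in> J")
    case True
    then have "\<bar>x $ j + v $ j\<bar> \<le> \<rho>" "\<bar>x $ j\<bar> < s"
      using assms(1)[OF v(2)] assms(2) by (auto simp: strip_def)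
    then show ?thesis using assms(3) by linarith
  next
    case False
    then have "v $ j = 0"
      using periods_nth(2) v(1) by blast
    then show ?thesis using assms(4) by simp
  qed
  then show "{v \<in> periods J. \<phi> (x + v) \<noteq> 0} \<subseteq> periods_upto J m"
    by (auto simp: periods_upto_def)
qed (auto simp: periods_upto_def)

lemma periodise_periodic:
  assumes "w \<in> periods J"
  shows "periodise J \<phi> (x + w) = periodise J \<phi> x"
  unfolding periodise_def
proof (rule sum.reindex_bij_witness[where i = "\<lambda>v. v - w" and j = "\<lambda>v. v + w"])
  fix v assume v: "v \<in> {v. v \<in> periods J \<and> \<phi> (x + v) \<noteq> 0}"
  then show "v - w \<in> {v. v \<in> periods J \<and> \<phi> (x + w + v) \<noteq> 0}"
    using periods_add[OF _ periods_minus[OF assms], of v] by (simp add: add.assoc)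
qed (auto simp: add_ac periods_add assms)

lemma periodise_smooth:
  fixes \<phi> :: "real^'d \<Rightarrow> real^'r"
  assumes \<phi>: "\<And>i. Ck_on i \<phi> UNIV" "\<And>x. \<phi> x \<noteq> 0 \<Longrightarrow> norm x \<le> \<rho>"
  shows "Ck_on i (periodise J \<phi>) UNIV"
proof -
  have supp: "\<forall>j\<in>J. \<bar>x $ j\<bar> \<le> \<bar>\<rho>\<bar>" if "\<phi> x \<noteq> 0" for x
    using \<phi>(2)[OF that] component_le_norm_cart[of x] by (meson abs_ge_self order_trans)
  have "Ck_on i (periodise J \<phi>) (strip J s)" for s
  proof (rule Ck_on_cong[OF open_strip])
    show "Ck_on i (\<lambda>x. \<Sum>v\<in>periods_upto J (\<bar>\<rho>\<bar> + \<bar>s\<bar>). \<phi> (x + v)) (strip J s)"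
      by (intro Ck_on_sum open_strip Ck_on_subset[OF Ck_on_translate[OF \<phi>(1)]]) auto
    show "(\<Sum>v\<in>periods_upto J (\<bar>\<rho>\<bar> + \<bar>s\<bar>). \<phi> (x + v)) = periodise J \<phi> x" if "x \<in> strip J s" for x
      using periodise_eq_sum[where \<phi> = \<phi> and \<rho> = "\<bar>\<rho>\<bar>" and m = "\<bar>\<rho>\<bar> + \<bar>s\<bar>", OF _ that] supp by simp
  qed
  then have "Ck_on i (periodise J \<phi>) (\<Union>(range (strip J)))"
    by (intro Ck_on_Union) (auto simp: open_strip)
  then show ?thesis
    by (simp add: Union_strip)
qed

lemma jacobian_periodise:
  fixes \<phi> :: "real^'d \<Rightarrow> real^'r"
  assumes \<phi>: "\<And>i. Ck_on i \<phi> UNIV" "\<And>x. \<phi> x \<noteq> 0 \<Longrightarrow> norm x \<le> \<rho>" and x: "x \<in> unit_cell J"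
    and m: "m \<ge> \<bar>\<rho>\<bar> + 2"
  shows "jacobian (periodise J \<phi>) (at x) = (\<Sum>v\<in>periods_upto J m. jacobian \<phi> (at (x + v)))"
proof -
  have supp: "\<forall>j\<in>J. \<bar>x $ j\<bar> \<le> \<bar>\<rho>\<bar>" if "\<phi> x \<noteq> 0" for x
    using \<phi>(2)[OF that] component_le_norm_cart[of x] by (meson abs_ge_self order_trans)
  define D where "D v = frechet_derivative \<phi> (at (x + v))" for v
  have "((\<lambda>x. \<phi> (x + v)) has_derivative D v) (at x)" for v
  proof -
    have "((\<lambda>x. x + v) has_derivative (\<lambda>x. x)) (at x)"
      by (auto intro!: derivative_eq_intros)
    then show ?thesis
      using has_derivative_compose[of "\<lambda>x. x + v" "\<lambda>x. x" x UNIV \<phi>] \<phi>(1)[of "Suc 0"]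
        Ck_on_differentiable[of 0 \<phi> UNIV "x + v"] by (auto simp: D_def)
  qed
  then have "((\<lambda>x. \<Sum>v\<in>periods_upto J m. \<phi> (x + v)) has_derivative (\<lambda>h. \<Sum>v\<in>periods_upto J m. D v h)) (at x)"
    by (intro has_derivative_sum)
  then have "(periodise J \<phi> has_derivative (\<lambda>h. \<Sum>v\<in>periods_upto J m. D v h)) (at x)"
  proof (rule has_derivative_transform_within_open[OF _ open_strip[of J 2]])
    show "x \<in> strip J 2"
      using x unit_cell_subset_strip by blast
    show "(\<Sum>v\<in>periods_upto J m. \<phi> (y + v)) = periodise J \<phi> y" if "y \<in> strip J 2" for y
      using periodise_eq_sum[where \<phi> = \<phi> and \<rho> = "\<bar>\<rho>\<bar>" and m = m, OF _ that] supp m by simp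
  qed
  from frechet_derivative_eq[OF this] show ?thesis
    by (simp add: jacobian_def D_def matrix_def vec_eq_iff)
qed

lemma periods_empty: "periods {} = {0}"
  by (auto simp: periods_def vec_eq_iff)

lemma test_function_euclidean_iff:
  "test_function {} X \<phi> \<longleftrightarrow>
    (\<forall>i. Ck_on i \<phi> UNIV) \<and> (\<exists>K. compact K \<and> K \<subseteq> X \<and> (\<forall>x. x \<notin> K \<longrightarrow> \<phi> x = 0))"
  unfolding test_function_def functions_on_def periods_empty by auto

lemma test_function_periodise:
  fixes \<phi> :: "real^'d \<Rightarrow> real^'r"
  assumes "test_function {} X \<phi>"
  shows "test_function J X (periodise J \<phi>)"
proof -
  obtain K where K: "compact K" "K \<subseteq> X" "\<And>x. x \<notin> K \<Longrightarrow> \<phi> x = 0" and \<phi>: "\<And>i. Ck_on i \<phi> UNIV"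
    using assms by (auto simp: test_function_euclidean_iff)
  obtain \<rho> where \<rho>: "\<And>x. x \<in> K \<Longrightarrow> norm x \<le> \<rho>"
    using compact_imp_bounded[OF K(1)] by (auto simp: bounded_iff)
  have "norm x \<le> \<rho>" if "\<phi> x \<noteq> 0" for x
    using K(3) \<rho> that by blast
  from periodise_smooth[OF \<phi> this] have "Ck_on i (periodise J \<phi>) UNIV" for i .
  moreover have "x \<in> {y + v |y v. y \<in> K \<and> v \<in> periods J}" if "periodise J \<phi> x \<noteq> 0" for x
  proof -
    have "{v. v \<in> periods J \<and> \<phi> (x + v) \<noteq> 0} \<noteq> {}"
      using that unfolding periodise_def by (metis sum.empty)
    then obtain v where v: "v \<in> periods J" "\<phi> (x + v) \<noteq> 0"
      by blast
    then have "x = (x + v) + - v" "x + v \<in> K" "- v \<in> periods J"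
      using K(3) periods_minus by auto
    then show ?thesis by blast
  qed
  ultimately show ?thesis
    unfolding test_function_def functions_on_def using K(1,2) by (auto simp: periodise_periodic)
qed

text \<open>
  Mollifying the indicator of the cell gives a function whose lattice translates sum to \<open>1\<close>.  Its
  product with \<open>\<psi>\<close> has compact support, since the factor confines the torus coordinates and \<open>\<psi>\<close>
  the others, and its periodisation is \<open>\<psi>\<close>.
\<close>

lemma test_function_is_periodisation:
  fixes \<psi> :: "real^'d \<Rightarrow> real^'r"
  assumes X: "open_domain J X" and \<psi>: "test_function J X \<psi>"
  obtains \<phi> where "test_function {} X \<phi>" "periodise J \<phi> = \<psi>"
proof -
  have \<psi>_smooth: "\<And>i. Ck_on i \<psi> UNIV" and \<psi>_per: "\<And>v x. v \<in> periods J \<Longrightarrow> \<psi> (x + v) = \<psi> x"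
    using \<psi> by (auto simp: test_function_def functions_on_def)
  obtain K where K: "compact K" "K \<subseteq> X" "{x. \<psi> x \<noteq> 0} \<subseteq> {y + v | y v. y \<in> K \<and> v \<in> periods J}"
    using \<psi> by (auto simp: test_function_def)
  obtain \<rho> where \<rho>: "\<rho> \<ge> 0" "\<And>x. x \<in> K \<Longrightarrow> norm x \<le> \<rho>"
    using compact_imp_bounded[OF K(1)] by (meson bounded_iff bounded_pos less_imp_le)
  obtain C and k :: "real^'d \<Rightarrow> real" where k: "C > 0" "mollifier C 1 k"
    using mollifier_exists[where 'a = "real^'d"] zero_less_one by blast
  interpret mollified "indicator (unit_cell J) :: real^'d \<Rightarrow> real" 1 C 1 k
    by standard (use k in \<open>auto simp: indicator_def\<close>)
  have theta_smooth: "Ck_on i W UNIV" for i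
    unfolding W_def by (rule conv_smooth[OF k_smooth k_zero'])
  have theta_supp: "\<bar>x $ j\<bar> \<le> 2" if "W x \<noteq> 0" "j \<in> J" for x j
  proof (rule ccontr)
    assume far: "\<not> \<bar>x $ j\<bar> \<le> 2"
    have "k (x - y) *\<^sub>R (indicator (unit_cell J) y :: real) = 0" for y
    proof (cases "y \<in> unit_cell J")
      case True
      then have "0 \<le> y $ j" "y $ j < 1"
        using that(2) by (auto simp: unit_cell_def)
      then have "1 \<le> norm (x - y)"
        using far component_le_norm_cart[of "x - y" j] by simp
      then show ?thesis using k_zero by simp
    qed simp
    then have "W x = 0"
      unfolding W_def conv_def by (simp only: Bochner_Integration.integral_zero)
    then show False using that by simp
  qed
  \<comment> \<open>The translates of the mollified indicator of the cell form a partition of unity.\<close>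
  have theta_sum: "(\<Sum>v\<in>periods_upto J m. W (x + v)) = 1" if m: "m \<ge> norm x + 3" for x m
  proof -
    let ?c = "indicator (unit_cell J) :: real^'d \<Rightarrow> real"
    let ?W = "periods_upto J m"
    have W_eq: "W z = (\<integral>y. k y * ?c (z - y) \<partial>lborel)" for z
      by (subst W_def, subst conv_reflect[OF bounded_bilinear_mollify]) auto
    have int: "integrable lborel (\<lambda>y. k y * ?c (z - y))" for z
      using integrable_kernel[of "\<lambda>y. ?c (z - y)" 1] by (simp add: indicator_def)
    have minus: "bij_betw uminus ?W ?W"
      by (rule bij_betwI[of _ _ _ uminus]) (auto simp: periods_upto_def periods_minus)
    have "(\<Sum>v\<in>?W. W (x + v)) = (\<integral>y. (\<Sum>v\<in>?W. k y * ?c (x + v - y)) \<partial>lborel)"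
      by (simp add: W_eq Bochner_Integration.integral_sum int)
    also have "\<dots> = (\<integral>y. k y \<partial>lborel)"
    proof (rule Bochner_Integration.integral_cong[OF refl])
      fix y
      have "(\<Sum>v\<in>?W. k y * ?c (x + v - y)) = k y * (\<Sum>v\<in>?W. ?c (x - y - v))"
        using sum.reindex_bij_betw[OF minus, of "\<lambda>v. ?c (x - y - v)"]
        by (simp add: sum_distrib_left[symmetric] algebra_simps)
      also have "\<dots> = k y"
      proof (cases "norm y \<ge> 1")
        case False
        have "\<bar>(x - y) $ j\<bar> \<le> norm x + 1" for j
          using component_le_norm_cart[of x j] component_le_norm_cart[of y j] False by simp
        then have "floor_vec J (x - y) \<in> ?W"
          using m by (intro floor_vec_in_periods_upto[of _ _ "norm x + 1"]) auto
        then have "(\<Sum>v\<in>?W. ?c (x - y - v)) = 1"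
          by (intro sum_indicator_unit_cell finite_periods_upto) (auto simp: periods_upto_def)
        then show ?thesis by simp
      qed (simp add: k_zero)
      finally show "(\<Sum>v\<in>?W. k y * ?c (x + v - y)) = k y" .
    qed
    finally show ?thesis
      by (simp add: k_integral)
  qed
  define \<phi> where "\<phi> x = W x *\<^sub>R \<psi> x" for x
  define L where "L = (\<Union>v\<in>periods_upto J (\<rho> + 2). (\<lambda>y. y + v) ` K)"
  have \<phi>_supp: "x \<in> L" if "\<phi> x \<noteq> 0" for x
  proof -
    have "W x \<noteq> 0" "\<psi> x \<noteq> 0"
      using that by (auto simp: \<phi>_def)
    then obtain y v where yv: "x = y + v" "y \<in> K" "v \<in> periods J"
      using subsetD[OF K(3), of x] by auto
    have "\<bar>v $ j\<bar> \<le> \<rho> + 2" for j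
    proof (cases "j \<in> J")
      case True
      then show ?thesis
        using theta_supp[OF \<open>W x \<noteq> 0\<close> True] yv(1) \<rho>(2)[OF yv(2)] component_le_norm_cart[of y j] by simp
    next
      case False
      then show ?thesis
        using periods_nth(2)[OF yv(3)] \<rho>(1) by simp
    qed
    then show ?thesis
      using yv by (auto simp: L_def periods_upto_def)
  qed
  have L: "compact L" "L \<subseteq> X"
  proof -
    have "compact ((\<lambda>y. y + v) ` K)" for v
      by (intro compact_continuous_image K continuous_intros)
    then show "compact L"
      unfolding L_def by (intro compact_UN finite_periods_upto)
    show "L \<subseteq> X"
      using K(2) open_domain_translate_iff[OF X] by (auto simp: L_def periods_upto_def)
  qed
  show thesis
  proof (rule that)
    have "Ck_on i \<phi> UNIV" for i
      unfolding \<phi>_def by (intro Ck_on_bilinear[OF _ bounded_bilinear_scaleR] theta_smooth \<psi>_smooth) simp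
    then show "test_function {} X \<phi>"
      unfolding test_function_euclidean_iff using L \<phi>_supp by blast
    show "periodise J \<phi> = \<psi>"
    proof
      fix x :: "real^'d"
      define s where "s = norm x + 1"
      have "\<bar>x $ j\<bar> < s" for j
        using component_le_norm_cart[of x j] by (simp add: s_def)
      then have "x \<in> strip J s"
        by (simp add: strip_def)
      moreover have "\<forall>j\<in>J. \<bar>z $ j\<bar> \<le> 2" if "\<phi> z \<noteq> 0" for z
        using theta_supp that by (auto simp: \<phi>_def)
      ultimately have "periodise J \<phi> x = (\<Sum>v\<in>periods_upto J (2 + s). \<phi> (x + v))"
        by (intro periodise_eq_sum[where \<rho> = 2 and s = s]) (auto simp: s_def)
      also have "\<dots> = (\<Sum>v\<in>periods_upto J (2 + s). W (x + v) *\<^sub>R \<psi> x)"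
        by (intro sum.cong) (auto simp: \<phi>_def \<psi>_per periods_upto_def)
      also have "\<dots> = (\<Sum>v\<in>periods_upto J (2 + s). W (x + v)) *\<^sub>R \<psi> x"
        by (rule scaleR_sum_left[symmetric])
      also have "\<dots> = \<psi> x"
        using theta_sum[of x "2 + s"] by (simp add: s_def)
      finally show "periodise J \<phi> x = \<psi> x" .
    qed
  qed
qed

section \<open>Periodic and Euclidean weak formulations\<close>

definition weak_form :: "'d::finite set \<Rightarrow> (real^'d) set \<Rightarrow> (real^'d \<Rightarrow> real^'d^'r) \<Rightarrow> bool" where
  "weak_form J X H \<longleftrightarrow> (\<forall>\<psi>. test_function J X \<psi> \<longrightarrow>
     (\<integral>x. H x \<bullet> jacobian \<psi> (at x) \<partial>domain_measure J X) = 0)"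

lemma integral_domain_measure:
  fixes f :: "real^'d \<Rightarrow> 'b::euclidean_space"
  assumes "open X"
  shows "(\<integral>x. f x \<partial>domain_measure J X) = (\<integral>x. indicator (X \<inter> unit_cell J) x *\<^sub>R f x \<partial>lebesgue)"
    and "integrable (domain_measure J X) f \<longleftrightarrow> integrable lebesgue (\<lambda>x. indicator (X \<inter> unit_cell J) x *\<^sub>R f x)"
    and "X \<inter> unit_cell J \<in> sets lebesgue"
proof -
  have "X \<inter> unit_cell J \<in> sets borel"
    using assms by auto
  then show *: "X \<inter> unit_cell J \<in> sets lebesgue"
    by auto
  show "(\<integral>x. f x \<partial>domain_measure J X) = (\<integral>x. indicator (X \<inter> unit_cell J) x *\<^sub>R f x \<partial>lebesgue)"
    unfolding domain_measure_def using * by (intro integral_restrict_space) auto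
  show "integrable (domain_measure J X) f \<longleftrightarrow> integrable lebesgue (\<lambda>x. indicator (X \<inter> unit_cell J) x *\<^sub>R f x)"
    unfolding domain_measure_def using * by (intro integrable_restrict_space) auto
qed

lemma jacobian_zero_outside:
  fixes \<phi> :: "real^'d \<Rightarrow> real^'r"
  assumes "Ck_on 1 \<phi> UNIV" "closed L" "\<And>x. x \<notin> L \<Longrightarrow> \<phi> x = 0" "x \<notin> L"
  shows "jacobian \<phi> (at x) = 0"
proof -
  have "C1_deriv \<phi> (\<lambda>x. frechet_derivative \<phi> (at x))"
    using assms(1) C1_deriv_of_Ck by (metis One_nat_def)
  from C1_deriv_zero_outside[OF this assms(2-4)] show ?thesis
    by (simp add: jacobian_def matrix_def vec_eq_iff)
qed

lemma continuous_jacobian: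
  fixes \<phi> :: "real^'d \<Rightarrow> real^'r"
  assumes "Ck_on 1 \<phi> UNIV"
  shows "continuous_on UNIV (\<lambda>x. jacobian \<phi> (at x))"
proof -
  have "C1_deriv \<phi> (\<lambda>x. frechet_derivative \<phi> (at x))"
    using assms C1_deriv_of_Ck by (metis One_nat_def)
  from C1_derivD(2)[OF this] show ?thesis
    unfolding jacobian_def matrix_def
    by (intro continuous_on_vec_lambda continuous_on_component)
qed

lemma integrable_inner_jacobian:
  fixes H :: "real^'d \<Rightarrow> real^'d^'r"
  assumes \<phi>: "Ck_on 1 \<phi> UNIV" and L: "compact L" "L \<subseteq> X" "\<And>x. x \<notin> L \<Longrightarrow> \<phi> x = 0"
    and H: "H absolutely_integrable_on L"
  shows "integrable lebesgue (\<lambda>x. indicator X x * (H x \<bullet> jacobian \<phi> (at x)))"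
proof -
  define P where "P x = jacobian \<phi> (at x)" for x
  note zero = jacobian_zero_outside[OF \<phi> compact_imp_closed[OF L(1)] L(3)]
  obtain \<rho> where \<rho>: "\<And>x. x \<in> L \<Longrightarrow> norm x \<le> \<rho>"
    using compact_imp_bounded[OF L(1)] by (auto simp: bounded_iff)
  have "continuous_on UNIV P"
    unfolding P_def by (rule continuous_jacobian[OF \<phi>])
  moreover have "P x = 0" if "norm x > \<rho>" for x
    using zero \<rho> that by (force simp: P_def)
  ultimately obtain c where c: "c > 0" "\<And>x. norm (P x) \<le> c"
    using bounded_compact_support by blast
  have P_meas: "P \<in> borel_measurable lebesgue"
    using \<open>continuous_on UNIV P\<close>
    by (intro measurable_completion) (auto intro: borel_measurable_continuous_onI)
  have int: "integrable lebesgue (\<lambda>x. indicator L x *\<^sub>R H x)"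
    using H by (simp add: set_integrable_def)
  have "integrable lebesgue (\<lambda>x. (indicator L x *\<^sub>R H x) \<bullet> P x)"
  proof (rule Bochner_Integration.integrable_bound)
    show "integrable lebesgue (\<lambda>x. c * norm (indicator L x *\<^sub>R H x))"
      using int by (intro integrable_mult_right integrable_norm)
    show "(\<lambda>x. (indicator L x *\<^sub>R H x) \<bullet> P x) \<in> borel_measurable lebesgue"
      using int P_meas by (intro borel_measurable_inner) auto
    have "norm ((indicator L x *\<^sub>R H x) \<bullet> P x) \<le> norm (c * norm (indicator L x *\<^sub>R H x))" for x
    proof -
      have "\<bar>(indicator L x *\<^sub>R H x) \<bullet> P x\<bar> \<le> norm (indicator L x *\<^sub>R H x) * c"
        by (rule order_trans[OF Cauchy_Schwarz_ineq2 mult_left_mono[OF c(2)]]) simp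
      then show ?thesis
        using c(1) by (simp add: mult.commute)
    qed
    then show "AE x in lebesgue. norm ((indicator L x *\<^sub>R H x) \<bullet> P x) \<le> norm (c * norm (indicator L x *\<^sub>R H x))"
      by simp
  qed
  moreover have "(indicator L x *\<^sub>R H x) \<bullet> P x = indicator X x * (H x \<bullet> jacobian \<phi> (at x))" for x
    using zero L(2) by (auto simp: P_def indicator_def)
  ultimately show ?thesis by simp
qed

text \<open>
  Integrating the sum of the lattice translates of \<open>\<phi>\<close> over one cell amounts to integrating \<open>\<phi>\<close>
  over all translates of the cell; the factor \<open>H\<close> is carried along by its periodicity.
\<close>

lemma integral_periodise:
  fixes H :: "real^'d \<Rightarrow> real^'d^'r"
  assumes X: "open_domain J X" and H: "\<And>v x. v \<in> periods J \<Longrightarrow> x \<in> X \<Longrightarrow> H (x + v) = H x"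
    and loc: "\<And>K. compact K \<Longrightarrow> K \<subseteq> X \<Longrightarrow> H absolutely_integrable_on K"
    and \<phi>: "test_function {} X \<phi>"
  shows "(\<integral>x. H x \<bullet> jacobian (periodise J \<phi>) (at x) \<partial>domain_measure J X)
    = (\<integral>x. H x \<bullet> jacobian \<phi> (at x) \<partial>domain_measure {} X)"
proof -
  obtain L where L: "compact L" "L \<subseteq> X" "\<And>x. x \<notin> L \<Longrightarrow> \<phi> x = 0" and \<phi>_smooth: "\<And>i. Ck_on i \<phi> UNIV"
    using \<phi> by (auto simp: test_function_euclidean_iff)
  obtain \<rho> where \<rho>: "\<rho> > 0" "\<And>x. x \<in> L \<Longrightarrow> norm x \<le> \<rho>"
    using compact_imp_bounded[OF L(1)] by (meson bounded_pos)
  define W where "W = periods_upto J (\<rho> + 2)"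
  have W: "finite W" "W \<subseteq> periods J"
    unfolding W_def by (rule finite_periods_upto) (auto simp: periods_upto_def)
  let ?c = "indicator (unit_cell J) :: real^'d \<Rightarrow> real"
  have openX: "open X"
    using X by (simp add: open_domain_def)
  define F where "F x = indicator X x * (H x \<bullet> jacobian \<phi> (at x))" for x
  have F_int: "integrable lebesgue F"
    unfolding F_def by (rule integrable_inner_jacobian[OF \<phi>_smooth L loc[OF L(1,2)]])
  have F_zero: "F x = 0" if "x \<notin> L" for x
    using jacobian_zero_outside[OF \<phi>_smooth compact_imp_closed[OF L(1)] L(3) that] by (simp add: F_def)
  have cell_int: "integrable lebesgue (\<lambda>x. ?c (x - v) * F x)" for v
  proof -
    have "(\<lambda>x. x - v) \<in> borel_measurable borel"
      by measurable
    then have "(\<lambda>x. ?c (x - v)) \<in> borel_measurable borel"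
      by measurable
    then show ?thesis
      using F_int by (intro Bochner_Integration.integrable_bound[OF F_int])
        (auto simp: indicator_def intro!: borel_measurable_times intro: measurable_completion)
  qed
  have tr: "integrable lebesgue (\<lambda>x. ?c x * F (x + v))"
    "(\<integral>x. ?c x * F (x + v) \<partial>lebesgue) = (\<integral>x. ?c (x - v) * F x \<partial>lebesgue)" for v
    using lebesgue_integral_translate[OF cell_int[of v], of v] by simp_all
  have "(\<integral>x. H x \<bullet> jacobian (periodise J \<phi>) (at x) \<partial>domain_measure J X)
      = (\<integral>x. (\<Sum>v\<in>W. ?c x * F (x + v)) \<partial>lebesgue)"
    unfolding integral_domain_measure[OF openX]
  proof (rule Bochner_Integration.integral_cong[OF refl])
    fix x
    show "indicator (X \<inter> unit_cell J) x *\<^sub>R (H x \<bullet> jacobian (periodise J \<phi>) (at x)) = (\<Sum>v\<in>W. ?c x * F (x + v))"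
    proof (cases "x \<in> unit_cell J")
      case True
      have jac: "jacobian (periodise J \<phi>) (at x) = (\<Sum>v\<in>W. jacobian \<phi> (at (x + v)))"
        unfolding W_def
        by (rule jacobian_periodise[OF \<phi>_smooth _ True, of \<rho>]) (use L(3) \<rho> in auto)
      have "F (x + v) = indicator X x * (H x \<bullet> jacobian \<phi> (at (x + v)))" if "v \<in> W" for v
        using that W(2) H[of v x] open_domain_translate_iff[OF X, of v x] by (auto simp: F_def indicator_def)
      then show ?thesis
        using True by (simp add: jac inner_sum_right sum_distrib_left indicator_def)
    qed simp
  qed
  also have "\<dots> = (\<Sum>v\<in>W. \<integral>x. ?c x * F (x + v) \<partial>lebesgue)"
    using tr by (intro Bochner_Integration.integral_sum)
  also have "\<dots> = (\<Sum>v\<in>W. \<integral>x. ?c (x - v) * F x \<partial>lebesgue)"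
    using tr by (intro sum.cong) simp_all
  also have "\<dots> = (\<integral>x. (\<Sum>v\<in>W. ?c (x - v) * F x) \<partial>lebesgue)"
    using cell_int by (intro Bochner_Integration.integral_sum[symmetric])
  also have "\<dots> = (\<integral>x. F x \<partial>lebesgue)"
  proof (rule Bochner_Integration.integral_cong[OF refl])
    fix x
    show "(\<Sum>v\<in>W. ?c (x - v) * F x) = F x"
    proof (cases "x \<in> L")
      case True
      have "\<bar>x $ j\<bar> \<le> \<rho>" for j
        using \<rho>(2)[OF True] component_le_norm_cart[of x j] by simp
      then have "floor_vec J x \<in> W"
        unfolding W_def using \<rho>(1) by (intro floor_vec_in_periods_upto[of _ _ \<rho>]) auto
      from sum_indicator_unit_cell[OF W this] show ?thesis
        by (simp add: sum_distrib_right[symmetric])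
    qed (simp add: F_zero)
  qed
  also have "\<dots> = (\<integral>x. H x \<bullet> jacobian \<phi> (at x) \<partial>domain_measure {} X)"
    unfolding integral_domain_measure[OF openX] by (simp add: F_def unit_cell_def)
  finally show ?thesis .
qed

lemma weak_form_periodic_iff:
  fixes H :: "real^'d \<Rightarrow> real^'d^'r"
  assumes "open_domain J X" "\<And>v x. v \<in> periods J \<Longrightarrow> x \<in> X \<Longrightarrow> H (x + v) = H x"
    "\<And>K. compact K \<Longrightarrow> K \<subseteq> X \<Longrightarrow> H absolutely_integrable_on K"
  shows "weak_form J X H \<longleftrightarrow> weak_form {} X H"
proof
  assume *: "weak_form J X H"
  show "weak_form {} X H"
    unfolding weak_form_def
  proof (intro allI impI)
    fix \<phi> :: "real^'d \<Rightarrow> real^'r" assume \<phi>: "test_function {} X \<phi>"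
    then show "(\<integral>x. H x \<bullet> jacobian \<phi> (at x) \<partial>domain_measure {} X) = 0"
      using * test_function_periodise[OF \<phi>, of J] integral_periodise[OF assms \<phi>]
      by (simp add: weak_form_def)
  qed
next
  assume *: "weak_form {} X H"
  show "weak_form J X H"
    unfolding weak_form_def
  proof (intro allI impI)
    fix \<psi> :: "real^'d \<Rightarrow> real^'r" assume "test_function J X \<psi>"
    then obtain \<phi> where \<phi>: "test_function {} X \<phi>" "periodise J \<phi> = \<psi>"
      using test_function_is_periodisation[OF assms(1)] by blast
    then show "(\<integral>x. H x \<bullet> jacobian \<psi> (at x) \<partial>domain_measure J X) = 0"
      using * integral_periodise[OF assms \<phi>(1)] by (simp add: weak_form_def)
  qed
qed

section \<open>From the hypotheses on \<open>U\<close> to a bounded Borel function\<close>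

lemma AE_lebesgue_translate:
  assumes "AE x in (lebesgue :: 'a::euclidean_space measure). P x"
  shows "AE x in lebesgue. P (x + v)"
proof (rule AE_distrD[OF lebesgue_translate(2)])
  show "AE x in distr lebesgue lebesgue (\<lambda>x. x + v). P x"
    unfolding lebesgue_translate(1) by (rule assms)
qed

lemma periodic_AE:
  fixes P :: "real^'d \<Rightarrow> bool"
  assumes X: "open_domain J X" and P: "\<And>v x. v \<in> periods J \<Longrightarrow> x \<in> X \<Longrightarrow> P (x + v) = P x"
    and AE: "AE x in domain_measure J X. P x"
  shows "AE x in lebesgue. x \<in> X \<longrightarrow> P x"
proof -
  have openX: "open X"
    using X by (simp add: open_domain_def)
  have "AE x in lebesgue. x \<in> X \<inter> unit_cell J \<longrightarrow> P x"
    using AE integral_domain_measure(3)[OF openX, of J] unfolding domain_measure_def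
    by (subst (asm) AE_restrict_space_iff) auto
  then have "AE x in lebesgue. x + - v \<in> X \<inter> unit_cell J \<longrightarrow> P (x + - v)" for v
    by (rule AE_lebesgue_translate)
  then have "AE x in lebesgue. \<forall>v\<in>periods J. x + - v \<in> X \<inter> unit_cell J \<longrightarrow> P (x + - v)"
    by (intro AE_ball_countable' countable_periods)
  then show ?thesis
  proof eventually_elim
    case (elim x)
    show ?case
    proof
      assume x: "x \<in> X"
      define v where "v = floor_vec J x"
      have v: "v \<in> periods J" "- v \<in> periods J" "x - v \<in> unit_cell J"
        using floor_vec_in_periods[of J x] by (auto simp: v_def periods_minus diff_in_unit_cell_iff)
      then show "P x"
        using elim open_domain_translate_iff[OF X v(2)] P[OF v(2) x] x by auto
    qed
  qed
qed

text \<open>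
  The function is the pointwise limit of finite sums of translates of its restriction to the cell.
\<close>

lemma periodic_measurable:
  fixes f :: "real^'d \<Rightarrow> 'b::euclidean_space"
  assumes X: "open_domain J X" and f: "\<And>v x. v \<in> periods J \<Longrightarrow> x \<in> X \<Longrightarrow> f (x + v) = f x"
    and meas: "f \<in> borel_measurable (domain_measure J X)"
  shows "(\<lambda>x. indicator X x *\<^sub>R f x) \<in> borel_measurable lebesgue"
proof -
  define h where "h x = indicator (X \<inter> unit_cell J) x *\<^sub>R f x" for x
  have openX: "open X"
    using X by (simp add: open_domain_def)
  have "h \<in> borel_measurable lebesgue"
    using meas integral_domain_measure(3)[OF openX, of J]
    by (simp add: h_def[abs_def] domain_measure_def borel_measurable_restrict_space_iff)
  then have shift: "(\<lambda>x. h (x + - v)) \<in> borel_measurable lebesgue" for v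
    using measurable_compose[OF lebesgue_translate(2)] by blast
  have lim: "(\<lambda>n. \<Sum>v\<in>periods_upto J (real n). h (x - v)) \<longlonglongrightarrow> indicator X x *\<^sub>R f x" for x
  proof (rule tendsto_eventually)
    obtain N :: nat where N: "norm x + 1 \<le> real N"
      using real_arch_simple by blast
    show "\<forall>\<^sub>F n in sequentially. (\<Sum>v\<in>periods_upto J (real n). h (x - v)) = indicator X x *\<^sub>R f x"
      using eventually_ge_at_top[of N]
    proof eventually_elim
      case (elim n)
      have "floor_vec J x \<in> periods_upto J (real n)"
        using N elim component_le_norm_cart[of x]
        by (intro floor_vec_in_periods_upto[of _ _ "norm x"]) auto
      then show ?case
        unfolding h_def
        by (intro sum_translates_of_cell X f finite_periods_upto) (auto simp: periods_upto_def)
    qed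
  qed
  show ?thesis
    by (rule borel_measurable_LIMSEQ_metric[OF _ lim]) (use shift in auto)
qed

lemma vec_measurable_iff:
  fixes U :: "'a \<Rightarrow> real^'n"
  shows "U \<in> borel_measurable M \<longleftrightarrow> (\<forall>i. (\<lambda>x. U x $ i) \<in> borel_measurable M)"
proof -
  have "U \<in> borel_measurable M \<longleftrightarrow> (\<forall>b\<in>Basis. (\<lambda>x. U x \<bullet> b) \<in> borel_measurable M)"
    by (rule borel_measurable_euclidean_space)
  also have "\<dots> \<longleftrightarrow> (\<forall>i. (\<lambda>x. U x $ i) \<in> borel_measurable M)"
    by (auto simp: Basis_vec_def inner_axis)
  finally show ?thesis .
qed

text \<open>
  By Lindelof's theorem, countably many balls with null preimage cover the complement of the
  essential range.
\<close>

lemma AE_essential_range: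
  fixes U :: "real^'d \<Rightarrow> real^'n"
  assumes "open X" and U[measurable]: "U \<in> borel_measurable (domain_measure J X)"
  shows "AE x in domain_measure J X. U x \<in> essential_range J X U"
proof -
  let ?M = "domain_measure J X" and ?K = "essential_range J X U"
  have space: "space ?M = X \<inter> unit_cell J"
    by (simp add: domain_measure_def)
  have "\<forall>y. \<exists>r. y \<notin> ?K \<longrightarrow> r > 0 \<and> emeasure ?M {x \<in> X \<inter> unit_cell J. norm (U x - y) < r} = 0"
    by (auto simp: essential_range_def)
  from choice[OF this] obtain r where r: "\<And>y. y \<notin> ?K \<Longrightarrow> r y > 0"
      "\<And>y. y \<notin> ?K \<Longrightarrow> emeasure ?M {x \<in> X \<inter> unit_cell J. norm (U x - y) < r y} = 0"
    by blast
  obtain F where F: "F \<subseteq> (\<lambda>y. ball y (r y)) ` (- ?K)" "countable F" "\<Union>F = \<Union>((\<lambda>y. ball y (r y)) ` (- ?K))"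
    using Lindelof[of "(\<lambda>y. ball y (r y)) ` (- ?K)"] by auto
  have "AE x in ?M. U x \<notin> S" if "S \<in> F" for S
  proof -
    obtain y where y: "y \<notin> ?K" "S = ball y (r y)"
      using F(1) \<open>S \<in> F\<close> by blast
    have "{x \<in> space ?M. U x \<in> S} = {x \<in> X \<inter> unit_cell J. norm (U x - y) < r y}"
      by (auto simp: space y(2) dist_norm norm_minus_commute)
    then have "emeasure ?M {x \<in> space ?M. U x \<in> S} = 0"
      using r(2)[OF y(1)] by simp
    moreover have "{x \<in> space ?M. U x \<in> S} \<in> sets ?M"
      using measurable_sets[OF U, of "ball y (r y)"] by (simp add: y(2) vimage_def Int_def conj_commute)
    ultimately show ?thesis
      by (intro AE_I[where N = "{x \<in> space ?M. U x \<in> S}"]) auto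
  qed
  then have "AE x in ?M. \<forall>S\<in>F. U x \<notin> S"
    by (intro AE_ball_countable' F(2))
  then show ?thesis
  proof eventually_elim
    case (elim x)
    then have "U x \<notin> \<Union>((\<lambda>y. ball y (r y)) ` (- ?K))"
      using F(3) by auto
    show ?case
    proof (rule ccontr)
      assume "U x \<notin> ?K"
      then have "U x \<in> ball (U x) (r (U x))"
        using r(1) by simp
      with elim show False
        using \<open>U x \<notin> ?K\<close> \<open>U x \<notin> \<Union>((\<lambda>y. ball y (r y)) ` (- ?K))\<close> by blast
    qed
  qed
qed

lemma borel_representative:
  fixes f :: "'a::euclidean_space \<Rightarrow> real^'n"
  assumes "f \<in> borel_measurable lebesgue"
  obtains V where "V \<in> borel_measurable borel" "AE x in lebesgue. f x = V x"
proof -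
  have "\<exists>h\<in>borel_measurable lborel. AE x in lborel. f x $ i = h x" for i
    using assms by (intro completion_ex_borel_measurable_real) (auto simp: vec_measurable_iff)
  then obtain h where h: "\<And>i. h i \<in> borel_measurable lborel" "\<And>i. AE x in lborel. f x $ i = h i x"
    by metis
  show thesis
  proof (rule that)
    show "(\<lambda>x. \<chi> i. h i x) \<in> borel_measurable borel"
      using h(1) by (simp add: vec_measurable_iff)
    have "AE x in lborel. \<forall>i. f x $ i = h i x"
      unfolding AE_all_countable using h(2) by blast
    then show "AE x in lebesgue. f x = (\<chi> i. h i x)"
      by (intro AE_completion) (auto simp: vec_eq_iff elim: eventually_mono)
  qed
qed

section \<open>The Besov bound on compact sets\<close>

lemma norm_cube_le_sum_cubes:
  fixes w :: "real^'n"
  shows "norm w ^ 3 \<le> CARD('n) ^ 3 * (\<Sum>i\<in>UNIV. \<bar>w $ i\<bar> ^ 3)"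
proof -
  define m where "m = Max (range (\<lambda>i. \<bar>w $ i\<bar>))"
  have m: "\<bar>w $ i\<bar> \<le> m" for i
    by (auto simp: m_def)
  have "m \<in> range (\<lambda>i. \<bar>w $ i\<bar>)"
    unfolding m_def by (intro Max_in) auto
  then obtain i0 where i0: "m = \<bar>w $ i0\<bar>" by auto
  have "norm w \<le> (\<Sum>i\<in>(UNIV::'n set). m)"
    using norm_le_l1_cart[of w] sum_mono[of UNIV "\<lambda>i. \<bar>w $ i\<bar>" "\<lambda>_. m"] m by force
  then have "norm w ^ 3 \<le> (CARD('n) * m) ^ 3"
    by (intro power_mono) auto
  also have "\<dots> = CARD('n) ^ 3 * \<bar>w $ i0\<bar> ^ 3"
    by (simp add: power_mult_distrib i0)
  also have "\<dots> \<le> CARD('n) ^ 3 * (\<Sum>i\<in>UNIV. \<bar>w $ i\<bar> ^ 3)"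
    by (intro mult_left_mono member_le_sum) auto
  finally show ?thesis .
qed

lemma cube_diff_le: "\<bar>a - b\<bar> powr 3 \<le> 8 * (\<bar>a\<bar> powr 3 + \<bar>b\<bar> powr 3)" for a b :: real
proof -
  define m where "m = max \<bar>a\<bar> \<bar>b\<bar>"
  have "\<bar>a - b\<bar> ^ 3 \<le> (2 * m) ^ 3"
    by (intro power_mono) (auto simp: m_def)
  also have "\<dots> \<le> 8 * (\<bar>a\<bar> ^ 3 + \<bar>b\<bar> ^ 3)"
    by (auto simp: m_def max_def power_mult_distrib)
  finally show ?thesis by simp
qed

text \<open>
  A compact set meets finitely many translates of the cell, so the increment over it is bounded by
  the one over the cell.  This comparison needs the increment to be integrable over the whole
  cell: the shifted function is, because the shifted cell is covered by finitely many translates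
  of the cell.
\<close>

lemma besov_increment_local:
  fixes u :: "real^'d \<Rightarrow> real"
  assumes X: "open_domain J X" and u: "u \<in> besov_space \<alpha> 3 J X" and S: "compact S" "S \<subseteq> X"
  shows "\<exists>c d. d > 0 \<and> (\<forall>y. norm y < d \<longrightarrow>
      integrable lebesgue (\<lambda>x. indicator S x * \<bar>u x - u (x - y)\<bar> powr 3) \<and>
      (\<integral>x. indicator S x * \<bar>u x - u (x - y)\<bar> powr 3 \<partial>lebesgue) \<le> c * norm y powr (3 * \<alpha>))"
proof -
  have openX: "open X"
    using X by (simp add: open_domain_def)
  have u_per: "u (x + v) = u x" if "v \<in> periods J" "x \<in> X" for v x
    using u that by (auto simp: besov_space_def Lq_space_def functions_on_def)
  have u_meas: "u \<in> borel_measurable (domain_measure J X)"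
    and u_int: "integrable (domain_measure J X) (\<lambda>x. \<bar>u x\<bar> powr 3)"
    using u by (auto simp: besov_space_def Lq_space_def)
  define D where "D y = X \<inter> (\<lambda>x. x + y) ` X" for y
  have D_iff: "x \<in> D y \<longleftrightarrow> x \<in> X \<and> x - y \<in> X" for x y
    by (force simp: D_def)
  obtain c where c: "\<And>y. y \<noteq> 0 \<Longrightarrow> norm y powr (- \<alpha>) * Lq_norm 3 J (D y) (\<lambda>x. u x - u (x - y)) \<le> c"
    using u by (auto simp: besov_space_def bdd_above_def D_def)
  have D_dom: "open_domain J (D y)" for y
  proof -
    have "open (D y)"
      unfolding D_def using openX open_translation[OF openX, of y] by (auto simp: add.commute)
    moreover have "x + v \<in> D y" if "v \<in> periods J" "x \<in> D y" for x v
      using that open_domain_translate_iff[OF X that(1), of x] open_domain_translate_iff[OF X that(1), of "x - y"]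
      by (auto simp: D_iff algebra_simps)
    ultimately show ?thesis
      by (auto simp: open_domain_def)
  qed
  define h where "h y x = \<bar>u x - u (x - y)\<bar> powr 3" for y x
  have h_per: "h y (x + v) = h y x" if "v \<in> periods J" "x \<in> D y" for y v x
    using that u_per[of v x] u_per[of v "x - y"] by (simp add: h_def D_iff algebra_simps)
  have int_cell: "integrable lebesgue (\<lambda>x. indicator (D y \<inter> unit_cell J) x * h y x)" for y
  proof -
    have Xc: "integrable lebesgue (\<lambda>x. indicator (X \<inter> unit_cell J) x * \<bar>u x\<bar> powr 3)"
      using u_int integral_domain_measure(2)[OF openX, where f = "\<lambda>x. \<bar>u x\<bar> powr 3" and J = J] by simp
    define T where "T = {x \<in> X. x + y \<in> X \<inter> unit_cell J}"
    have "(\<lambda>x. x + y) -` (X \<inter> unit_cell J) \<inter> space borel \<in> sets borel"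
      using openX by (intro measurable_sets[of _ borel borel]) auto
    moreover have "T = X \<inter> ((\<lambda>x. x + y) -` (X \<inter> unit_cell J) \<inter> space borel)"
      by (auto simp: T_def)
    ultimately have "T \<in> sets borel"
      using openX by (simp add: sets.Int borel_open)
    then have T: "T \<in> sets lebesgue"
      by auto
    have "integrable lebesgue (\<lambda>x. indicator T x * \<bar>u x\<bar> powr 3)"
    proof (rule periodic_integrable_over(1)[OF X _ Xc T])
      show "floor_vec J x \<in> periods_upto J (norm y + 2)" if "x \<in> T" for x
      proof (rule floor_vec_in_periods_upto)
        show "\<bar>x $ j\<bar> \<le> norm y + 1" if "j \<in> J" for j
        proof -
          have "0 \<le> x $ j + y $ j" "x $ j + y $ j < 1"
            using \<open>x \<in> T\<close> that by (auto simp: T_def unit_cell_def)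
          then show ?thesis
            using component_le_norm_cart[of y j] by linarith
        qed
      qed auto
      show "finite (periods_upto J (norm y + 2))" "periods_upto J (norm y + 2) \<subseteq> periods J"
        by (rule finite_periods_upto) (auto simp: periods_upto_def)
    qed (auto simp: T_def u_per)
    from lebesgue_integral_translate(1)[OF this, of "- y"]
    have sh: "integrable lebesgue (\<lambda>x. indicator T (x - y) * \<bar>u (x - y)\<bar> powr 3)"
      by simp
    have U_meas: "(\<lambda>x. indicator X x *\<^sub>R u x) \<in> borel_measurable lebesgue"
      by (rule periodic_measurable[OF X u_per u_meas])
    have U_meas': "(\<lambda>x. indicator X (x + - y) *\<^sub>R u (x + - y)) \<in> borel_measurable lebesgue"
      using measurable_compose[OF lebesgue_translate(2)[of "- y"] U_meas] .
    have Dc: "indicator (D y \<inter> unit_cell J) \<in> borel_measurable lebesgue"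
      using integral_domain_measure(3)[of "D y" J] D_dom[of y]
      by (intro borel_measurable_indicator) (auto simp: open_domain_def)
    have meas: "(\<lambda>x. indicator (D y \<inter> unit_cell J) x *
        \<bar>indicator X x *\<^sub>R u x - indicator X (x + - y) *\<^sub>R u (x + - y)\<bar> powr 3) \<in> borel_measurable lebesgue"
      using U_meas U_meas' Dc by measurable
    have "(\<lambda>x. indicator (D y \<inter> unit_cell J) x *
        \<bar>indicator X x *\<^sub>R u x - indicator X (x + - y) *\<^sub>R u (x + - y)\<bar> powr 3)
      = (\<lambda>x. indicator (D y \<inter> unit_cell J) x * h y x)"
      by (auto simp: h_def indicator_def D_iff)
    with meas have meas: "(\<lambda>x. indicator (D y \<inter> unit_cell J) x * h y x) \<in> borel_measurable lebesgue"
      by simp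
    show ?thesis
    proof (rule Bochner_Integration.integrable_bound[OF _ meas])
      show "integrable lebesgue (\<lambda>x. 8 * (indicator (X \<inter> unit_cell J) x * \<bar>u x\<bar> powr 3
          + indicator T (x - y) * \<bar>u (x - y)\<bar> powr 3))"
        using Xc sh by (intro integrable_mult_right Bochner_Integration.integrable_add)
      have "indicator (D y \<inter> unit_cell J) x * h y x \<le> 8 * (indicator (X \<inter> unit_cell J) x * \<bar>u x\<bar> powr 3
          + indicator T (x - y) * \<bar>u (x - y)\<bar> powr 3)" for x
        using cube_diff_le[of "u x" "u (x - y)"] by (auto simp: indicator_def D_iff T_def h_def)
      then show "AE x in lebesgue. norm (indicator (D y \<inter> unit_cell J) x * h y x)
          \<le> norm (8 * (indicator (X \<inter> unit_cell J) x * \<bar>u x\<bar> powr 3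
          + indicator T (x - y) * \<bar>u (x - y)\<bar> powr 3))"
        by (intro AE_I2) (smt (verit) h_def indicator_pos_le mult_nonneg_nonneg powr_ge_zero real_norm_def)
    qed
  qed
  have cell_bound: "(\<integral>x. indicator (D y \<inter> unit_cell J) x * h y x \<partial>lebesgue) \<le> \<bar>c\<bar> ^ 3 * norm y powr (3 * \<alpha>)"
    if y: "y \<noteq> 0" for y
  proof -
    define I where "I = (\<integral>x. indicator (D y \<inter> unit_cell J) x * h y x \<partial>lebesgue)"
    have I: "I \<ge> 0"
      unfolding I_def by (intro integral_nonneg_AE) (auto simp: h_def)
    have L: "Lq_norm 3 J (D y) (\<lambda>x. u x - u (x - y)) = I powr (1/3)"
      using integral_domain_measure(1)[where f = "\<lambda>x. \<bar>u x - u (x - y)\<bar> powr 3" and X = "D y" and J = J] D_dom[of y]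
      by (simp add: Lq_norm_def I_def h_def open_domain_def)
    have "norm y powr (- \<alpha>) * I powr (1/3) \<le> c"
      using c[OF y] L by simp
    then have "norm y powr \<alpha> * (norm y powr (- \<alpha>) * I powr (1/3)) \<le> norm y powr \<alpha> * \<bar>c\<bar>"
      by (intro mult_left_mono) auto
    then have "I powr (1/3) \<le> \<bar>c\<bar> * norm y powr \<alpha>"
      using y by (simp add: powr_minus field_simps)
    then have "(I powr (1/3)) ^ 3 \<le> (\<bar>c\<bar> * norm y powr \<alpha>) ^ 3"
      by (intro power_mono) auto
    also have "(I powr (1/3)) ^ 3 = (I powr (1/3)) powr 3"
      by simp
    also have "\<dots> = I"
      using I by (simp only: powr_powr) simp
    also have "(\<bar>c\<bar> * norm y powr \<alpha>) ^ 3 = \<bar>c\<bar> ^ 3 * norm y powr (3 * \<alpha>)"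
      using y by (simp add: power_mult_distrib powr_power mult.commute)
    finally show ?thesis
      by (simp add: I_def)
  qed
  obtain d where d: "d > 0" "(\<Union>x\<in>S. ball x d) \<subseteq> X"
    using compact_subset_open_imp_ball_epsilon_subset[OF S(1) openX S(2)] by blast
  obtain \<rho> where \<rho>: "\<rho> > 0" "\<And>x. x \<in> S \<Longrightarrow> norm x \<le> \<rho>"
    using compact_imp_bounded[OF S(1)] by (meson bounded_pos)
  define W where "W = periods_upto J (\<rho> + 1)"
  have S_leb: "S \<in> sets lebesgue"
    using S(1) by (simp add: compact_imp_closed borel_closed)
  show ?thesis
  proof (intro exI conjI allI impI)
    show "d > 0" by fact
    fix y :: "real^'d" assume y: "norm y < d"
    have SD: "S \<subseteq> D y"
    proof
      fix x assume x: "x \<in> S"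
      then have "x - y \<in> ball x d"
        using y by (simp add: dist_norm)
      then have "x - y \<in> X"
        using d(2) x by blast
      then show "x \<in> D y"
        using S(2) x by (auto simp: D_iff)
    qed
    have "floor_vec J x \<in> W" if "x \<in> S" for x
    proof -
      have "\<bar>x $ j\<bar> \<le> \<rho>" for j
        using \<rho>(2)[OF that] component_le_norm_cart[of x j] by simp
      then show ?thesis
        unfolding W_def using \<rho>(1) by (intro floor_vec_in_periods_upto[of _ _ \<rho>]) auto
    qed
    note over = periodic_integrable_over[OF D_dom h_per int_cell S_leb SD _ _ this]
    have W: "finite W" "W \<subseteq> periods J"
      unfolding W_def by (rule finite_periods_upto) (auto simp: periods_upto_def)
    show "integrable lebesgue (\<lambda>x. indicator S x * \<bar>u x - u (x - y)\<bar> powr 3)"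
      using over(1) W by (simp add: h_def)
    show "(\<integral>x. indicator S x * \<bar>u x - u (x - y)\<bar> powr 3 \<partial>lebesgue)
        \<le> real (card W) * \<bar>c\<bar> ^ 3 * norm y powr (3 * \<alpha>)"
    proof (cases "y = 0")
      case False
      have "(\<integral>x. indicator S x * h y x \<partial>lebesgue)
          \<le> card W * (\<integral>x. indicator (D y \<inter> unit_cell J) x * h y x \<partial>lebesgue)"
        using over(2) W by (simp add: h_def)
      also have "\<dots> \<le> card W * (\<bar>c\<bar> ^ 3 * norm y powr (3 * \<alpha>))"
        by (intro mult_left_mono cell_bound False) auto
      finally show ?thesis
        by (simp add: h_def)
    qed simp
  qed
qed

section \<open>The companion law\<close>

text \<open>
  The left side involves only globally defined Borel functions, as \<open>companion_law_euclidean\<close>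
  demands.  In the applications \<open>a\<close> is \<open>A\<close> times the cutoff, so both agree at the values of \<open>U\<close>.
\<close>

lemma weak_integral_eq:
  fixes A :: "real^'n \<Rightarrow> real^'d^'r" and a :: "real^'n \<Rightarrow> real^'d^'r"
  assumes X: "open X" and V: "V \<in> borel_measurable borel" and a: "continuous_on UNIV a"
    and AE: "AE x in lebesgue. x \<in> X \<longrightarrow> a (V x) = A (U x)"
    and loc: "\<And>K. compact K \<Longrightarrow> K \<subseteq> X \<Longrightarrow> (\<lambda>x. A (U x)) absolutely_integrable_on K"
    and \<phi>: "Ck_on 1 \<phi> UNIV" and S: "compact S" "S \<subseteq> X" "\<And>x. x \<notin> S \<Longrightarrow> \<phi> x = 0"
  shows "(\<integral>x. (\<Sum>v\<in>Basis. (a (V x) *v v) \<bullet> frechet_derivative \<phi> (at x) v) \<partial>lborel)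
    = (\<integral>x. A (U x) \<bullet> jacobian \<phi> (at x) \<partial>domain_measure {} X)"
proof -
  have aV: "(\<lambda>x. a (V x)) \<in> borel_measurable borel"
    using measurable_compose[OF V borel_measurable_continuous_onI[OF a]] .
  have jac: "(\<lambda>x. jacobian \<phi> (at x)) \<in> borel_measurable borel"
    by (rule borel_measurable_continuous_onI[OF continuous_jacobian[OF \<phi>]])
  have meas: "(\<lambda>x. a (V x) \<bullet> jacobian \<phi> (at x)) \<in> borel_measurable lborel"
    using aV jac by (intro borel_measurable_inner) simp_all
  have "(\<integral>x. (\<Sum>v\<in>Basis. (a (V x) *v v) \<bullet> frechet_derivative \<phi> (at x) v) \<partial>lborel)
      = (\<integral>x. a (V x) \<bullet> jacobian \<phi> (at x) \<partial>lborel)"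
    by (simp add: jacobian_def inner_matrix_eq_sum_Basis)
  also have "\<dots> = (\<integral>x. a (V x) \<bullet> jacobian \<phi> (at x) \<partial>lebesgue)"
    by (rule integral_completion[OF meas, symmetric])
  also have "\<dots> = (\<integral>x. indicator X x * (A (U x) \<bullet> jacobian \<phi> (at x)) \<partial>lebesgue)"
  proof (rule integral_cong_AE)
    show "(\<lambda>x. a (V x) \<bullet> jacobian \<phi> (at x)) \<in> borel_measurable lebesgue"
      by (rule measurable_completion[OF meas])
    show "(\<lambda>x. indicator X x * (A (U x) \<bullet> jacobian \<phi> (at x))) \<in> borel_measurable lebesgue"
      using integrable_inner_jacobian[OF \<phi> S loc[OF S(1,2)]] by (rule borel_measurable_integrable)
    show "AE x in lebesgue. a (V x) \<bullet> jacobian \<phi> (at x) = indicator X x * (A (U x) \<bullet> jacobian \<phi> (at x))"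
      using AE
    proof eventually_elim
      case (elim x)
      have "jacobian \<phi> (at x) = 0" if "x \<notin> X"
        using jacobian_zero_outside[OF \<phi> compact_imp_closed[OF S(1)] S(3)] S(2) that by blast
      then show ?case
        using elim by (cases "x \<in> X") auto
    qed
  qed
  also have "\<dots> = (\<integral>x. A (U x) \<bullet> jacobian \<phi> (at x) \<partial>domain_measure {} X)"
    unfolding integral_domain_measure[OF X] by (simp add: unit_cell_def)
  finally show ?thesis .
qed

lemma besov_local_representative:
  fixes U V :: "real^'d \<Rightarrow> real^'n"
  assumes X: "open_domain J X" and U: "\<And>i. (\<lambda>x. U x $ i) \<in> besov_space \<alpha> 3 J X"
    and V: "V \<in> borel_measurable borel" "\<And>x. norm (V x) \<le> M" "AE x in lebesgue. x \<in> X \<longrightarrow> V x = U x"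
    and S: "compact S" "S \<subseteq> X"
  shows "\<exists>c d. d > 0 \<and> (\<forall>y. norm y < d \<longrightarrow>
        (\<integral>x. indicator S x * norm (V x - V (x - y)) ^ 3 \<partial>lborel) \<le> c * norm y powr (3 * \<alpha>))"
proof -
  have openX: "open X"
    using X by (simp add: open_domain_def)
  define inc where "inc y i x = indicator S x * \<bar>U x $ i - U (x - y) $ i\<bar> powr 3" for y i x
  have "\<forall>i. \<exists>c d. d > 0 \<and> (\<forall>y. norm y < d \<longrightarrow>
      integrable lebesgue (inc y i) \<and> (\<integral>x. inc y i x \<partial>lebesgue) \<le> c * norm y powr (3 * \<alpha>))"
    unfolding inc_def[abs_def] using besov_increment_local[OF X U S] by blast
  then obtain c d where cd: "\<And>i. d i > 0"
      "\<And>i y. norm y < d i \<Longrightarrow> integrable lebesgue (inc y i)"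
      "\<And>i y. norm y < d i \<Longrightarrow> (\<integral>x. inc y i x \<partial>lebesgue) \<le> c i * norm y powr (3 * \<alpha>)"
    by metis
  obtain d0 where d0: "d0 > 0" "(\<Union>x\<in>S. ball x d0) \<subseteq> X"
    using compact_subset_open_imp_ball_epsilon_subset[OF S(1) openX S(2)] by blast
  define d1 where "d1 = min d0 (Min (range d))"
  have d1: "d1 > 0" "d1 \<le> d0" "\<And>i. d1 \<le> d i"
    using cd(1) d0(1) by (auto simp: d1_def min_le_iff_disj)
  obtain \<rho> where \<rho>: "\<And>x. x \<in> S \<Longrightarrow> norm x \<le> \<rho>"
    using compact_imp_bounded[OF S(1)] by (meson bounded_iff)
  note [measurable] = V(1)
  have [measurable]: "S \<in> sets borel"
    using S(1) by (simp add: compact_imp_closed borel_closed)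
  show ?thesis
  proof (intro exI conjI allI impI)
    show "d1 > 0" by fact
    fix y :: "real^'d" assume y: "norm y < d1"
    define F where "F x = indicator S x * norm (V x - V (x - y)) ^ 3" for x
    have F_meas: "F \<in> borel_measurable lborel"
      unfolding F_def by measurable
    have F_int: "integrable lborel F"
    proof (rule integrable_bounded_support[where c = "(2 * M) ^ 3" and R = \<rho>])
      have "norm (V x - V (x - y)) ^ 3 \<le> (2 * M) ^ 3" for x
        using norm_triangle_ineq4[of "V x" "V (x - y)"] V(2)[of x] V(2)[of "x - y"]
        by (intro power_mono) auto
      moreover have "0 \<le> (2 * M) ^ 3"
        using order_trans[OF norm_ge_zero V(2)] by simp
      ultimately show "norm (F x) \<le> (2 * M) ^ 3" for x
        by (simp add: F_def indicator_def)
      show "F x = 0" if "norm x > \<rho>" for x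
        using \<rho>[of x] that by (force simp: F_def)
    qed (use F_meas in simp)
    have "AE x in lebesgue. x + - y \<in> X \<longrightarrow> V (x + - y) = U (x + - y)"
      by (rule AE_lebesgue_translate[OF V(3)])
    with V(3) have AE: "AE x in lebesgue. F x \<le> CARD('n) ^ 3 * (\<Sum>i\<in>UNIV. inc y i x)"
    proof eventually_elim
      case (elim x)
      show ?case
      proof (cases "x \<in> S")
        case True
        have "x - y \<in> ball x d0"
          using y d1 by (simp add: dist_norm)
        then have "x \<in> X" "x - y \<in> X"
          using True S(2) d0(2) by blast+
        then have "F x = norm (U x - U (x - y)) ^ 3"
          using elim True by (simp add: F_def)
        then show ?thesis
          using norm_cube_le_sum_cubes[of "U x - U (x - y)"] True by (simp add: inc_def)
      qed (simp add: F_def inc_def)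
    qed
    have inc_int: "integrable lebesgue (inc y i)" for i
      using cd(2) y d1(3)[of i] by simp
    have "(\<integral>x. F x \<partial>lborel) = (\<integral>x. F x \<partial>lebesgue)"
      by (rule integral_completion[OF F_meas, symmetric])
    also have "\<dots> \<le> (\<integral>x. CARD('n) ^ 3 * (\<Sum>i\<in>UNIV. inc y i x) \<partial>lebesgue)"
      using F_int inc_int AE by (intro integral_mono_AE) (auto simp: integrable_completion)
    also have "\<dots> = CARD('n) ^ 3 * (\<Sum>i\<in>UNIV. \<integral>x. inc y i x \<partial>lebesgue)"
      using inc_int by (simp add: Bochner_Integration.integral_sum)
    also have "\<dots> \<le> CARD('n) ^ 3 * (\<Sum>i\<in>UNIV. c i * norm y powr (3 * \<alpha>))"
      using cd(3) y d1(3) by (intro mult_left_mono sum_mono) (auto intro: less_le_trans)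
    also have "\<dots> = CARD('n) ^ 3 * (\<Sum>i\<in>UNIV. c i) * norm y powr (3 * \<alpha>)"
      by (simp add: sum_distrib_right)
    finally show "(\<integral>x. indicator S x * norm (V x - V (x - y)) ^ 3 \<partial>lborel)
        \<le> CARD('n) ^ 3 * (\<Sum>i\<in>UNIV. c i) * norm y powr (3 * \<alpha>)"
      by (simp add: F_def)
  qed
qed

lemma Ck_on_matrix_apply:
  fixes A :: "'a::euclidean_space \<Rightarrow> real^'d^'r"
  assumes "open S" "Ck_on k A S"
  shows "Ck_on k (\<lambda>u. A u *v v) S"
  by (rule Ck_on_bounded_linear[OF assms(1) bounded_linear_matrix_apply assms(2)])

lemma frechet_derivative_cong_open:
  assumes "open S" "u \<in> S" "\<And>w. w \<in> S \<Longrightarrow> f w = h w" "(f has_derivative D) (at u)"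
  shows "frechet_derivative h (at u) = D"
  using has_derivative_transform_within_open[OF assms(4,1,2)] assms(3) frechet_derivative_eq by blast

theorem theorem1p4:
  fixes i0 :: "'d::finite"
    and J :: "'d set"
    and X :: "(real^'d) set"
    and \<O> :: "(real^'n) set"
    and \<alpha> :: real
    and G :: "real^'n \<Rightarrow> real^'d^'n"
    and Q :: "real^'n \<Rightarrow> real^'d^1"
    and B :: "real^'n \<Rightarrow> real^'n^1"
    and U :: "real^'d \<Rightarrow> real^'n"
  assumes "open \<O>"
    and "J = {} \<or> J = - {i0}"
    and "open_domain J X"
    and "0 < \<alpha>" and "\<alpha> < 1" and "\<alpha> > 1/3"
    and "Ck_on 2 G \<O>"
    and "U \<in> besov_space_into \<alpha> 3 J X \<O>"
    and "weak_solution J X \<O> G U"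
    and "continuous_on \<O> Q"
    and "Ck_on 1 B \<O>"
    and "\<forall>u\<in>\<O>. \<forall>j. (\<lambda>w. column j (Q w)) differentiable (at u) \<and>
           jacobian (\<lambda>w. column j (Q w)) (at u) = B u ** jacobian (\<lambda>w. column j (G w)) (at u)"
    and "compact (essential_range J X U)" and "essential_range J X U \<subseteq> \<O>"
  shows "weak_solution J X \<O> Q U"
proof -
  note open_\<O> = assms(1) and X = assms(3) and G = assms(7) and B = assms(11)
  define K where "K = essential_range J X U"
  have K: "compact K" "K \<subseteq> \<O>"
    using assms(13,14) by (auto simp: K_def)
  have openX: "open X"
    using X by (simp add: open_domain_def)
  have U_fun: "U \<in> functions_on J X \<O>" and U_besov: "\<And>i. (\<lambda>x. U x $ i) \<in> besov_space \<alpha> 3 J X"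
    using assms(8) by (auto simp: besov_space_into_def)
  have U_per: "U (x + v) = U x" if "v \<in> periods J" "x \<in> X" for v x
    using U_fun that by (auto simp: functions_on_def)
  have G_loc: "(\<lambda>x. G (U x)) absolutely_integrable_on S" if "compact S" "S \<subseteq> X" for S
    using assms(9) that by (auto simp: weak_solution_def)
  have U_meas: "U \<in> borel_measurable (domain_measure J X)"
    using U_besov by (auto simp: vec_measurable_iff besov_space_def Lq_space_def)
  have U_K: "AE x in lebesgue. x \<in> X \<longrightarrow> U x \<in> K"
    using AE_essential_range[OF openX U_meas] unfolding K_def[symmetric]
    by (intro periodic_AE[OF X]) (auto simp: U_per)

  obtain M where M: "M \<ge> 0" "\<And>u. u \<in> K \<Longrightarrow> norm u \<le> M"
    using compact_imp_bounded[OF K(1)] by (meson bounded_pos less_imp_le)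
  obtain V0 where V0: "V0 \<in> borel_measurable borel" "AE x in lebesgue. indicator X x *\<^sub>R U x = V0 x"
    using borel_representative[OF periodic_measurable[OF X U_per U_meas]] by blast
  (* Almost all values of U lie in K, so truncating at the radius M changes V0 only on a null set of X. *)
  define V where "V x = (if norm (V0 x) \<le> M then V0 x else 0)" for x
  have V_meas: "V \<in> borel_measurable borel"
    using V0(1) unfolding V_def[abs_def] by measurable
  have V_bound: "norm (V x) \<le> M" for x
    using M(1) by (simp add: V_def)
  have V_U: "AE x in lebesgue. x \<in> X \<longrightarrow> V x = U x"
    using V0(2) U_K by eventually_elim (auto simp: V_def dest: M(2))
  have V_K_leb: "AE x in lebesgue. x \<in> X \<longrightarrow> V x \<in> K"
    using V_U U_K by eventually_elim auto
  then have V_K: "AE x in lborel. x \<in> X \<longrightarrow> V x \<in> K"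
    by (subst (asm) AE_completion_iff) (use openX V_meas K(1) in \<open>auto simp: compact_imp_closed\<close>)

  obtain \<eta> :: "real^'n \<Rightarrow> real" and r T where \<eta>: "r > 0" "\<And>i. Ck_on i \<eta> UNIV" "compact T" "T \<subseteq> \<O>"
    "\<And>u. u \<notin> T \<Longrightarrow> \<eta> u = 0" "\<And>p u. p \<in> K \<Longrightarrow> norm (u - p) < r \<Longrightarrow> \<eta> u = 1"
    by (rule smooth_cutoff[OF K open_\<O>]) (rule that)
  note extend = Ck_on_extend_by_zero[OF open_\<O> compact_imp_closed[OF \<eta>(3)] \<eta>(4) \<eta>(2)]
  obtain R where R: "\<And>u. norm u > R \<Longrightarrow> \<eta> u = 0"
  proof -
    obtain R where "\<forall>u\<in>T. norm u \<le> R"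
      using compact_imp_bounded[OF \<eta>(3)] bounded_iff by blast
    then show thesis
      using \<eta>(5) by (intro that[of R]) force
  qed
  have dQ: "((\<lambda>w. (Q w *v v) $ 1) has_derivative
      (\<lambda>h. B u $ 1 \<bullet> frechet_derivative (\<lambda>w. G w *v v) (at u) h)) (at u)" if "u \<in> \<O>" for u v
    using assms(12) that G by (intro companion_derivative) (auto simp: numeral_2_eq_2)
  have Gv: "Ck_on 2 (\<lambda>u. G u *v v) \<O>" for v
    by (rule Ck_on_matrix_apply[OF open_\<O> G])
  have B1: "Ck_on 1 (\<lambda>u. B u $ 1) \<O>"
    by (rule Ck_on_bounded_linear[OF open_\<O> bounded_linear_vec_nth B])
  have Qv: "Ck_on 1 (\<lambda>u. (Q u *v v) $ 1) \<O>" for v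
    unfolding C1_on_iff[OF open_\<O>]
  proof (intro exI conjI ballI allI)
    show "((\<lambda>w. (Q w *v v) $ 1) has_derivative
      (\<lambda>h. B u $ 1 \<bullet> frechet_derivative (\<lambda>w. G w *v v) (at u) h)) (at u)" if "u \<in> \<O>" for u
      by (rule dQ[OF that])
    have "Ck_on 1 (\<lambda>u. frechet_derivative (\<lambda>w. G w *v v) (at u) h) \<O>" for h
      using Gv[of v] by (simp add: numeral_2_eq_2)
    then show "continuous_on \<O> (\<lambda>u. B u $ 1 \<bullet> frechet_derivative (\<lambda>w. G w *v v) (at u) h)" for h
      using B1 by (intro continuous_on_inner Ck_on_continuous[of 1])
  qed

  define g where "g v u = \<eta> u *\<^sub>R (G u *v v)" for v u
  define q where "q v u = \<eta> u *\<^sub>R ((Q u *v v) $ 1)" for v u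
  define b where "b u = \<eta> u *\<^sub>R (B u $ 1)" for u
  define q' where "q' v = (\<lambda>u. frechet_derivative (q v) (at u))" for v
  have g_Ck: "Ck_on 2 (g v) UNIV" for v
    unfolding g_def by (rule extend[OF \<eta>(5) Gv])
  have "Ck_on 1 (q v) UNIV" for v
    unfolding q_def by (rule extend[OF \<eta>(5) Qv])
  then have q_C1: "C1_deriv (q v) (q' v)" for v
    using C1_deriv_of_Ck[of 0 "q v"] by (simp add: q'_def)
  have "Ck_on 1 b UNIV"
    unfolding b_def by (rule extend[OF \<eta>(5) B1])
  then have b_C1: "C1_deriv b (\<lambda>u. frechet_derivative b (at u))"
    using C1_deriv_of_Ck[of 0 b] by simp
  have compat: "q' v u h = b u \<bullet> frechet_derivative (g v) (at u) h"
    if p: "p \<in> K" "norm (u - p) < r" for v u h p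
  proof -
    have u: "u \<in> ball p r"
      using p(2) by (simp add: dist_norm norm_minus_commute)
    have one: "\<eta> w = 1" if "w \<in> ball p r" for w
      using \<eta>(6)[OF p(1)] that by (simp add: dist_norm norm_minus_commute)
    have "u \<in> \<O>"
      using one[OF u] \<eta>(4,5) by force
    have "q' v u = (\<lambda>h. B u $ 1 \<bullet> frechet_derivative (\<lambda>w. G w *v v) (at u) h)"
      unfolding q'_def
      by (rule frechet_derivative_cong_open[OF open_ball u _ dQ[OF \<open>u \<in> \<O>\<close>]]) (simp add: q_def one)
    moreover have "frechet_derivative (g v) (at u) = frechet_derivative (\<lambda>w. G w *v v) (at u)"
    proof (rule frechet_derivative_cong_open[OF open_ball u])
      show "((\<lambda>w. G w *v v) has_derivative frechet_derivative (\<lambda>w. G w *v v) (at u)) (at u)"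
        using Gv[of v] \<open>u \<in> \<O>\<close> by (intro Ck_on_differentiable[where k = 1]) (simp_all add: numeral_2_eq_2)
    qed (simp add: g_def one)
    ultimately show ?thesis
      by (simp add: b_def one[OF u])
  qed

  have one_AE: "AE x in lebesgue. x \<in> X \<longrightarrow> \<eta> (V x) = 1 \<and> V x = U x"
    using V_K_leb V_U by eventually_elim (use \<eta>(1,6) in auto)
  have aG: "continuous_on UNIV (\<lambda>u. \<eta> u *\<^sub>R G u)"
    by (rule Ck_on_continuous) (rule extend[OF \<eta>(5) G])
  have aQ: "continuous_on UNIV (\<lambda>u. \<eta> u *\<^sub>R Q u)"
    by (rule Ck_on_continuous[where k = 0], rule extend[OF \<eta>(5)]) (use assms(10) in simp_all)
  have aG_AE: "AE x in lebesgue. x \<in> X \<longrightarrow> \<eta> (V x) *\<^sub>R G (V x) = G (U x)"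
    using one_AE by eventually_elim auto
  have aQ_AE: "AE x in lebesgue. x \<in> X \<longrightarrow> \<eta> (V x) *\<^sub>R Q (V x) = Q (U x)"
    using one_AE by eventually_elim auto

  have Q_loc: "(\<lambda>x. Q (U x)) absolutely_integrable_on S" if S: "compact S" "S \<subseteq> X" for S
  proof -
    obtain c where c: "c > 0" "\<And>u. norm (\<eta> u *\<^sub>R Q u) \<le> c"
      using bounded_compact_support[OF aQ, of R] R by auto
    obtain \<rho> where \<rho>: "\<And>x. x \<in> S \<Longrightarrow> norm x \<le> \<rho>"
      using compact_imp_bounded[OF S(1)] by (meson bounded_iff)
    define F where "F x = indicator S x *\<^sub>R (\<eta> (V x) *\<^sub>R Q (V x))" for x
    have S_sets: "S \<in> sets borel"
      using S(1) by (simp add: compact_imp_closed borel_closed)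
    have "F \<in> borel_measurable borel"
      unfolding F_def
      by (intro borel_measurable_scaleR borel_measurable_indicator S_sets
          measurable_compose[OF V_meas borel_measurable_continuous_onI[OF aQ]])
    moreover have "norm (F x) \<le> c" for x
      using c(1) c(2)[of "V x"] by (auto simp: F_def indicator_def)
    moreover have "F x = 0" if "norm x > \<rho>" for x
      using \<rho>[of x] that by (force simp: F_def)
    ultimately have "integrable lborel F"
      by (rule integrable_bounded_support)
    then have F_int: "integrable lebesgue F"
      by (simp add: integrable_completion borel_measurable_integrable)
    have F_eq: "AE x in lebesgue. F x = indicator S x *\<^sub>R Q (U x)"
      using aQ_AE by eventually_elim (use S(2) in \<open>auto simp: F_def indicator_def\<close>)
    have "(\<lambda>x. indicator S x *\<^sub>R Q (U x)) \<in> borel_measurable lebesgue"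
      by (rule borel_measurable_AE[OF borel_measurable_integrable[OF F_int] F_eq])
    then have "integrable lebesgue (\<lambda>x. indicator S x *\<^sub>R Q (U x))"
      by (rule integrable_cong_AE_imp[OF F_int]) (use F_eq in eventually_elim, simp)
    then show ?thesis
      by (simp add: set_integrable_def)
  qed

  have G_weak: "weak_form {} X (\<lambda>x. G (U x))"
  proof -
    have "weak_form J X (\<lambda>x. G (U x))"
      using assms(9) by (simp add: weak_form_def weak_solution_def)
    then show ?thesis
      by (subst (asm) weak_form_periodic_iff[OF X]) (simp_all add: U_per G_loc)
  qed
  have "weak_form {} X (\<lambda>x. Q (U x))"
    unfolding weak_form_def
  proof (intro allI impI)
    fix \<psi> :: "real^'d \<Rightarrow> real^1" assume "test_function {} X \<psi>"
    then obtain S where \<psi>: "\<And>i. Ck_on i \<psi> UNIV" and S: "compact S" "S \<subseteq> X" "\<And>x. x \<notin> S \<Longrightarrow> \<psi> x = 0"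
      by (auto simp: test_function_euclidean_iff)
    have d\<psi>: "C1_deriv \<psi> (\<lambda>x. frechet_derivative \<psi> (at x))"
      using C1_deriv_of_Ck \<psi> by blast
    have \<psi>1: "C1_deriv (\<lambda>x. \<psi> x $ 1) (\<lambda>x v. frechet_derivative \<psi> (at x) v $ 1)"
      using C1_derivD[OF d\<psi>]
      by (auto simp: C1_deriv_def intro!: bounded_linear.has_derivative[OF bounded_linear_vec_nth]
          continuous_on_component)
    have "(\<integral>x. (\<Sum>v\<in>Basis. q v (V x) * frechet_derivative \<psi> (at x) v $ 1) \<partial>lborel) = 0"
    proof (rule companion_law_euclidean[where R = R, OF openX V_meas V_bound V_K _ assms(6) g_Ck _ q_C1 _ b_C1 _ \<eta>(1) compat _ \<psi>1 S(1,2)])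
      show "\<exists>c d. d > 0 \<and> (\<forall>y. norm y < d \<longrightarrow>
          (\<integral>x. indicator S x * norm (V x - V (x - y)) ^ 3 \<partial>lborel) \<le> c * norm y powr (3 * \<alpha>))"
        if "compact S" "S \<subseteq> X" for S
        by (rule besov_local_representative[OF X U_besov V_meas V_bound V_U that])
      fix \<phi> :: "real^'d \<Rightarrow> real^'n" and S
      assume \<phi>: "\<And>i. Ck_on i \<phi> UNIV" and S: "compact S" "S \<subseteq> X" "\<And>x. x \<notin> S \<Longrightarrow> \<phi> x = 0"
      then have "test_function {} X \<phi>"
        unfolding test_function_euclidean_iff by blast
      then have "(\<integral>x. G (U x) \<bullet> jacobian \<phi> (at x) \<partial>domain_measure {} X) = 0"
        using G_weak by (simp add: weak_form_def)
      then show "(\<integral>x. (\<Sum>v\<in>Basis. g v (V x) \<bullet> frechet_derivative \<phi> (at x) v) \<partial>lborel) = 0"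
        using weak_integral_eq[OF openX V_meas aG aG_AE G_loc \<phi> S]
        by (simp add: g_def scaleR_matrix_vector_assoc)
    qed (simp_all add: g_def q_def b_def R S(3))
    moreover have "(\<Sum>v\<in>Basis. q v (V x) * frechet_derivative \<psi> (at x) v $ 1)
        = (\<Sum>v\<in>Basis. ((\<eta> (V x) *\<^sub>R Q (V x)) *v v) \<bullet> frechet_derivative \<psi> (at x) v)" for x
      by (simp add: q_def inner_vec_def scaleR_matrix_vector_assoc[symmetric])
    ultimately show "(\<integral>x. Q (U x) \<bullet> jacobian \<psi> (at x) \<partial>domain_measure {} X) = 0"
      using weak_integral_eq[OF openX V_meas aQ aQ_AE Q_loc \<psi> S] by simp
  qed
  then have "weak_form J X (\<lambda>x. Q (U x))"
    by (subst weak_form_periodic_iff[OF X]) (simp_all add: U_per Q_loc)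
  then show ?thesis
    unfolding weak_solution_def weak_form_def using U_fun Q_loc by blast
qed

end
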